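(* Let $\mathbb{D}=\{z\in\mathbb{C}:|z|<1\}$, let $\mathfrak{b}(z,w)=(1-z\overline{w})^{-2}$ be the Bergman kernel on $\mathbb{D}$, and let $$\ell(z,w)=\frac{1}{1-9z\overline{w}},\qquad z,w\in\tfrac13\mathbb{D}.$$ Then $(\mathfrak{b},\ell)$ is a complete Pick pair on $\frac13\mathbb{D}$, but there does not exist a strong Shimorin certificate $s$ for $(\mathfrak{b},\ell)$ on $\frac13\mathbb{D}$ such that, if $\tilde{s}$ is any strong Shimorin certificate for $(\mathfrak{b},\ell)$ on $\frac13\mathbb{D}$, then $s$ is a factor of $\tilde{s}$.
   Context: A kernel on a non-empty set $X$ is a function $k:X\times X\to\mathbb{C}$ such that $[k(z_i,z_j)]_{i,j=1}^n$ is positive semi-definite for all finite choices of points; $\mathcal{H}_k$ is the reproducing kernel Hilbert space. $\mathrm{Mult}(\mathcal{H}_k\otimes\mathbb{C}^N,\mathcal{H}_\ell\otimes\mathbb{C}^N)$ is the set of $\Phi:X\to\mathbb{M}_N$ (complex $N\times N$ matrices) with $\Phi f\in\mathcal{H}_\ell\otimes\mathbb{C}^N$ for all $f\in\mathcal{H}_k\otimes\mathbb{C}^N$, normed by the operator norm of $f\mapsto\Phi f$. $(k,\ell)$ is a complete Pick pair on $X$ if for all $n,N\ge1$, all $z_1,\dots,z_n\in X$ and all $W_1,\dots,W_n\in\mathbb{M}_N$ with $[\ell(z_i,z_j)I_{N\times N}-k(z_i,z_j)W_iW_j^*]_{i,j=1}^n$ positive semi-definite, there is $\Phi\in\mathrm{Mult}(\mathcal{H}_k\otimes\mathbb{C}^N,\mathcal{H}_\ell\otimes\mathbb{C}^N)$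 of norm at most one with $\Phi(z_i)=W_i$ for all $i$. A kernel $s$ is a complete Pick kernel if $(s,s)$ is a complete Pick pair. A strong Shimorin certificate for $(k,\ell)$ on $X$ is a complete Pick kernel $s$ on $X$ for which there are kernels $h,g$ on $X$ with $k=(1-h)s$ and $\ell=sg$. A kernel $s$ is a factor of a kernel $\tilde{s}$ on $X$ if there is a kernel $g$ on $X$ with $\tilde{s}=gs$. *)

theory Defs
  imports
    "HOL-Library.Extended_Nonnegative_Real"
    "Jordan_Normal_Form.Schur_Decomposition"
begin

definition psd :: "nat \<Rightarrow> complex mat \<Rightarrow> bool" where
  "psd n A \<longleftrightarrow> A \<in> carrier_mat n n \<and> (\<forall>v \<in> carrier_vec n. 0 \<le> (A *\<^sub>v v) \<bullet>c v)"

text \<open>The order on \<^typ>\<open>complex\<close> is the one of \<^theory>\<open>HOL-Library.Complex_Order\<close>: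
  \<open>0 \<le> z\<close> says that \<open>z\<close> is real and nonnegative.\<close>

definition block_mat :: "nat \<Rightarrow> nat \<Rightarrow> (nat \<Rightarrow> nat \<Rightarrow> complex mat) \<Rightarrow> complex mat" where
  "block_mat n N B = mat (n * N) (n * N)
     (\<lambda>(p, q). B (p div N) (q div N) $$ (p mod N, q mod N))"

definition kernel_on :: "'a set \<Rightarrow> ('a \<Rightarrow> 'a \<Rightarrow> complex) \<Rightarrow> bool" where
  "kernel_on X k \<longleftrightarrow> X \<noteq> {} \<and>
     (\<forall>n. \<forall>z :: nat \<Rightarrow> 'a. (\<forall>i<n. z i \<in> X) \<longrightarrow> psd n (mat n n (\<lambda>(i, j). k (z i) (z j))))"

text \<open>Functions on \<open>X\<close> are represented by functions on the whole type that vanish outside \<open>X\<close>.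
  Inner products are linear in the first argument.\<close>

definition kernel_fun :: "'a set \<Rightarrow> ('a \<Rightarrow> 'a \<Rightarrow> complex) \<Rightarrow> 'a \<Rightarrow> 'a \<Rightarrow> complex" where
  "kernel_fun X k w = (\<lambda>z. if z \<in> X then k z w else 0)"

locale pre_rkhs =
  fixes X :: "'a set" and k :: "'a \<Rightarrow> 'a \<Rightarrow> complex"
    and H :: "('a \<Rightarrow> complex) set" and ip :: "('a \<Rightarrow> complex) \<Rightarrow> ('a \<Rightarrow> complex) \<Rightarrow> complex"
  assumes supp: "f \<in> H \<Longrightarrow> z \<notin> X \<Longrightarrow> f z = 0"
    and zero: "(\<lambda>_. 0) \<in> H"
    and add: "f \<in> H \<Longrightarrow> g \<in> H \<Longrightarrow> (\<lambda>z. f z + g z) \<in> H"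
    and scale: "f \<in> H \<Longrightarrow> (\<lambda>z. c * f z) \<in> H"
    and ip_add: "f \<in> H \<Longrightarrow> g \<in> H \<Longrightarrow> h \<in> H \<Longrightarrow> ip (\<lambda>z. f z + g z) h = ip f h + ip g h"
    and ip_scale: "f \<in> H \<Longrightarrow> h \<in> H \<Longrightarrow> ip (\<lambda>z. c * f z) h = c * ip f h"
    and ip_cnj: "f \<in> H \<Longrightarrow> g \<in> H \<Longrightarrow> ip g f = cnj (ip f g)"
    and ip_nonneg: "f \<in> H \<Longrightarrow> 0 \<le> ip f f"
    and ip_definite: "f \<in> H \<Longrightarrow> ip f f = 0 \<Longrightarrow> f = (\<lambda>_. 0)"
    and kernel_mem: "w \<in> X \<Longrightarrow> kernel_fun X k w \<in> H"
    and reproducing: "f \<in> H \<Longrightarrow> w \<in> X \<Longrightarrow> ip f (kernel_fun X k w) = f w"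
begin

definition nrm :: "('a \<Rightarrow> complex) \<Rightarrow> real" where
  "nrm f = sqrt (Re (ip f f))"

definition cauchy :: "(nat \<Rightarrow> 'a \<Rightarrow> complex) \<Rightarrow> bool" where
  "cauchy F \<longleftrightarrow> (\<forall>e>0. \<exists>M. \<forall>m\<ge>M. \<forall>n\<ge>M. nrm (\<lambda>z. F m z - F n z) < e)"

end

locale rkhs = pre_rkhs +
  assumes complete: "(\<And>n. F n \<in> H) \<Longrightarrow> cauchy F \<Longrightarrow>
    \<exists>f\<in>H. (\<lambda>n. nrm (\<lambda>z. F n z - f z)) \<longlonglongrightarrow> 0"

text \<open>We show that every kernel has exactly one reproducing kernel Hilbert space
  (Moore--Aronszajn).\<close>

context pre_rkhs
begin

lemma diff: assumes "f \<in> H" "g \<in> H" shows "(\<lambda>z. f z - g z) \<in> H"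
  using add[OF assms(1) scale[OF assms(2), of "-1"]] by simp

lemma ip_add2: "f \<in> H \<Longrightarrow> g \<in> H \<Longrightarrow> h \<in> H \<Longrightarrow> ip h (\<lambda>z. f z + g z) = ip h f + ip h g"
  by (simp add: ip_cnj[of _ h] add ip_add)

lemma ip_scale2: "f \<in> H \<Longrightarrow> h \<in> H \<Longrightarrow> ip h (\<lambda>z. c * f z) = cnj c * ip h f"
  by (simp add: ip_cnj[of _ h] scale ip_scale)

lemma ip_diff: assumes "f \<in> H" "g \<in> H" "h \<in> H"
  shows "ip (\<lambda>z. f z - g z) h = ip f h - ip g h"
  using ip_add[OF assms(1) scale[OF assms(2), of "-1"] assms(3)] ip_scale[of g h "-1"] assms by simp

lemma ip_diff2: "f \<in> H \<Longrightarrow> g \<in> H \<Longrightarrow> h \<in> H \<Longrightarrow> ip h (\<lambda>z. f z - g z) = ip h f - ip h g"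
  by (simp add: ip_cnj[of _ h] diff ip_diff)

lemma nrm_nonneg [simp]: "f \<in> H \<Longrightarrow> 0 \<le> nrm f"
  using ip_nonneg[of f] by (simp add: nrm_def less_eq_complex_def)

lemma nrm_sq: "f \<in> H \<Longrightarrow> ip f f = complex_of_real ((nrm f)\<^sup>2)"
  using ip_nonneg[of f] by (auto simp add: nrm_def less_eq_complex_def complex_eq_iff)

lemma nrm_sq_Re: "f \<in> H \<Longrightarrow> (nrm f)\<^sup>2 = Re (ip f f)"
  by (simp add: nrm_sq)

lemma nrm_add_sq: assumes "f \<in> H" "g \<in> H"
  shows "(nrm (\<lambda>z. f z + g z))\<^sup>2 = (nrm f)\<^sup>2 + 2 * Re (ip f g) + (nrm g)\<^sup>2"
  using assms by (simp add: nrm_sq_Re add ip_add ip_add2 ip_cnj[of f g])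

lemma nrm_scale: assumes "f \<in> H" shows "nrm (\<lambda>z. c * f z) = cmod c * nrm f"
proof -
  have "ip (\<lambda>z. c * f z) (\<lambda>z. c * f z) = complex_of_real ((cmod c * nrm f)\<^sup>2)"
  proof -
    have "ip (\<lambda>z. c * f z) (\<lambda>z. c * f z) = (c * cnj c) * ip f f"
      using assms by (simp add: scale ip_scale ip_scale2)
    then show ?thesis
      using assms by (simp only: complex_norm_square[symmetric] nrm_sq power_mult_distrib of_real_mult)
  qed
  then show ?thesis using assms by (simp add: nrm_def[of "\<lambda>z. c * f z"] real_sqrt_mult)
qed

lemma nrm_minus: assumes "f \<in> H" "g \<in> H"
  shows "nrm (\<lambda>z. f z - g z) = nrm (\<lambda>z. g z - f z)"
  using nrm_scale[OF diff[OF assms], of "-1"] by simp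

lemma cauchy_schwarz: assumes "f \<in> H" "g \<in> H" shows "cmod (ip f g) \<le> nrm f * nrm g"
proof (cases "ip g g = 0")
  case True
  then have "g = (\<lambda>_. 0)" using ip_definite assms by blast
  then have "ip f g = 0" using ip_scale2[OF zero assms(1), of 0] by simp
  then show ?thesis using assms by simp
next
  case False
  define d where "d = (nrm g)\<^sup>2"
  have d: "d > 0" "ip g g = of_real d" using False assms by (auto simp: nrm_sq d_def)
  define t where "t = - ip f g / of_real d"
  have "0 \<le> (nrm (\<lambda>z. f z + t * g z))\<^sup>2" by simp
  also have "\<dots> = (nrm f)\<^sup>2 + 2 * Re (cnj t * ip f g) + (cmod t)\<^sup>2 * d"
    using assms by (simp add: nrm_add_sq scale nrm_scale ip_scale2 power_mult_distrib d_def)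
  also have "cnj t * ip f g = - of_real ((cmod (ip f g))\<^sup>2 / d)"
    by (simp add: t_def complex_norm_square mult.commute del: of_real_power)
  also have "(cmod t)\<^sup>2 * d = (cmod (ip f g))\<^sup>2 / d"
    using d by (simp add: t_def norm_divide power_divide power2_eq_square)
  finally have "(cmod (ip f g))\<^sup>2 / d \<le> (nrm f)\<^sup>2" by simp
  then have "(cmod (ip f g))\<^sup>2 \<le> (nrm f * nrm g)\<^sup>2"
    using d by (simp add: divide_le_eq d_def power_mult_distrib)
  then show ?thesis by (rule power2_le_imp_le) (simp add: assms)
qed

lemma nrm_triangle: assumes "f \<in> H" "g \<in> H"
  shows "nrm (\<lambda>z. f z + g z) \<le> nrm f + nrm g"
proof (rule power2_le_imp_le)
  have "Re (ip f g) \<le> nrm f * nrm g"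
    using cauchy_schwarz[OF assms] complex_Re_le_cmod order_trans by blast
  then show "(nrm (\<lambda>z. f z + g z))\<^sup>2 \<le> (nrm f + nrm g)\<^sup>2"
    using assms by (simp add: nrm_add_sq power2_sum)
qed (use assms in simp)

lemma nrm_triangle_diff: assumes "f \<in> H" "g \<in> H" "h \<in> H"
  shows "nrm (\<lambda>z. f z - h z) \<le> nrm (\<lambda>z. f z - g z) + nrm (\<lambda>z. g z - h z)"
  using nrm_triangle[OF diff[OF assms(1,2)] diff[OF assms(2,3)]] by simp

lemma eval_bound: assumes "f \<in> H" "z \<in> X"
  shows "cmod (f z) \<le> nrm f * nrm (kernel_fun X k z)"
  using cauchy_schwarz[OF assms(1) kernel_mem[OF assms(2)]] reproducing[OF assms] by simp

lemma conv_pointwise: assumes "\<And>n. F n \<in> H" "f \<in> H" "(\<lambda>n. nrm (\<lambda>z. F n z - f z)) \<longlonglongrightarrow> 0"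
  shows "(\<lambda>n. F n z) \<longlonglongrightarrow> f z"
proof (cases "z \<in> X")
  case True
  have "(\<lambda>n. F n z - f z) \<longlonglongrightarrow> 0"
    by (rule tendsto_0_le[OF assms(3), where K = "nrm (kernel_fun X k z)"])
      (use eval_bound[OF diff[OF assms(1,2)] True] assms in \<open>auto simp: diff\<close>)
  then show ?thesis by (simp add: LIM_zero_iff)
next
  case False
  then have "F n z = 0" "f z = 0" for n using supp assms by auto
  then show ?thesis by simp
qed

lemma conv_ip: assumes "\<And>n. F n \<in> H" "f \<in> H" "(\<lambda>n. nrm (\<lambda>z. F n z - f z)) \<longlonglongrightarrow> 0" "h \<in> H"
  shows "(\<lambda>n. ip (F n) h) \<longlonglongrightarrow> ip f h"
proof -
  have "(\<lambda>n. ip (F n) h - ip f h) \<longlonglongrightarrow> 0"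
    by (rule tendsto_0_le[OF assms(3), where K = "nrm h"])
      (use cauchy_schwarz[OF diff[OF assms(1,2)] assms(4)] assms in \<open>auto simp: ip_diff diff\<close>)
  then show ?thesis by (simp add: LIM_zero_iff)
qed

lemma cauchyD: "cauchy F \<Longrightarrow> e > 0 \<Longrightarrow> \<exists>M. \<forall>m\<ge>M. \<forall>n\<ge>M. nrm (\<lambda>z. F m z - F n z) < e"
  by (simp add: cauchy_def)

lemma conv_cauchy: assumes "\<And>n. F n \<in> H" "f \<in> H" "(\<lambda>n. nrm (\<lambda>z. F n z - f z)) \<longlonglongrightarrow> 0"
  shows "cauchy F"
  unfolding cauchy_def
proof (intro allI impI)
  fix e :: real assume "e > 0"
  then obtain M where M: "\<And>n. n \<ge> M \<Longrightarrow> nrm (\<lambda>z. F n z - f z) < e / 2"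
    using LIMSEQ_D[OF assms(3), of "e/2"] assms by (auto simp: diff abs_of_nonneg)
  have "nrm (\<lambda>z. F m z - F n z) < e" if "m \<ge> M" "n \<ge> M" for m n
    using nrm_triangle_diff[OF assms(1,2,1), of m n] M[OF that(1)] M[OF that(2)]
      nrm_minus[OF assms(1,2), of n] by linarith
  then show "\<exists>M. \<forall>m\<ge>M. \<forall>n\<ge>M. nrm (\<lambda>z. F m z - F n z) < e" by (intro exI[of _ M] allI impI)
qed

lemma cauchy_bounded: assumes "\<And>n. F n \<in> H" "cauchy F"
  shows "\<exists>C. \<forall>n. nrm (F n) \<le> C"
proof -
  from assms(2) have "\<exists>M. \<forall>m\<ge>M. \<forall>n\<ge>M. nrm (\<lambda>z. F m z - F n z) < 1"
    by (rule cauchyD) simp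
  then obtain M where "\<forall>m\<ge>M. \<forall>n\<ge>M. nrm (\<lambda>z. F m z - F n z) < 1" ..
  then have M: "nrm (\<lambda>z. F n z - F M z) < 1" if "n \<ge> M" for n using that by simp
  define C where "C = (\<Sum>i\<le>M. nrm (F i)) + 1"
  have le: "nrm (F i) \<le> (\<Sum>i\<le>M. nrm (F i))" if "i \<le> M" for i
    using that assms by (intro member_le_sum) auto
  have "nrm (F n) \<le> C" for n
  proof (cases "n \<le> M")
    case True
    then show ?thesis using le[of n] by (simp add: C_def)
  next
    case False
    have "nrm (F n) \<le> nrm (\<lambda>z. F n z - F M z) + nrm (F M)"
      using nrm_triangle[OF diff[OF assms(1,1)] assms(1), of n M M] by simp
    then show ?thesis using M[of n] le[of M] False by (simp add: C_def)
  qed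
  then show ?thesis by blast
qed

lemma cauchy_pointwise: assumes "\<And>n. F n \<in> H" "cauchy F"
  shows "Cauchy (\<lambda>n. F n z)"
proof (cases "z \<in> X")
  case False
  then have "F n z = 0" for n using supp assms by simp
  then show ?thesis by (simp add: Cauchy_def)
next
  case True
  show ?thesis
  proof (rule metric_CauchyI)
    fix e :: real assume e: "e > 0"
    define C where "C = nrm (kernel_fun X k z) + 1"
    have "0 \<le> nrm (kernel_fun X k z)" using True by (simp add: kernel_mem)
    then have C: "C > 0" "nrm (kernel_fun X k z) \<le> C" by (auto simp: C_def)
    then have "e / C > 0" using e by simp
    with assms(2) have "\<exists>M. \<forall>m\<ge>M. \<forall>n\<ge>M. nrm (\<lambda>z. F m z - F n z) < e / C"
      by (rule cauchyD)
    then obtain M where "\<forall>m\<ge>M. \<forall>n\<ge>M. nrm (\<lambda>z. F m z - F n z) < e / C" ..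
    then have M: "nrm (\<lambda>z. F m z - F n z) < e / C" if "m \<ge> M" "n \<ge> M" for m n using that by simp
    have "dist (F m z) (F n z) < e" if "m \<ge> M" "n \<ge> M" for m n
    proof -
      have "cmod (F m z - F n z) \<le> nrm (\<lambda>z. F m z - F n z) * nrm (kernel_fun X k z)"
        using eval_bound[OF diff[OF assms(1,1)] True] by simp
      also have "\<dots> \<le> nrm (\<lambda>z. F m z - F n z) * C"
        using C assms by (intro mult_left_mono) (auto simp: diff)
      also have "\<dots> < e" using M[OF that] C by (simp add: field_simps)
      finally show ?thesis by (simp add: dist_norm)
    qed
    then show "\<exists>M. \<forall>m\<ge>M. \<forall>n\<ge>M. dist (F m z) (F n z) < e" by blast
  qed
qed

end

inductive_set kspan :: "'a set \<Rightarrow> ('a \<Rightarrow> 'a \<Rightarrow> complex) \<Rightarrow> ('a \<Rightarrow> complex) set" for X k where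
  kspan_zero: "(\<lambda>_. 0) \<in> kspan X k"
| kspan_step: "g \<in> kspan X k \<Longrightarrow> w \<in> X \<Longrightarrow> (\<lambda>z. g z + c * kernel_fun X k w z) \<in> kspan X k"

lemma kspan_add: assumes "f \<in> kspan X k" "g \<in> kspan X k"
  shows "(\<lambda>z. f z + g z) \<in> kspan X k"
  using assms(2)
proof induction
  case kspan_zero
  then show ?case using assms(1) by simp
next
  case (kspan_step g w c)
  then show ?case using kspan.kspan_step[OF kspan_step.IH kspan_step.hyps(2), of c]
    by (simp add: add.assoc)
qed

lemma kspan_scale: assumes "f \<in> kspan X k" shows "(\<lambda>z. a * f z) \<in> kspan X k"
  using assms
proof induction
  case kspan_zero
  then show ?case using kspan.kspan_zero by simp
next
  case (kspan_step g w c)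
  then show ?case using kspan.kspan_step[OF kspan_step.IH kspan_step.hyps(2), of "a * c"]
    by (simp add: algebra_simps)
qed

lemma kspan_diff: assumes "f \<in> kspan X k" "g \<in> kspan X k"
  shows "(\<lambda>z. f z - g z) \<in> kspan X k"
  using kspan_add[OF assms(1) kspan_scale[OF assms(2), of "-1"]] by simp

lemma kspan_kernel: "w \<in> X \<Longrightarrow> kernel_fun X k w \<in> kspan X k"
  using kspan_step[OF kspan_zero, of w X 1] by simp

lemma zero_if_quadratic: fixes a :: complex
  assumes "\<And>c. 2 * Re (cnj c * a) \<le> (cmod c)\<^sup>2 * b" "b \<ge> 0"
  shows "a = 0"
proof (rule ccontr)
  assume "a \<noteq> 0"
  define t where "t = 1 / (b + 1)"
  have t: "t > 0" "t * b < 1" using assms(2) by (auto simp: t_def field_simps)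
  have re: "Re (cnj (of_real t * a) * a) = t * (cmod a)\<^sup>2"
    unfolding cmod_power2 by (simp add: power2_eq_square algebra_simps)
  have "2 * (t * (cmod a)\<^sup>2) \<le> (cmod (of_real t * a))\<^sup>2 * b"
    using assms(1)[of "of_real t * a"] unfolding re .
  also have "\<dots> = (t * cmod a)\<^sup>2 * b" using t by (simp add: norm_mult)
  also have "\<dots> = (t * b) * (t * (cmod a)\<^sup>2)" by (simp add: power2_eq_square)
  also have "\<dots> \<le> 1 * (t * (cmod a)\<^sup>2)" using t by (intro mult_right_mono) auto
  finally show False using t \<open>a \<noteq> 0\<close> by simp
qed

context pre_rkhs
begin

lemma ip_zero: "h \<in> H \<Longrightarrow> ip (\<lambda>_. 0) h = 0"
  using ip_scale[OF zero, of h 0] by simp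

lemma ip_kernel: "f \<in> H \<Longrightarrow> w \<in> X \<Longrightarrow> ip (kernel_fun X k w) f = cnj (f w)"
  using ip_cnj[OF _ kernel_mem] reproducing by metis

lemma kspan_subset: assumes "g \<in> kspan X k" shows "g \<in> H"
  using assms
proof induction
  case kspan_zero
  then show ?case by (rule zero)
next
  case (kspan_step g w c)
  then show ?case by (intro add scale kernel_mem)
qed

lemma nrm_zero [simp]: "nrm (\<lambda>_. 0) = 0"
  by (simp add: nrm_def ip_zero[OF zero])

lemma ip_step: "g \<in> H \<Longrightarrow> h \<in> H \<Longrightarrow> w \<in> X \<Longrightarrow>
    ip (\<lambda>z. g z + c * kernel_fun X k w z) h = ip g h + c * cnj (h w)"
  by (simp only: ip_add scale kernel_mem ip_scale ip_kernel)

lemma parallelogram: assumes "f \<in> H" "g \<in> H"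
  shows "(nrm (\<lambda>z. f z + g z))\<^sup>2 + (nrm (\<lambda>z. f z - g z))\<^sup>2 = 2 * (nrm f)\<^sup>2 + 2 * (nrm g)\<^sup>2"
  using assms by (simp add: nrm_sq_Re add diff ip_add ip_add2 ip_diff ip_diff2)

end

context rkhs
begin

lemma kspan_dense: assumes f: "f \<in> H"
  shows "\<exists>F. (\<forall>n. F n \<in> kspan X k) \<and> (\<lambda>n. nrm (\<lambda>z. F n z - f z)) \<longlonglongrightarrow> 0"
proof -
  define S where "S = (\<lambda>g. (nrm (\<lambda>z. f z - g z))\<^sup>2) ` kspan X k"
  define d where "d = Inf S"
  define r :: "nat \<Rightarrow> real" where "r n = 1 / real (Suc n)" for n
  have r: "r n > 0" for n by (simp add: r_def)
  have bdd: "bdd_below S" by (rule bdd_belowI[of _ 0]) (auto simp: S_def)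
  have ne: "S \<noteq> {}" using kspan_zero by (auto simp: S_def)
  have d_le: "d \<le> (nrm (\<lambda>z. f z - g z))\<^sup>2" if "g \<in> kspan X k" for g
    unfolding d_def using that by (intro cInf_lower bdd) (auto simp: S_def)
  have "\<exists>g \<in> kspan X k. (nrm (\<lambda>z. f z - g z))\<^sup>2 < d + r n" for n
    using cInf_lessD[OF ne, of "d + r n"] r[of n] by (auto simp: d_def S_def)
  then obtain G where G: "\<And>n. G n \<in> kspan X k" "\<And>n. (nrm (\<lambda>z. f z - G n z))\<^sup>2 < d + r n"
    by metis
  have GH: "G n \<in> H" for n using kspan_subset G by blast
  have close: "(nrm (\<lambda>z. G m z - G n z))\<^sup>2 \<le> 2 * r m + 2 * r n" for m n
  proof -
    let ?h = "\<lambda>z. f z - (1/2) * (G n z + G m z)"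
    have mem: "?h \<in> H" by (intro diff f scale add GH)
    have "d \<le> (nrm ?h)\<^sup>2" by (intro d_le kspan_scale kspan_add G)
    then have "4 * d \<le> (nrm (\<lambda>z. 2 * ?h z))\<^sup>2" by (simp only: nrm_scale[OF mem]) (simp add: power_mult_distrib)
    also have "(\<lambda>z. 2 * ?h z) = (\<lambda>z. (f z - G n z) + (f z - G m z))"
      by (simp add: fun_eq_iff field_simps)
    finally have "4 * d \<le> (nrm (\<lambda>z. (f z - G n z) + (f z - G m z)))\<^sup>2" .
    moreover have "(\<lambda>z. (f z - G n z) - (f z - G m z)) = (\<lambda>z. G m z - G n z)" by (simp add: fun_eq_iff)
    ultimately show ?thesis
      using parallelogram[OF diff[OF f GH] diff[OF f GH], of n m] G(2)[of n] G(2)[of m] by simp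
  qed
  have "cauchy G"
    unfolding cauchy_def
  proof (intro allI impI)
    fix e :: real assume e: "e > 0"
    then have "0 < e\<^sup>2 / 4" by simp
    then obtain M where M: "r M < e\<^sup>2 / 4"
      using nat_approx_posE[of "e\<^sup>2/4"] by (auto simp: r_def)
    have "nrm (\<lambda>z. G m z - G n z) < e" if "m \<ge> M" "n \<ge> M" for m n
    proof (rule power2_less_imp_less)
      have "r m \<le> r M" "r n \<le> r M" using that by (auto simp: r_def field_simps)
      then show "(nrm (\<lambda>z. G m z - G n z))\<^sup>2 < e\<^sup>2" using close[of m n] M by simp
    qed (use e in simp)
    then show "\<exists>M. \<forall>m\<ge>M. \<forall>n\<ge>M. nrm (\<lambda>z. G m z - G n z) < e" by (intro exI[of _ M] allI impI)
  qed
  then obtain g where g: "g \<in> H" "(\<lambda>n. nrm (\<lambda>z. G n z - g z)) \<longlonglongrightarrow> 0"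
    using complete[of G] GH by blast
  have "f w - g w = 0" if w: "w \<in> X" for w
  proof (rule zero_if_quadratic)
    let ?k = "kernel_fun X k w"
    fix c :: complex
    have ineq: "2 * Re (cnj c * (f w - G n w)) - (cmod c)\<^sup>2 * (nrm ?k)\<^sup>2 \<le> r n" for n
    proof -
      have "d \<le> (nrm (\<lambda>z. f z - (G n z + c * ?k z)))\<^sup>2"
        by (intro d_le kspan_step G w)
      also have "(\<lambda>z. f z - (G n z + c * ?k z)) = (\<lambda>z. (f z - G n z) + (- c) * ?k z)"
        by (simp add: fun_eq_iff)
      also have "(nrm \<dots>)\<^sup>2 = (nrm (\<lambda>z. f z - G n z))\<^sup>2
          + 2 * Re (ip (\<lambda>z. f z - G n z) (\<lambda>z. (- c) * ?k z)) + (nrm (\<lambda>z. (- c) * ?k z))\<^sup>2"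
        by (intro nrm_add_sq diff f GH scale kernel_mem w)
      also have "ip (\<lambda>z. f z - G n z) (\<lambda>z. (- c) * ?k z) = - (cnj c * (f w - G n w))"
        by (simp only: ip_scale2[OF kernel_mem[OF w] diff[OF f GH]] reproducing[OF diff[OF f GH] w]) simp
      also have "(nrm (\<lambda>z. (- c) * ?k z))\<^sup>2 = (cmod c)\<^sup>2 * (nrm ?k)\<^sup>2"
        by (simp only: nrm_scale[OF kernel_mem[OF w]] power_mult_distrib norm_minus_cancel)
      finally show ?thesis using G(2)[of n] by simp
    qed
    have "(\<lambda>n. 2 * Re (cnj c * (f w - G n w)) - (cmod c)\<^sup>2 * (nrm ?k)\<^sup>2)
        \<longlonglongrightarrow> 2 * Re (cnj c * (f w - g w)) - (cmod c)\<^sup>2 * (nrm ?k)\<^sup>2"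
      by (intro tendsto_intros conv_pointwise GH g)
    moreover have "r \<longlonglongrightarrow> 0"
      using LIMSEQ_inverse_real_of_nat by (simp add: r_def[abs_def] inverse_eq_divide)
    ultimately have "2 * Re (cnj c * (f w - g w)) - (cmod c)\<^sup>2 * (nrm ?k)\<^sup>2 \<le> 0"
      by (rule LIMSEQ_le) (use ineq in blast)
    then show "2 * Re (cnj c * (f w - g w)) \<le> (cmod c)\<^sup>2 * (nrm ?k)\<^sup>2" by simp
  qed simp
  then have "f = g" using supp f g by (metis eq_iff_diff_eq_0 ext)
  then show ?thesis using G g by blast
qed

end

lemma rkhs_transfer:
  assumes 1: "rkhs X k H1 ip1" and 2: "rkhs X k H2 ip2" and f: "f \<in> H1"
  shows "f \<in> H2 \<and> (\<exists>F. (\<forall>n. F n \<in> kspan X k) \<and>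
    (\<lambda>n. pre_rkhs.nrm ip1 (\<lambda>z. F n z - f z)) \<longlonglongrightarrow> 0 \<and>
    (\<lambda>n. pre_rkhs.nrm ip2 (\<lambda>z. F n z - f z)) \<longlonglongrightarrow> 0)"
proof -
  interpret A: rkhs X k H1 ip1 by fact
  interpret B: rkhs X k H2 ip2 by fact
  have "ip1 g h = ip2 g h" if "g \<in> kspan X k" "h \<in> kspan X k" for g h
    using that(1)
  proof induction
    case kspan_zero
    then show ?case using that A.ip_zero A.kspan_subset B.ip_zero B.kspan_subset by simp
  next
    case (kspan_step g w c)
    then show ?case
      by (simp only: A.ip_step[OF A.kspan_subset[OF kspan_step.hyps(1)] A.kspan_subset[OF that(2)]]
          B.ip_step[OF B.kspan_subset[OF kspan_step.hyps(1)] B.kspan_subset[OF that(2)]])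
  qed
  then have nrm_eq: "A.nrm g = B.nrm g" if "g \<in> kspan X k" for g
    using that by (simp add: A.nrm_def B.nrm_def)
  obtain F where F: "\<And>n. F n \<in> kspan X k" "(\<lambda>n. A.nrm (\<lambda>z. F n z - f z)) \<longlonglongrightarrow> 0"
    using A.kspan_dense[OF f] by blast
  have F': "F n \<in> H1" "F n \<in> H2" for n using F A.kspan_subset B.kspan_subset by auto
  have "A.cauchy F" by (rule A.conv_cauchy[OF F'(1) f F(2)])
  then have "B.cauchy F"
    by (simp add: A.cauchy_def B.cauchy_def nrm_eq kspan_diff F)
  then obtain f2 where f2: "f2 \<in> H2" "(\<lambda>n. B.nrm (\<lambda>z. F n z - f2 z)) \<longlonglongrightarrow> 0"
    using B.complete[of F] F' by blast
  have "f z = f2 z" for z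
    using LIMSEQ_unique[OF A.conv_pointwise[OF F'(1) f F(2)] B.conv_pointwise[OF F'(2) f2]] .
  then have "f = f2" by blast
  then show ?thesis using F f2 by blast
qed

theorem rkhs_unique:
  assumes "rkhs X k H1 ip1" "rkhs X k H2 ip2"
  shows "H1 = H2" "f \<in> H1 \<Longrightarrow> h \<in> H1 \<Longrightarrow> ip1 f h = ip2 f h"
proof -
  interpret A: rkhs X k H1 ip1 by fact
  interpret B: rkhs X k H2 ip2 by fact
  show eq: "H1 = H2" using rkhs_transfer[OF assms] rkhs_transfer[OF assms(2,1)] by blast
  show "ip1 f h = ip2 f h" if f: "f \<in> H1" and h: "h \<in> H1"
  proof -
    obtain F where F: "\<And>n. F n \<in> kspan X k" "(\<lambda>n. A.nrm (\<lambda>z. F n z - f z)) \<longlonglongrightarrow> 0"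
        "(\<lambda>n. B.nrm (\<lambda>z. F n z - f z)) \<longlonglongrightarrow> 0"
      using rkhs_transfer[OF assms f] by blast
    have F': "F n \<in> H1" "F n \<in> H2" for n using F A.kspan_subset B.kspan_subset by auto
    have ip_eq: "ip1 (F n) h = ip2 (F n) h" for n
      using F(1)[of n]
    proof induction
      case kspan_zero
      then show ?case using h eq A.ip_zero B.ip_zero by simp
    next
      case (kspan_step g w c)
      then show ?case
        by (simp only: A.ip_step[OF A.kspan_subset[OF kspan_step.hyps(1)] h]
            B.ip_step[OF B.kspan_subset[OF kspan_step.hyps(1)] h[unfolded eq]])
    qed
    show ?thesis
      using LIMSEQ_unique[OF A.conv_ip[OF F'(1) f F(2) h, unfolded ip_eq]
          B.conv_ip[OF F'(2) f[unfolded eq] F(3) h[unfolded eq]]] .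
  qed
qed

context pre_rkhs
begin

lemma ip_close: assumes "f \<in> H" "g \<in> H" "f' \<in> H" "g' \<in> H"
  shows "cmod (ip f g - ip f' g') \<le> nrm (\<lambda>z. f z - f' z) * nrm g + nrm f' * nrm (\<lambda>z. g z - g' z)"
proof -
  have "ip f g - ip f' g' = ip (\<lambda>z. f z - f' z) g + ip f' (\<lambda>z. g z - g' z)"
    using assms by (simp add: ip_diff ip_diff2)
  then have "cmod (ip f g - ip f' g') = cmod (ip (\<lambda>z. f z - f' z) g + ip f' (\<lambda>z. g z - g' z))" by (rule arg_cong)
  also have "\<dots> \<le> cmod (ip (\<lambda>z. f z - f' z) g) + cmod (ip f' (\<lambda>z. g z - g' z))" by (rule norm_triangle_ineq)
  also have "\<dots> \<le> nrm (\<lambda>z. f z - f' z) * nrm g + nrm f' * nrm (\<lambda>z. g z - g' z)"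
    by (intro add_mono cauchy_schwarz diff assms)
  finally show ?thesis .
qed

text \<open>Elements of the completion are represented by Cauchy sequences in \<open>H\<close>.\<close>

definition rep :: "(nat \<Rightarrow> 'a \<Rightarrow> complex) \<Rightarrow> ('a \<Rightarrow> complex) \<Rightarrow> bool" where
  "rep u f \<longleftrightarrow> (\<forall>n. u n \<in> H) \<and> cauchy u \<and> (\<forall>z. (\<lambda>n. u n z) \<longlonglongrightarrow> f z)"

lemma rep_cauchy: "rep u f \<Longrightarrow> cauchy u"
  by (simp add: rep_def)

definition cspace :: "('a \<Rightarrow> complex) set" where
  "cspace = {f. \<exists>u. rep u f}"

definition cip :: "('a \<Rightarrow> complex) \<Rightarrow> ('a \<Rightarrow> complex) \<Rightarrow> complex" where
  "cip f g = lim (\<lambda>n. ip ((SOME u. rep u f) n) ((SOME v. rep v g) n))"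

lemma cauchy_add: assumes "\<And>n. u n \<in> H" "\<And>n. v n \<in> H" "cauchy u" "cauchy v"
  shows "cauchy (\<lambda>n z. u n z + v n z)"
  unfolding cauchy_def
proof (intro allI impI)
  fix e :: real assume "e > 0"
  then have e: "e / 2 > 0" by simp
  obtain M1 where M1: "\<forall>m\<ge>M1. \<forall>n\<ge>M1. nrm (\<lambda>z. u m z - u n z) < e / 2"
    using cauchyD[OF assms(3) e] ..
  obtain M2 where M2: "\<forall>m\<ge>M2. \<forall>n\<ge>M2. nrm (\<lambda>z. v m z - v n z) < e / 2"
    using cauchyD[OF assms(4) e] ..
  have "nrm (\<lambda>z. u m z + v m z - (u n z + v n z)) < e" if "m \<ge> max M1 M2" "n \<ge> max M1 M2" for m n
  proof -
    have "(\<lambda>z. u m z + v m z - (u n z + v n z)) = (\<lambda>z. (u m z - u n z) + (v m z - v n z))"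
      by (simp add: fun_eq_iff)
    then show ?thesis
      using nrm_triangle[OF diff[OF assms(1,1)] diff[OF assms(2,2)], of m n m n] M1 M2 that by force
  qed
  then show "\<exists>M. \<forall>m\<ge>M. \<forall>n\<ge>M. nrm (\<lambda>z. u m z + v m z - (u n z + v n z)) < e"
    by (intro exI[of _ "max M1 M2"] allI impI)
qed

lemma cauchy_scale: assumes "\<And>n. u n \<in> H" "cauchy u"
  shows "cauchy (\<lambda>n z. c * u n z)"
  unfolding cauchy_def
proof (intro allI impI)
  fix e :: real assume "e > 0"
  then have e: "e / (cmod c + 1) > 0" by (simp add: add_nonneg_pos)
  obtain M where M: "\<forall>m\<ge>M. \<forall>n\<ge>M. nrm (\<lambda>z. u m z - u n z) < e / (cmod c + 1)"
    using cauchyD[OF assms(2) e] ..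
  have "nrm (\<lambda>z. c * u m z - c * u n z) < e" if "m \<ge> M" "n \<ge> M" for m n
  proof -
    have "nrm (\<lambda>z. c * u m z - c * u n z) = cmod c * nrm (\<lambda>z. u m z - u n z)"
      using nrm_scale[OF diff[OF assms(1,1)], of c m n] by (simp add: right_diff_distrib)
    also have "\<dots> \<le> (cmod c + 1) * nrm (\<lambda>z. u m z - u n z)"
      by (intro mult_right_mono nrm_nonneg diff assms) simp
    also have "\<dots> < e"
    proof -
      have "nrm (\<lambda>z. u m z - u n z) < e / (cmod c + 1)" using M that by simp
      moreover have "cmod c + 1 > 0" by (simp add: add_nonneg_pos)
      ultimately show ?thesis by (simp only: pos_less_divide_eq mult.commute)
    qed
    finally show ?thesis .
  qed
  then show "\<exists>M. \<forall>m\<ge>M. \<forall>n\<ge>M. nrm (\<lambda>z. c * u m z - c * u n z) < e"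
    by (intro exI[of _ M] allI impI)
qed

lemma cauchy_const: "f \<in> H \<Longrightarrow> cauchy (\<lambda>_. f)"
  by (simp add: cauchy_def)

lemma rep_add: "rep u f \<Longrightarrow> rep v g \<Longrightarrow> rep (\<lambda>n z. u n z + v n z) (\<lambda>z. f z + g z)"
  by (auto simp: rep_def intro!: add cauchy_add tendsto_add)

lemma rep_scale: "rep u f \<Longrightarrow> rep (\<lambda>n z. c * u n z) (\<lambda>z. c * f z)"
  by (auto simp: rep_def intro!: scale cauchy_scale tendsto_mult_left)

lemma rep_const: "f \<in> H \<Longrightarrow> rep (\<lambda>_. f) f"
  by (simp add: rep_def cauchy_const)

lemma rep_diff: assumes "rep u f" "rep v g"
  shows "rep (\<lambda>n z. u n z - v n z) (\<lambda>z. f z - g z)"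
  using rep_add[OF assms(1) rep_scale[OF assms(2), of "-1"]] by simp

lemma rep_bound: assumes "rep u f" shows "\<exists>C>0. \<forall>n. nrm (u n) \<le> C"
proof -
  obtain C where "\<forall>n. nrm (u n) \<le> C"
    using cauchy_bounded[of u] assms by (auto simp: rep_def)
  then show ?thesis by (intro exI[of _ "max C 1"]) (auto simp: le_max_iff_disj)
qed

lemma ip_convergent: assumes u: "rep u f" and v: "rep v g"
  shows "convergent (\<lambda>n. ip (u n) (v n))"
proof -
  have mem: "u n \<in> H" "v n \<in> H" for n using u v by (auto simp: rep_def)
  obtain C where C: "C > 0" "\<And>n. nrm (u n) \<le> C" using rep_bound[OF u] by auto
  obtain D where D: "D > 0" "\<And>n. nrm (v n) \<le> D" using rep_bound[OF v] by auto
  have "Cauchy (\<lambda>n. ip (u n) (v n))"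
  proof (rule metric_CauchyI)
    fix e :: real assume "e > 0"
    then have e1: "e / (2 * D) > 0" and e2: "e / (2 * C) > 0" using C D by auto
    obtain M1 where M1: "\<forall>m\<ge>M1. \<forall>n\<ge>M1. nrm (\<lambda>z. u m z - u n z) < e / (2 * D)"
      using cauchyD[OF rep_cauchy[OF u] e1] ..
    obtain M2 where M2: "\<forall>m\<ge>M2. \<forall>n\<ge>M2. nrm (\<lambda>z. v m z - v n z) < e / (2 * C)"
      using cauchyD[OF rep_cauchy[OF v] e2] ..
    have "dist (ip (u m) (v m)) (ip (u n) (v n)) < e"
      if mn: "m \<ge> max M1 M2" "n \<ge> max M1 M2" for m n
    proof -
      have "dist (ip (u m) (v m)) (ip (u n) (v n))
          \<le> nrm (\<lambda>z. u m z - u n z) * nrm (v m) + nrm (u n) * nrm (\<lambda>z. v m z - v n z)"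
        unfolding dist_norm by (rule ip_close) (rule mem)+
      also have "\<dots> \<le> nrm (\<lambda>z. u m z - u n z) * D + C * nrm (\<lambda>z. v m z - v n z)"
        using C D by (intro add_mono mult_mono nrm_nonneg diff mem order_refl) auto
      also have "nrm (\<lambda>z. u m z - u n z) * D < e / 2"
        using M1 mn D by (auto simp: field_simps)
      also have "C * nrm (\<lambda>z. v m z - v n z) < e / 2"
        using M2 mn C by (auto simp: field_simps)
      finally show ?thesis by simp
    qed
    then show "\<exists>M. \<forall>m\<ge>M. \<forall>n\<ge>M. dist (ip (u m) (v m)) (ip (u n) (v n)) < e"
      by (intro exI[of _ "max M1 M2"] allI impI)
  qed
  then show ?thesis by (simp add: Cauchy_convergent_iff)
qed

lemma ip_kspan_null: assumes "\<And>n. u n \<in> H" "\<And>z. (\<lambda>n. u n z) \<longlonglongrightarrow> 0" "h \<in> kspan X k"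
  shows "(\<lambda>n. ip h (u n)) \<longlonglongrightarrow> 0"
  using assms(3)
proof induction
  case kspan_zero
  then show ?case by (simp add: ip_zero assms)
next
  case (kspan_step g w c)
  have "(\<lambda>n. ip g (u n) + c * cnj (u n w)) \<longlonglongrightarrow> 0 + c * cnj 0"
    by (intro tendsto_intros kspan_step.IH assms)
  then show ?case
    by (simp only: ip_step[OF kspan_subset[OF kspan_step.hyps(1)] assms(1) kspan_step.hyps(2)]
        complex_cnj_zero mult_zero_right add_0_right)
qed

end

locale span_rkhs = pre_rkhs X k "kspan X k" ip for X k ip
begin

lemma rep_null: assumes u: "rep u (\<lambda>_. 0)" shows "(\<lambda>n. nrm (u n)) \<longlonglongrightarrow> 0"
proof -
  have mem: "u n \<in> kspan X k" for n using u by (auto simp: rep_def)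
  obtain C where C: "C > 0" "\<And>n. nrm (u n) \<le> C" using rep_bound[OF u] by auto
  have "(\<lambda>n. (nrm (u n))\<^sup>2) \<longlonglongrightarrow> 0"
  proof (rule LIMSEQ_I)
    fix e :: real assume "e > 0"
    then have e1: "e / (2 * C) > 0" and e2: "e / 2 > 0" using C by auto
    obtain M where M: "\<forall>m\<ge>M. \<forall>n\<ge>M. nrm (\<lambda>z. u m z - u n z) < e / (2 * C)"
      using cauchyD[OF rep_cauchy[OF u] e1] ..
    have "(\<lambda>n. ip (u M) (u n)) \<longlonglongrightarrow> 0"
      by (rule ip_kspan_null[OF mem _ mem]) (use u in \<open>auto simp: rep_def\<close>)
    then obtain M' where M': "\<And>n. n \<ge> M' \<Longrightarrow> cmod (ip (u M) (u n)) < e / 2"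
      using LIMSEQ_D[OF _ e2] by fastforce
    have "norm ((nrm (u n))\<^sup>2 - 0) < e" if n: "n \<ge> max M M'" for n
    proof -
      have "ip (u n) (u n) = ip (\<lambda>z. u n z - u M z) (u n) + ip (u M) (u n)"
        using mem by (simp add: ip_diff)
      then have "cmod (ip (u n) (u n)) \<le> cmod (ip (\<lambda>z. u n z - u M z) (u n)) + cmod (ip (u M) (u n))"
        by (metis norm_triangle_ineq)
      also have "cmod (ip (\<lambda>z. u n z - u M z) (u n)) \<le> nrm (\<lambda>z. u n z - u M z) * nrm (u n)"
        by (rule cauchy_schwarz[OF diff[OF mem mem] mem])
      also have "\<dots> \<le> nrm (\<lambda>z. u n z - u M z) * C"
        by (intro mult_left_mono C nrm_nonneg diff mem)
      also have "\<dots> < e / 2" using M n C by (auto simp: field_simps)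
      also have "cmod (ip (u M) (u n)) < e / 2" using M' n by simp
      also have "ip (u n) (u n) = complex_of_real ((nrm (u n))\<^sup>2)" by (rule nrm_sq[OF mem])
      finally show ?thesis by (simp add: norm_of_real del: of_real_power)
    qed
    then show "\<exists>M. \<forall>n\<ge>M. norm ((nrm (u n))\<^sup>2 - 0) < e" by blast
  qed
  then have "(\<lambda>n. sqrt ((nrm (u n))\<^sup>2)) \<longlonglongrightarrow> sqrt 0" by (rule tendsto_real_sqrt)
  then show ?thesis using mem by simp
qed

lemma cip_lim: assumes u: "rep u f" and v: "rep v g"
  shows "(\<lambda>n. ip (u n) (v n)) \<longlonglongrightarrow> cip f g"
proof -
  define u' where "u' = (SOME u. rep u f)"
  define v' where "v' = (SOME v. rep v g)"
  have u': "rep u' f" unfolding u'_def using u by (rule someI[of "\<lambda>u. rep u f"])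
  have v': "rep v' g" unfolding v'_def using v by (rule someI[of "\<lambda>v. rep v g"])
  have mem: "u n \<in> kspan X k" "v n \<in> kspan X k" "u' n \<in> kspan X k" "v' n \<in> kspan X k" for n
    using u v u' v' by (auto simp: rep_def)
  have lim': "(\<lambda>n. ip (u' n) (v' n)) \<longlonglongrightarrow> cip f g"
    using ip_convergent[OF u' v'] by (simp add: convergent_LIMSEQ_iff cip_def u'_def v'_def)
  obtain C where C: "C > 0" "\<And>n. nrm (u' n) \<le> C" using rep_bound[OF u'] by auto
  obtain D where D: "D > 0" "\<And>n. nrm (v n) \<le> D" using rep_bound[OF v] by auto
  have nu: "(\<lambda>n. nrm (\<lambda>z. u n z - u' n z)) \<longlonglongrightarrow> 0" using rep_null rep_diff[OF u u'] by simp
  have nv: "(\<lambda>n. nrm (\<lambda>z. v n z - v' n z)) \<longlonglongrightarrow> 0" using rep_null rep_diff[OF v v'] by simp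
  have bnd: "(\<lambda>n. nrm (\<lambda>z. u n z - u' n z) * D + C * nrm (\<lambda>z. v n z - v' n z)) \<longlonglongrightarrow> 0"
    using tendsto_add[OF tendsto_mult_right[OF nu, of D] tendsto_mult_left[OF nv, of C]] by simp
  have "(\<lambda>n. ip (u n) (v n) - ip (u' n) (v' n)) \<longlonglongrightarrow> 0"
  proof (rule tendsto_0_le[OF bnd, where K = 1])
    have le: "norm (ip (u n) (v n) - ip (u' n) (v' n))
        \<le> nrm (\<lambda>z. u n z - u' n z) * D + C * nrm (\<lambda>z. v n z - v' n z)" for n
    proof -
      have "norm (ip (u n) (v n) - ip (u' n) (v' n))
          \<le> nrm (\<lambda>z. u n z - u' n z) * nrm (v n) + nrm (u' n) * nrm (\<lambda>z. v n z - v' n z)"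
        by (rule ip_close) (rule mem)+
      also have "\<dots> \<le> nrm (\<lambda>z. u n z - u' n z) * D + C * nrm (\<lambda>z. v n z - v' n z)"
        using C D by (intro add_mono mult_mono nrm_nonneg diff mem order_refl) auto
      finally show ?thesis .
    qed
    show "\<forall>\<^sub>F n in sequentially. norm (ip (u n) (v n) - ip (u' n) (v' n))
        \<le> norm (nrm (\<lambda>z. u n z - u' n z) * D + C * nrm (\<lambda>z. v n z - v' n z)) * 1"
      unfolding mult_1_right real_norm_def[of "_ + _"]
      by (intro always_eventually allI order_trans[OF le abs_ge_self])
  qed
  from tendsto_add[OF this lim'] show ?thesis by simp
qed

lemma cip_eq: "f \<in> kspan X k \<Longrightarrow> g \<in> kspan X k \<Longrightarrow> cip f g = ip f g"
  using LIMSEQ_unique[OF cip_lim[OF rep_const rep_const, of f g] tendsto_const] by simp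

sublocale C: pre_rkhs X k cspace cip
proof
  fix f z assume "f \<in> cspace" "z \<notin> X"
  then obtain u where u: "rep u f" by (auto simp: cspace_def)
  then have "u n z = 0" for n using supp \<open>z \<notin> X\<close> by (auto simp: rep_def)
  moreover have "(\<lambda>n. u n z) \<longlonglongrightarrow> f z" using u by (auto simp: rep_def)
  ultimately show "f z = 0" by (simp add: LIMSEQ_const_iff)
next
  show "(\<lambda>_. 0) \<in> cspace" using rep_const[OF zero] by (auto simp: cspace_def)
next
  fix f g assume "f \<in> cspace" "g \<in> cspace"
  then show "(\<lambda>z. f z + g z) \<in> cspace" unfolding cspace_def using rep_add by blast
next
  fix f and c :: complex assume "f \<in> cspace"
  then show "(\<lambda>z. c * f z) \<in> cspace" unfolding cspace_def using rep_scale by blast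
next
  fix f g h assume "f \<in> cspace" "g \<in> cspace" "h \<in> cspace"
  then obtain u v w where u: "rep u f" and v: "rep v g" and w: "rep w h" by (auto simp: cspace_def)
  have mem: "u n \<in> kspan X k" "v n \<in> kspan X k" "w n \<in> kspan X k" for n
    using u v w by (auto simp: rep_def)
  have "(\<lambda>n. ip (u n) (w n) + ip (v n) (w n)) \<longlonglongrightarrow> cip f h + cip g h"
    by (intro tendsto_add cip_lim u v w)
  moreover have "(\<lambda>n. ip (u n) (w n) + ip (v n) (w n)) \<longlonglongrightarrow> cip (\<lambda>z. f z + g z) h"
    using cip_lim[OF rep_add[OF u v] w] by (simp only: ip_add mem)
  ultimately show "cip (\<lambda>z. f z + g z) h = cip f h + cip g h" using LIMSEQ_unique by blast
next
  fix f h and c :: complex assume "f \<in> cspace" "h \<in> cspace"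
  then obtain u w where u: "rep u f" and w: "rep w h" by (auto simp: cspace_def)
  have mem: "u n \<in> kspan X k" "w n \<in> kspan X k" for n
    using u w by (auto simp: rep_def)
  have "(\<lambda>n. c * ip (u n) (w n)) \<longlonglongrightarrow> c * cip f h"
    by (intro tendsto_mult_left cip_lim u w)
  moreover have "(\<lambda>n. c * ip (u n) (w n)) \<longlonglongrightarrow> cip (\<lambda>z. c * f z) h"
    using cip_lim[OF rep_scale[OF u] w] by (simp only: ip_scale mem)
  ultimately show "cip (\<lambda>z. c * f z) h = c * cip f h" using LIMSEQ_unique by blast
next
  fix f g assume "f \<in> cspace" "g \<in> cspace"
  then obtain u v where u: "rep u f" and v: "rep v g" by (auto simp: cspace_def)
  have mem: "u n \<in> kspan X k" "v n \<in> kspan X k" for n using u v by (auto simp: rep_def)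
  have "ip (v n) (u n) = cnj (ip (u n) (v n))" for n by (rule ip_cnj[OF mem])
  then have "(\<lambda>n. cnj (ip (u n) (v n))) \<longlonglongrightarrow> cip g f"
    using cip_lim[OF v u] by simp
  moreover have "(\<lambda>n. cnj (ip (u n) (v n))) \<longlonglongrightarrow> cnj (cip f g)"
    by (intro tendsto_intros cip_lim u v)
  ultimately show "cip g f = cnj (cip f g)" using LIMSEQ_unique by blast
next
  fix f assume "f \<in> cspace"
  then obtain u where u: "rep u f" by (auto simp: cspace_def)
  have mem: "u n \<in> kspan X k" for n using u by (auto simp: rep_def)
  have nn: "0 \<le> Re (ip (u n) (u n))" "Im (ip (u n) (u n)) = 0" for n
    using ip_nonneg[OF mem] by (auto simp: less_eq_complex_def)
  have "0 \<le> Re (cip f f)"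
    by (rule LIMSEQ_le_const[OF tendsto_Re[OF cip_lim[OF u u]]]) (use nn in blast)
  moreover have "Im (cip f f) = 0"
    using tendsto_Im[OF cip_lim[OF u u]] by (simp add: nn LIMSEQ_const_iff)
  ultimately show "0 \<le> cip f f" by (simp add: less_eq_complex_def)
next
  fix f assume "f \<in> cspace" and z: "cip f f = 0"
  then obtain u where u: "rep u f" by (auto simp: cspace_def)
  have mem: "u n \<in> kspan X k" for n using u by (auto simp: rep_def)
  have "(\<lambda>n. nrm (u n)) \<longlonglongrightarrow> 0"
    using tendsto_real_sqrt[OF tendsto_Re[OF cip_lim[OF u u]]] z by (simp add: nrm_def)
  then have "(\<lambda>n. nrm (\<lambda>z. u n z - 0)) \<longlonglongrightarrow> 0" by simp
  then have "(\<lambda>n. u n z) \<longlonglongrightarrow> 0" for z by (rule conv_pointwise[OF mem zero])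
  moreover have "(\<lambda>n. u n z) \<longlonglongrightarrow> f z" for z using u by (auto simp: rep_def)
  ultimately show "f = (\<lambda>_. 0)" using LIMSEQ_unique by blast
next
  fix w assume "w \<in> X"
  then show "kernel_fun X k w \<in> cspace" using rep_const[OF kernel_mem] by (auto simp: cspace_def)
next
  fix f w assume "f \<in> cspace" and w: "w \<in> X"
  then obtain u where u: "rep u f" by (auto simp: cspace_def)
  have mem: "u n \<in> kspan X k" for n using u by (auto simp: rep_def)
  have "(\<lambda>n. u n w) \<longlonglongrightarrow> cip f (kernel_fun X k w)"
    using cip_lim[OF u rep_const[OF kernel_mem[OF w]]] by (simp only: reproducing[OF mem w])
  moreover have "(\<lambda>n. u n w) \<longlonglongrightarrow> f w" using u by (auto simp: rep_def)
  ultimately show "cip f (kernel_fun X k w) = f w" using LIMSEQ_unique by blast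
qed

lemma kspan_cspace: "f \<in> kspan X k \<Longrightarrow> f \<in> cspace"
  using rep_const by (auto simp: cspace_def)

lemma cnrm_eq: "f \<in> kspan X k \<Longrightarrow> C.nrm f = nrm f"
  by (simp add: C.nrm_def nrm_def cip_eq)

lemma rep_conv: assumes u: "rep u f" shows "(\<lambda>n. C.nrm (\<lambda>z. u n z - f z)) \<longlonglongrightarrow> 0"
proof (rule LIMSEQ_I)
  fix e :: real assume "e > 0"
  then have e: "e / 2 > 0" by simp
  obtain M where M: "\<forall>m\<ge>M. \<forall>n\<ge>M. nrm (\<lambda>z. u m z - u n z) < e / 2"
    using cauchyD[OF rep_cauchy[OF u] e] ..
  have mem: "u n \<in> kspan X k" for n using u by (auto simp: rep_def)
  have f: "f \<in> cspace" using u by (auto simp: cspace_def)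
  have "norm (C.nrm (\<lambda>z. u n z - f z) - 0) < e" if n: "n \<ge> M" for n
  proof -
    have r: "rep (\<lambda>m z. u n z - u m z) (\<lambda>z. u n z - f z)"
      by (rule rep_diff[OF rep_const[OF mem] u])
    have "(\<lambda>m. nrm (\<lambda>z. u n z - u m z)) \<longlonglongrightarrow> C.nrm (\<lambda>z. u n z - f z)"
      unfolding nrm_def C.nrm_def by (intro tendsto_real_sqrt tendsto_Re cip_lim r)
    moreover have "\<exists>N. \<forall>m\<ge>N. nrm (\<lambda>z. u n z - u m z) \<le> e / 2"
      using M n by (intro exI[of _ M]) (auto intro: less_imp_le)
    ultimately have "C.nrm (\<lambda>z. u n z - f z) \<le> e / 2" by (rule LIMSEQ_le_const2)
    moreover have "0 \<le> C.nrm (\<lambda>z. u n z - f z)"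
      by (intro C.nrm_nonneg C.diff kspan_cspace mem f)
    ultimately show ?thesis using e by simp
  qed
  then show "\<exists>M. \<forall>n\<ge>M. norm (C.nrm (\<lambda>z. u n z - f z) - 0) < e" by blast
qed

lemma completion: "rkhs X k cspace cip"
proof
  fix F assume F: "\<And>n. F n \<in> cspace" and cF: "C.cauchy F"
  have "\<exists>g \<in> kspan X k. C.nrm (\<lambda>z. g z - F n z) < inverse (real (Suc n))" for n
  proof -
    obtain u where u: "rep u (F n)" using F[of n] by (auto simp: cspace_def)
    obtain m where "norm (C.nrm (\<lambda>z. u m z - F n z) - 0) < inverse (real (Suc n))"
      using LIMSEQ_D[OF rep_conv[OF u], of "inverse (real (Suc n))"] by force
    moreover have "u m \<in> kspan X k" using u by (auto simp: rep_def)
    ultimately show ?thesis by force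
  qed
  then obtain g where g: "\<And>n. g n \<in> kspan X k"
      "\<And>n. C.nrm (\<lambda>z. g n z - F n z) < inverse (real (Suc n))" by metis
  have gc: "g n \<in> cspace" for n using g kspan_cspace by blast
  have nn: "0 \<le> C.nrm (\<lambda>z. g n z - F n z)" for n by (intro C.nrm_nonneg C.diff gc F)
  have lim: "(\<lambda>n. C.nrm (\<lambda>z. g n z - F n z)) \<longlonglongrightarrow> 0"
    by (rule tendsto_0_le[OF LIMSEQ_inverse_real_of_nat, where K = 1])
      (use g nn in \<open>auto intro!: always_eventually less_imp_le simp del: of_nat_Suc\<close>)
  have cg: "cauchy g"
    unfolding cauchy_def
  proof (intro allI impI)
    fix e :: real assume "e > 0"
    then have e: "e / 3 > 0" by simp
    obtain M1 where M1: "\<forall>m\<ge>M1. \<forall>n\<ge>M1. C.nrm (\<lambda>z. F m z - F n z) < e / 3"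
      using C.cauchyD[OF cF e] ..
    obtain M2 where M2: "\<And>n. n \<ge> M2 \<Longrightarrow> C.nrm (\<lambda>z. g n z - F n z) < e / 3"
      using LIMSEQ_D[OF lim e] nn by auto
    have "nrm (\<lambda>z. g m z - g n z) < e" if mn: "m \<ge> max M1 M2" "n \<ge> max M1 M2" for m n
    proof -
      have "nrm (\<lambda>z. g m z - g n z) = C.nrm (\<lambda>z. g m z - g n z)"
        by (simp add: cnrm_eq kspan_diff g)
      also have "\<dots> \<le> C.nrm (\<lambda>z. g m z - F m z) + C.nrm (\<lambda>z. F m z - g n z)"
        by (rule C.nrm_triangle_diff[OF gc F gc])
      also have "C.nrm (\<lambda>z. F m z - g n z) \<le> C.nrm (\<lambda>z. F m z - F n z) + C.nrm (\<lambda>z. F n z - g n z)"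
        by (rule C.nrm_triangle_diff[OF F F gc])
      also have "C.nrm (\<lambda>z. F n z - g n z) = C.nrm (\<lambda>z. g n z - F n z)"
        by (rule C.nrm_minus[OF F gc])
      also have "C.nrm (\<lambda>z. g m z - F m z) < e / 3" using M2 mn by simp
      also have "C.nrm (\<lambda>z. F m z - F n z) < e / 3" using M1 mn by simp
      also have "C.nrm (\<lambda>z. g n z - F n z) < e / 3" using M2 mn by simp
      finally show ?thesis by simp
    qed
    then show "\<exists>M. \<forall>m\<ge>M. \<forall>n\<ge>M. nrm (\<lambda>z. g m z - g n z) < e"
      by (intro exI[of _ "max M1 M2"] allI impI)
  qed
  define f where "f z = lim (\<lambda>n. g n z)" for z
  have "(\<lambda>n. g n z) \<longlonglongrightarrow> f z" for z
    using cauchy_pointwise[OF g(1) cg, of z]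
    by (simp add: f_def Cauchy_convergent_iff convergent_LIMSEQ_iff)
  then have r: "rep g f" using g cg by (simp add: rep_def)
  then have f: "f \<in> cspace" by (auto simp: cspace_def)
  have "(\<lambda>n. C.nrm (\<lambda>z. g n z - F n z) + C.nrm (\<lambda>z. g n z - f z)) \<longlonglongrightarrow> 0"
    using tendsto_add[OF lim rep_conv[OF r]] by simp
  then have "(\<lambda>n. C.nrm (\<lambda>z. F n z - f z)) \<longlonglongrightarrow> 0"
  proof (rule tendsto_0_le[where K = 1])
    have le: "norm (C.nrm (\<lambda>z. F n z - f z)) \<le> C.nrm (\<lambda>z. g n z - F n z) + C.nrm (\<lambda>z. g n z - f z)" for n
      using C.nrm_triangle_diff[OF F gc f, of n n] C.nrm_minus[OF F gc, of n n]
        C.nrm_nonneg[OF C.diff[OF F f], of n] by simp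
    show "\<forall>\<^sub>F n in sequentially. norm (C.nrm (\<lambda>z. F n z - f z))
        \<le> norm (C.nrm (\<lambda>z. g n z - F n z) + C.nrm (\<lambda>z. g n z - f z)) * 1"
      unfolding mult_1_right real_norm_def[of "_ + _"]
      by (intro always_eventually allI order_trans[OF le abs_ge_self])
  qed
  then show "\<exists>f\<in>cspace. (\<lambda>n. C.nrm (\<lambda>z. F n z - f z)) \<longlonglongrightarrow> 0" using f by blast
qed

end

definition kcomb :: "'a set \<Rightarrow> ('a \<Rightarrow> 'a \<Rightarrow> complex) \<Rightarrow> ('a \<times> complex) list \<Rightarrow> 'a \<Rightarrow> complex" where
  "kcomb X k xs = (\<lambda>z. \<Sum>(w, c)\<leftarrow>xs. c * kernel_fun X k w z)"

definition kform :: "('a \<Rightarrow> complex) \<Rightarrow> ('a \<times> complex) list \<Rightarrow> complex" where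
  "kform g ys = (\<Sum>(w, c)\<leftarrow>ys. cnj c * g w)"

definition kip :: "'a set \<Rightarrow> ('a \<Rightarrow> 'a \<Rightarrow> complex) \<Rightarrow> ('a \<Rightarrow> complex) \<Rightarrow> ('a \<Rightarrow> complex) \<Rightarrow> complex" where
  "kip X k g h = kform g (SOME ys. fst ` set ys \<subseteq> X \<and> kcomb X k ys = h)"

lemma kcomb_simps: "kcomb X k [] = (\<lambda>_. 0)"
  "kcomb X k ((w, c) # xs) = (\<lambda>z. c * kernel_fun X k w z + kcomb X k xs z)"
  by (simp_all add: kcomb_def)

lemma kform_simps: "kform g [] = 0" "kform g ((w, c) # ys) = cnj c * g w + kform g ys"
  by (simp_all add: kform_def)

lemma kform_add: "kform (\<lambda>z. f z + g z) ys = kform f ys + kform g ys"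
  by (induction ys) (auto simp: kform_simps algebra_simps)

lemma kform_scale: "kform (\<lambda>z. c * g z) ys = c * kform g ys"
  by (induction ys) (auto simp: kform_simps algebra_simps)

lemma kform_zero: "kform (\<lambda>_. 0) ys = 0"
  by (induction ys) (auto simp: kform_simps)

lemma kspan_kcomb: assumes "h \<in> kspan X k"
  shows "\<exists>ys. fst ` set ys \<subseteq> X \<and> kcomb X k ys = h"
  using assms
proof induction
  case kspan_zero
  then show ?case by (intro exI[of _ "[]"]) (simp add: kcomb_simps)
next
  case (kspan_step g w c)
  then obtain ys where "fst ` set ys \<subseteq> X" "kcomb X k ys = g" by blast
  then show ?case using kspan_step.hyps
    by (intro exI[of _ "(w, c) # ys"]) (simp add: kcomb_simps add.commute)
qed

lemma kernel_pos: assumes k: "kernel_on X k" and xs: "fst ` set xs \<subseteq> X"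
  shows "0 \<le> kform (kcomb X k xs) xs"
proof -
  define n where "n = length xs"
  define z where "z i = fst (xs ! i)" for i
  define v where "v = vec n (\<lambda>i. snd (xs ! i))"
  define A where "A = mat n n (\<lambda>(i, j). k (z i) (z j))"
  have zX: "z i \<in> X" if "i < n" for i using that xs by (auto simp: z_def n_def)
  then have "psd n A" using k by (auto simp: kernel_on_def A_def)
  then have "0 \<le> (A *\<^sub>v v) \<bullet>c v" by (auto simp: psd_def v_def)
  also have "(A *\<^sub>v v) \<bullet>c v = (\<Sum>i = 0..<n. (\<Sum>j = 0..<n. k (z i) (z j) * snd (xs ! j)) * cnj (snd (xs ! i)))"
    by (auto simp: A_def v_def scalar_prod_def conjugate_complex_def intro!: sum.cong)
  also have "\<dots> = (\<Sum>i = 0..<n. cnj (snd (xs ! i)) * kcomb X k xs (z i))"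
  proof (intro sum.cong refl)
    fix i assume "i \<in> {0..<n}"
    then have "z i \<in> X" using zX by simp
    then have "kcomb X k xs (z i) = (\<Sum>j = 0..<n. k (z i) (z j) * snd (xs ! j))"
      by (simp add: kcomb_def sum_list_sum_nth n_def case_prod_unfold kernel_fun_def z_def mult.commute)
    then show "(\<Sum>j = 0..<n. k (z i) (z j) * snd (xs ! j)) * cnj (snd (xs ! i))
        = cnj (snd (xs ! i)) * kcomb X k xs (z i)" by simp
  qed
  also have "\<dots> = kform (kcomb X k xs) xs"
    by (simp add: kform_def sum_list_sum_nth n_def case_prod_unfold z_def)
  finally show ?thesis .
qed

lemma kernel_diag: assumes k: "kernel_on X k" and "a \<in> X"
  shows "0 \<le> k a a"
  using kernel_pos[OF k, of "[(a, 1)]"] assms by (simp add: kcomb_simps kform_simps kernel_fun_def)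

lemma kernel_hermitian: assumes k: "kernel_on X k" and a: "a \<in> X" and b: "b \<in> X"
  shows "k b a = cnj (k a b)"
proof -
  have "Im (k a a) = 0" "Im (k b b) = 0"
    using kernel_diag[OF k] a b by (auto simp: less_eq_complex_def)
  moreover have "Im (kform (kcomb X k [(a, 1), (b, 1)]) [(a, 1), (b, 1)]) = 0"
    using kernel_pos[OF k, of "[(a, 1), (b, 1)]"] a b by (auto simp: less_eq_complex_def)
  moreover have "Im (kform (kcomb X k [(a, 1), (b, \<i>)]) [(a, 1), (b, \<i>)]) = 0"
    using kernel_pos[OF k, of "[(a, 1), (b, \<i>)]"] a b by (auto simp: less_eq_complex_def)
  ultimately show ?thesis using a b
    by (simp add: kcomb_simps kform_simps kernel_fun_def complex_eq_iff)
qed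

lemma kform_kernel_fun: assumes k: "kernel_on X k" and w: "w \<in> X" and xs: "fst ` set xs \<subseteq> X"
  shows "kform (kernel_fun X k w) xs = cnj (kcomb X k xs w)"
  using xs
proof (induction xs)
  case Nil
  then show ?case by (simp add: kform_simps kcomb_simps)
next
  case (Cons p xs)
  obtain a c where p: "p = (a, c)" by force
  then have "a \<in> X" using Cons.prems by simp
  then have "kernel_fun X k w a = cnj (kernel_fun X k a w)"
    using kernel_hermitian[OF k w] w by (simp add: kernel_fun_def)
  then show ?case using Cons by (simp add: p kform_simps kcomb_simps)
qed

lemma kform_sym: assumes k: "kernel_on X k" and xs: "fst ` set xs \<subseteq> X" and ys: "fst ` set ys \<subseteq> X"
  shows "kform (kcomb X k xs) ys = cnj (kform (kcomb X k ys) xs)"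
  using ys
proof (induction ys)
  case Nil
  then show ?case by (simp add: kform_simps kcomb_simps kform_zero)
next
  case (Cons p ys)
  obtain w c where p: "p = (w, c)" by force
  then have "w \<in> X" using Cons.prems by simp
  then show ?case using Cons
    by (simp add: p kform_simps kcomb_simps kform_add kform_scale kform_kernel_fun[OF k _ xs])
qed

lemma kip_eq: assumes k: "kernel_on X k" and g: "g \<in> kspan X k" and ys: "fst ` set ys \<subseteq> X"
  shows "kip X k g (kcomb X k ys) = kform g ys"
proof -
  define ys' where "ys' = (SOME ys'. fst ` set ys' \<subseteq> X \<and> kcomb X k ys' = kcomb X k ys)"
  have ys': "fst ` set ys' \<subseteq> X" "kcomb X k ys' = kcomb X k ys"
    using someI[of "\<lambda>ys'. fst ` set ys' \<subseteq> X \<and> kcomb X k ys' = kcomb X k ys" ys] ys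
    by (auto simp: ys'_def)
  obtain xs where xs: "fst ` set xs \<subseteq> X" "kcomb X k xs = g" using kspan_kcomb[OF g] by blast
  have "kip X k g (kcomb X k ys) = kform g ys'" by (simp add: kip_def ys'_def)
  also have "\<dots> = kform g ys"
    using kform_sym[OF k xs(1) ys'(1)] kform_sym[OF k xs(1) ys] by (simp add: xs ys')
  finally show ?thesis .
qed

lemma span_rkhs_kip: assumes k: "kernel_on X k" shows "span_rkhs X k (kip X k)"
proof
  fix f z assume "f \<in> kspan X k" "z \<notin> X"
  then show "f z = 0" by induction (auto simp: kernel_fun_def)
next
  fix f g h assume f: "f \<in> kspan X k" and g: "g \<in> kspan X k" and "h \<in> kspan X k"
  then obtain ys where ys: "fst ` set ys \<subseteq> X" "kcomb X k ys = h" using kspan_kcomb by blast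
  show "kip X k (\<lambda>z. f z + g z) h = kip X k f h + kip X k g h"
    using kip_eq[OF k f ys(1)] kip_eq[OF k g ys(1)] kip_eq[OF k kspan_add[OF f g] ys(1)]
    by (simp add: ys kform_add)
next
  fix f h and c :: complex assume f: "f \<in> kspan X k" and "h \<in> kspan X k"
  then obtain ys where ys: "fst ` set ys \<subseteq> X" "kcomb X k ys = h" using kspan_kcomb by blast
  show "kip X k (\<lambda>z. c * f z) h = c * kip X k f h"
    using kip_eq[OF k f ys(1)] kip_eq[OF k kspan_scale[OF f] ys(1)] by (simp add: ys kform_scale)
next
  fix f g assume f: "f \<in> kspan X k" and g: "g \<in> kspan X k"
  obtain xs where xs: "fst ` set xs \<subseteq> X" "kcomb X k xs = f" using kspan_kcomb[OF f] by blast
  obtain ys where ys: "fst ` set ys \<subseteq> X" "kcomb X k ys = g" using kspan_kcomb[OF g] by blast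
  show "kip X k g f = cnj (kip X k f g)"
    using kip_eq[OF k f ys(1)] kip_eq[OF k g xs(1)] kform_sym[OF k ys(1) xs(1)] by (simp add: xs ys)
next
  fix f assume f: "f \<in> kspan X k"
  obtain xs where xs: "fst ` set xs \<subseteq> X" "kcomb X k xs = f" using kspan_kcomb[OF f] by blast
  have eq: "kip X k f f = kform f xs" using kip_eq[OF k f xs(1)] xs by simp
  show "0 \<le> kip X k f f" using kernel_pos[OF k xs(1)] eq xs by simp
  assume "kip X k f f = 0"
  then have f0: "kform f xs = 0" using eq by simp
  have "f w = 0" if w: "w \<in> X" for w
  proof (rule zero_if_quadratic)
    show "0 \<le> Re (k w w)" using kernel_diag[OF k w] by (simp add: less_eq_complex_def)
    fix c :: complex
    have "0 \<le> kform (kcomb X k ((w, - c) # xs)) ((w, - c) # xs)"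
      by (rule kernel_pos[OF k]) (use w xs in simp)
    also have "\<dots> = cnj c * c * k w w - cnj c * f w - cnj (cnj c * f w)"
      using w by (simp only: kform_simps kcomb_simps kform_add kform_scale xs f0
          kform_kernel_fun[OF k w xs(1)]) (simp add: kernel_fun_def algebra_simps)
    finally have "0 \<le> Re (cnj c * c * k w w) - 2 * Re (cnj c * f w)"
      by (simp add: less_eq_complex_def)
    moreover have "Re (cnj c * c * k w w) = (cmod c)\<^sup>2 * Re (k w w)"
      using kernel_diag[OF k w] unfolding cmod_power2
      by (simp add: less_eq_complex_def power2_eq_square algebra_simps)
    ultimately show "2 * Re (cnj c * f w) \<le> (cmod c)\<^sup>2 * Re (k w w)" by linarith
  qed
  moreover have "f z = 0" if "z \<notin> X" for z
    using f that by induction (auto simp: kernel_fun_def)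
  ultimately show "f = (\<lambda>_. 0)" by blast
next
  fix f w assume f: "f \<in> kspan X k" and w: "w \<in> X"
  have "kcomb X k [(w, 1)] = kernel_fun X k w" by (simp add: kcomb_simps)
  then show "kip X k f (kernel_fun X k w) = f w"
    using kip_eq[OF k f, of "[(w, 1)]"] w by (simp add: kform_simps)
qed (auto intro: kspan_zero kspan_add kspan_scale kspan_kernel)

theorem rkhs_exists:
  assumes "kernel_on X k"
  shows "\<exists>H ip. rkhs X k H ip"
  using span_rkhs.completion[OF span_rkhs_kip[OF assms]] by blast


definition rkhs_space :: "'a set \<Rightarrow> ('a \<Rightarrow> 'a \<Rightarrow> complex) \<Rightarrow> ('a \<Rightarrow> complex) set" where
  "rkhs_space X k = (THE H. \<exists>ip. rkhs X k H ip)"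

text \<open>Only the values on the space are determined; the choice elsewhere is immaterial.\<close>

definition rkhs_ip ::
  "'a set \<Rightarrow> ('a \<Rightarrow> 'a \<Rightarrow> complex) \<Rightarrow> ('a \<Rightarrow> complex) \<Rightarrow> ('a \<Rightarrow> complex) \<Rightarrow> complex" where
  "rkhs_ip X k = (SOME ip. rkhs X k (rkhs_space X k) ip)"

theorem rkhs_space_rkhs:
  assumes "kernel_on X k"
  shows "rkhs X k (rkhs_space X k) (rkhs_ip X k)"
proof -
  have "\<exists>!H. \<exists>ip. rkhs X k H ip" using rkhs_exists[OF assms] rkhs_unique(1) by metis
  then have "\<exists>ip. rkhs X k (rkhs_space X k) ip" unfolding rkhs_space_def by (rule theI')
  then show ?thesis unfolding rkhs_ip_def by (rule someI_ex)
qed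

definition rkhs_norm :: "'a set \<Rightarrow> ('a \<Rightarrow> 'a \<Rightarrow> complex) \<Rightarrow> ('a \<Rightarrow> complex) \<Rightarrow> real" where
  "rkhs_norm X k f = sqrt (Re (rkhs_ip X k f f))"

text \<open>\<open>H\<^sub>k \<otimes> C\<^sup>N\<close>, identified with the \<open>C\<^sup>N\<close>-valued functions whose components lie in \<open>H\<^sub>k\<close>;
  the squared norm is the sum of the squared norms of the components.\<close>

definition vec_rkhs :: "'a set \<Rightarrow> ('a \<Rightarrow> 'a \<Rightarrow> complex) \<Rightarrow> nat \<Rightarrow> ('a \<Rightarrow> complex vec) set" where
  "vec_rkhs X k N =
     {f. (\<forall>z. f z \<in> carrier_vec N) \<and> (\<forall>i<N. (\<lambda>z. f z $ i) \<in> rkhs_space X k)}"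

definition vec_rkhs_norm ::
  "'a set \<Rightarrow> ('a \<Rightarrow> 'a \<Rightarrow> complex) \<Rightarrow> nat \<Rightarrow> ('a \<Rightarrow> complex vec) \<Rightarrow> real" where
  "vec_rkhs_norm X k N f = sqrt (\<Sum>i<N. (rkhs_norm X k (\<lambda>z. f z $ i))\<^sup>2)"

definition mult_op :: "'a set \<Rightarrow> nat \<Rightarrow> ('a \<Rightarrow> complex mat) \<Rightarrow> ('a \<Rightarrow> complex vec) \<Rightarrow> 'a \<Rightarrow> complex vec"
  where "mult_op X N \<Phi> f = (\<lambda>z. if z \<in> X then \<Phi> z *\<^sub>v f z else 0\<^sub>v N)"

definition Mult ::
  "'a set \<Rightarrow> ('a \<Rightarrow> 'a \<Rightarrow> complex) \<Rightarrow> ('a \<Rightarrow> 'a \<Rightarrow> complex) \<Rightarrow> nat \<Rightarrow> ('a \<Rightarrow> complex mat) set" where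
  "Mult X k l N = {\<Phi>. (\<forall>z\<in>X. \<Phi> z \<in> carrier_mat N N) \<and>
     (\<forall>f \<in> vec_rkhs X k N. mult_op X N \<Phi> f \<in> vec_rkhs X l N)}"

text \<open>The operator norm takes values in \<^typ>\<open>ennreal\<close>, so that the supremum is meaningful without
  knowing beforehand that multiplication by \<open>\<Phi>\<close> is bounded.\<close>

definition mult_norm ::
  "'a set \<Rightarrow> ('a \<Rightarrow> 'a \<Rightarrow> complex) \<Rightarrow> ('a \<Rightarrow> 'a \<Rightarrow> complex) \<Rightarrow> nat \<Rightarrow> ('a \<Rightarrow> complex mat) \<Rightarrow> ennreal" where
  "mult_norm X k l N \<Phi> =
     (SUP f \<in> {f \<in> vec_rkhs X k N. vec_rkhs_norm X k N f \<le> 1}.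
        ennreal (vec_rkhs_norm X l N (mult_op X N \<Phi> f)))"

definition complete_pick_pair ::
  "'a set \<Rightarrow> ('a \<Rightarrow> 'a \<Rightarrow> complex) \<Rightarrow> ('a \<Rightarrow> 'a \<Rightarrow> complex) \<Rightarrow> bool" where
  "complete_pick_pair X k l \<longleftrightarrow> kernel_on X k \<and> kernel_on X l \<and>
     (\<forall>n\<ge>1. \<forall>N\<ge>1. \<forall>z :: nat \<Rightarrow> 'a. \<forall>W :: nat \<Rightarrow> complex mat.
        (\<forall>i<n. z i \<in> X \<and> W i \<in> carrier_mat N N) \<and>
        psd (n * N) (block_mat n N
          (\<lambda>i j. l (z i) (z j) \<cdot>\<^sub>m 1\<^sub>m N - k (z i) (z j) \<cdot>\<^sub>m (W i * mat_adjoint (W j)))) \<longrightarrow>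
        (\<exists>\<Phi> \<in> Mult X k l N. mult_norm X k l N \<Phi> \<le> 1 \<and> (\<forall>i<n. \<Phi> (z i) = W i)))"

definition complete_pick_kernel :: "'a set \<Rightarrow> ('a \<Rightarrow> 'a \<Rightarrow> complex) \<Rightarrow> bool" where
  "complete_pick_kernel X s \<longleftrightarrow> complete_pick_pair X s s"

definition strong_shimorin_certificate ::
  "'a set \<Rightarrow> ('a \<Rightarrow> 'a \<Rightarrow> complex) \<Rightarrow> ('a \<Rightarrow> 'a \<Rightarrow> complex) \<Rightarrow> ('a \<Rightarrow> 'a \<Rightarrow> complex) \<Rightarrow> bool" where
  "strong_shimorin_certificate X k l s \<longleftrightarrow> complete_pick_kernel X s \<and>
     (\<exists>h g. kernel_on X h \<and> kernel_on X g \<and>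
        (\<forall>z\<in>X. \<forall>w\<in>X. k z w = (1 - h z w) * s z w \<and> l z w = s z w * g z w))"

definition kernel_factor ::
  "'a set \<Rightarrow> ('a \<Rightarrow> 'a \<Rightarrow> complex) \<Rightarrow> ('a \<Rightarrow> 'a \<Rightarrow> complex) \<Rightarrow> bool" where
  "kernel_factor X s t \<longleftrightarrow> (\<exists>g. kernel_on X g \<and> (\<forall>z\<in>X. \<forall>w\<in>X. t z w = g z w * s z w))"

definition bergman_kernel :: "complex \<Rightarrow> complex \<Rightarrow> complex" where
  "bergman_kernel z w = 1 / (1 - z * cnj w)\<^sup>2"

definition third_disc :: "complex set" where
  "third_disc = {z. cmod z < 1/3}"

end

theory Submission
  imports Defs "HOL-Analysis.L2_Norm"
begin

text \<open>Write \<open>b\<close> for the Bergman kernel, \<open>\<phi>\<^sub>a\<close> for the disc automorphism that moves \<open>a\<close> to \<open>0\<close>, and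
  \<open>m\<^sub>a(z,w) = \<phi>\<^sub>a(z) \<phi>\<^sub>a(w)\<^sup>*\<close>.

  The pair has the complete Pick property because interpolation data can be extended one point at a time. A matrix
  function \<open>\<Phi>\<close> is a contractive multiplier if \<open>l I - k \<Phi> \<Phi>\<^sup>*\<close> is positive
  (\<open>contractive_multiplier_if_psd\<close>), so by Zorn's lemma it suffices to add one point \<open>p\<close> to data with positive
  Pick matrix. The new target matrix is the one missing block of a positive block matrix, and a completion exists as soon
  as the two known principal parts are positive (\<open>psd_completion\<close>). This reduces to a
  comparison of the Schur complements \<open>k'\<close>, \<open>l'\<close> of the two kernels at \<open>p\<close>: it is enough to have a kernel \<open>\<tau>\<close> with
  \<open>\<tau> l \<le> l'\<close> and \<open>k' \<le> \<tau> k\<close> (\<open>complete_pick_pair_if_dominated\<close>). For the Bergman kernel \<open>k' = (2 m\<^sub>p - m\<^sub>p\<^sup>2) k\<close>, and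
  \<open>\<tau> = 2 m\<^sub>p\<close> works because \<open>(1 - 2 m\<^sub>p) l\<close> is positive for every \<open>p\<close> in the small disc
  (\<open>psd_on_third_szego_certificate\<close>).

  The same positivity shows that every \<open>a\<close> in the small disc gives a strong Shimorin certificate
  \<open>s\<^sub>a = b (1 - m\<^sub>a)\<^sup>2 / (1 - 2 m\<^sub>a) = b (1 + m\<^sub>a\<^sup>2 / (1 - 2 m\<^sub>a))\<close>, which on the diagonal agrees with \<open>b\<close> to fourth order at \<open>a\<close>. Suppose that a certificate
  \<open>s\<close>, with \<open>b = (1 - h) s\<close>, is a factor of all of them, say \<open>s\<^sub>a = g\<^sub>a s\<close>. Then \<open>s\<^sub>a / b - g\<^sub>a = (s\<^sub>a / b) h\<close> is positive. Domination by a
  kernel that is constant to this order at \<open>a\<close> makes the increments of \<open>g\<^sub>a\<close>, and hence those of \<open>h\<close>, quadratically small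
  at \<open>a\<close> (\<open>quotient_quadratic_modulus\<close>). As \<open>a\<close> is arbitrary, \<open>h\<close> is constant and \<open>s\<close> is a multiple of
  \<open>b\<close>. But no positive multiple of \<open>b\<close> is a complete Pick kernel, by an explicit extremal two-point problem
  (\<open>not_complete_pick_kernel_bergman_multiple\<close>).\<close>

section \<open>Positive semi-definite functions\<close>

text \<open>A kernel is tested here on finite sets of an arbitrary type rather than on finite sequences of points: the
  Pick matrices below are functions on triples (point, matrix, row index), and kernels on such a set
  are pulled back and multiplied without any renumbering.\<close>

definition quad :: "'i set \<Rightarrow> ('i \<Rightarrow> 'i \<Rightarrow> complex) \<Rightarrow> ('i \<Rightarrow> complex) \<Rightarrow> complex" where
  "quad F \<kappa> c = (\<Sum>i\<in>F. \<Sum>j\<in>F. cnj (c i) * \<kappa> i j * c j)"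

definition psd_on :: "'i set \<Rightarrow> ('i \<Rightarrow> 'i \<Rightarrow> complex) \<Rightarrow> bool" where
  "psd_on S \<kappa> \<longleftrightarrow> (\<forall>F c. finite F \<longrightarrow> F \<subseteq> S \<longrightarrow> 0 \<le> quad F \<kappa> c)"

lemma psd_onI: "(\<And>F c. finite F \<Longrightarrow> F \<subseteq> S \<Longrightarrow> 0 \<le> quad F \<kappa> c) \<Longrightarrow> psd_on S \<kappa>"
  by (simp add: psd_on_def)

lemma psd_onD: "psd_on S \<kappa> \<Longrightarrow> finite F \<Longrightarrow> F \<subseteq> S \<Longrightarrow> 0 \<le> quad F \<kappa> c"
  by (simp add: psd_on_def)

lemma quad_cong: "(\<And>i j. i \<in> F \<Longrightarrow> j \<in> F \<Longrightarrow> \<kappa> i j = \<kappa>' i j) \<Longrightarrow> quad F \<kappa> c = quad F \<kappa>' c"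
  by (simp add: quad_def)

lemma psd_on_subset: "psd_on S \<kappa> \<Longrightarrow> T \<subseteq> S \<Longrightarrow> psd_on T \<kappa>"
  by (auto simp: psd_on_def)

lemma psd_on_cong:
  assumes "psd_on S \<kappa>" "\<And>i j. i \<in> S \<Longrightarrow> j \<in> S \<Longrightarrow> \<kappa>' i j = \<kappa> i j"
  shows "psd_on S \<kappa>'"
proof (rule psd_onI)
  fix F and c :: "_ \<Rightarrow> complex" assume F: "finite F" "F \<subseteq> S"
  then have "quad F \<kappa>' c = quad F \<kappa> c" using assms(2) by (intro quad_cong) blast
  then show "0 \<le> quad F \<kappa>' c" using psd_onD[OF assms(1) F] by simp
qed

lemma quad_add: "quad F (\<lambda>i j. \<kappa> i j + \<kappa>' i j) c = quad F \<kappa> c + quad F \<kappa>' c"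
  by (simp add: quad_def algebra_simps sum.distrib)

lemma psd_on_add: "psd_on S \<kappa> \<Longrightarrow> psd_on S \<kappa>' \<Longrightarrow> psd_on S (\<lambda>i j. \<kappa> i j + \<kappa>' i j)"
  by (simp add: psd_on_def quad_add)

lemma psd_on_zero: "psd_on S (\<lambda>i j. 0)"
  by (simp add: psd_on_def quad_def)

lemma psd_on_sum: "(\<And>m. m \<in> M \<Longrightarrow> psd_on S (\<kappa> m)) \<Longrightarrow> psd_on S (\<lambda>i j. \<Sum>m\<in>M. \<kappa> m i j)"
  by (induction M rule: infinite_finite_induct) (auto simp: psd_on_zero psd_on_add)

lemma psd_on_congruence:
  assumes "psd_on S \<kappa>" shows "psd_on S (\<lambda>i j. f i * \<kappa> i j * cnj (f j))"
proof (rule psd_onI)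
  fix F and c :: "_ \<Rightarrow> complex" assume F: "finite F" "F \<subseteq> S"
  have "quad F (\<lambda>i j. f i * \<kappa> i j * cnj (f j)) c = quad F \<kappa> (\<lambda>i. cnj (f i) * c i)"
    by (simp add: quad_def mult_ac)
  then show "0 \<le> quad F (\<lambda>i j. f i * \<kappa> i j * cnj (f j)) c" using psd_onD[OF assms F] by simp
qed

lemma mult_cnj_nonneg: "0 \<le> z * cnj z"
  by (simp add: less_eq_complex_def)

lemma quad_rank_one:
  "quad F (\<lambda>i j. f i * cnj (f j)) c = (\<Sum>i\<in>F. cnj (c i) * f i) * cnj (\<Sum>i\<in>F. cnj (c i) * f i)"
  unfolding quad_def cnj_sum sum_product by (simp add: mult_ac)

lemma psd_on_rank_one: "psd_on S (\<lambda>i j. f i * cnj (f j))"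
  by (simp only: psd_on_def quad_rank_one mult_cnj_nonneg) simp

lemma psd_on_scale:
  assumes "psd_on S \<kappa>" "0 \<le> a" shows "psd_on S (\<lambda>i j. a * \<kappa> i j)"
proof -
  have "quad F (\<lambda>i j. a * \<kappa> i j) c = a * quad F \<kappa> c" for F c
    by (simp add: quad_def sum_distrib_left mult_ac)
  then show ?thesis using assms by (simp add: psd_on_def)
qed

lemma psd_on_const: "0 \<le> a \<Longrightarrow> psd_on S (\<lambda>i j. a)"
  using psd_on_scale[OF psd_on_rank_one[of S "\<lambda>_. 1"], of a] by simp

text \<open>The map may identify points; coefficients at points with the same image add up.\<close>

lemma psd_on_pullback:
  assumes "psd_on S \<kappa>" "\<And>i. i \<in> T \<Longrightarrow> f i \<in> S"
  shows "psd_on T (\<lambda>i j. \<kappa> (f i) (f j))"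
proof (rule psd_onI)
  fix F and c :: "_ \<Rightarrow> complex" assume F: "finite F" "F \<subseteq> T"
  define d where "d x = (\<Sum>i | i \<in> F \<and> f i = x. c i)" for x
  have inner: "(\<Sum>j\<in>F. a * \<kappa> x (f j) * c j) = (\<Sum>y\<in>f ` F. a * \<kappa> x y * d y)" for a x
    by (subst sum.image_gen[OF F(1), of _ f]) (simp add: d_def sum_distrib_left)
  have "quad F (\<lambda>i j. \<kappa> (f i) (f j)) c = (\<Sum>i\<in>F. \<Sum>y\<in>f ` F. cnj (c i) * \<kappa> (f i) y * d y)"
    by (simp only: quad_def inner)
  also have "\<dots> = (\<Sum>x\<in>f ` F. \<Sum>i | i \<in> F \<and> f i = x. \<Sum>y\<in>f ` F. cnj (c i) * \<kappa> x y * d y)"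
    by (subst sum.image_gen[OF F(1), of _ f]) (simp add: Collect_conj_eq)
  also have "\<dots> = quad (f ` F) \<kappa> d"
    unfolding quad_def
    by (intro sum.cong refl) (simp add: d_def sum_distrib_right sum.swap[of _ "f ` F"])
  finally show "0 \<le> quad F (\<lambda>i j. \<kappa> (f i) (f j)) c"
    using psd_onD[OF assms(1), of "f ` F"] F assms(2) by auto
qed

lemma psd_on_lim:
  assumes "\<And>n. psd_on S (\<kappa> n)" "\<And>i j. i \<in> S \<Longrightarrow> j \<in> S \<Longrightarrow> (\<lambda>n. \<kappa> n i j) \<longlonglongrightarrow> \<kappa>' i j"
  shows "psd_on S \<kappa>'"
proof (rule psd_onI)
  fix F and c :: "_ \<Rightarrow> complex" assume F: "finite F" "F \<subseteq> S"
  have lim: "(\<lambda>n. quad F (\<kappa> n) c) \<longlonglongrightarrow> quad F \<kappa>' c"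
    unfolding quad_def using F(2) by (intro tendsto_intros assms(2)) auto
  have nn: "0 \<le> Re (quad F (\<kappa> n) c)" "Im (quad F (\<kappa> n) c) = 0" for n
    using psd_onD[OF assms(1) F, of n c] by (auto simp: less_eq_complex_def)
  have "0 \<le> Re (quad F \<kappa>' c)"
    by (rule LIMSEQ_le_const[OF tendsto_Re[OF lim]]) (use nn in blast)
  moreover have "Im (quad F \<kappa>' c) = 0"
    using tendsto_Im[OF lim] by (simp add: nn LIMSEQ_const_iff)
  ultimately show "0 \<le> quad F \<kappa>' c" by (simp add: less_eq_complex_def)
qed

lemma psd_on_two_points:
  assumes "psd_on S \<kappa>" "z \<in> S" "w \<in> S"
  shows "0 \<le> cnj a * \<kappa> z z * a + cnj a * \<kappa> z w * b + (cnj b * \<kappa> w z * a + cnj b * \<kappa> w w * b)"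
proof -
  have "psd_on {0, 1::nat} (\<lambda>i j. \<kappa> (if i = 0 then z else w) (if j = 0 then z else w))"
    by (rule psd_on_pullback[OF assms(1)]) (use assms in auto)
  from psd_onD[OF this, of "{0,1}" "\<lambda>i. if i = 0 then a else b"] show ?thesis
    by (simp add: quad_def algebra_simps)
qed

lemma psd_on_diag: "psd_on S \<kappa> \<Longrightarrow> z \<in> S \<Longrightarrow> 0 \<le> \<kappa> z z"
  using psd_on_two_points[of S \<kappa> z z 1 0] by simp

lemma psd_on_hermitian:
  assumes "psd_on S \<kappa>" "z \<in> S" "w \<in> S" shows "\<kappa> w z = cnj (\<kappa> z w)"
proof -
  have "Im (\<kappa> z z) = 0" "Im (\<kappa> w w) = 0"
    using psd_on_diag[OF assms(1)] assms by (auto simp: less_eq_complex_def)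
  then show ?thesis
    using psd_on_two_points[OF assms, of 1 1] psd_on_two_points[OF assms, of 1 \<i>]
    by (simp add: less_eq_complex_def complex_eq_iff)
qed

text \<open>A diagonal zero forces a zero row, because otherwise a second point with a suitable coefficient would
  make the form negative.\<close>

lemma psd_on_zero_diag:
  assumes "psd_on S \<kappa>" "z \<in> S" "w \<in> S" "\<kappa> w w = 0" shows "\<kappa> w z = 0"
proof (rule zero_if_quadratic)
  show "0 \<le> Re (\<kappa> z z)" using psd_on_diag[OF assms(1,2)] by (simp add: less_eq_complex_def)
  fix c :: complex
  have im: "Im (\<kappa> z z) = 0" using psd_on_diag[OF assms(1,2)] by (simp add: less_eq_complex_def)
  have "0 \<le> cnj (cnj c) * \<kappa> z z * cnj c - cnj (cnj c) * \<kappa> z w - cnj c * \<kappa> w z"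
    using psd_on_two_points[OF assms(1-3), of "cnj c" "-1"] assms(4) by (simp add: algebra_simps)
  then have "0 \<le> Re (c * cnj c * \<kappa> z z) - Re (c * \<kappa> z w) - Re (cnj c * \<kappa> w z)"
    by (simp add: less_eq_complex_def algebra_simps)
  moreover have "Re (c * \<kappa> z w) = Re (cnj c * \<kappa> w z)"
    using psd_on_hermitian[OF assms(1-3)] by simp
  moreover have "Re (c * cnj c * \<kappa> z z) = (cmod c)\<^sup>2 * Re (\<kappa> z z)"
    using im unfolding cmod_power2 by (simp add: power2_eq_square algebra_simps)
  ultimately show "2 * Re (cnj c * \<kappa> w z) \<le> (cmod c)\<^sup>2 * Re (\<kappa> z z)" by linarith
qed

text \<open>On coefficients \<open>e\<close>, the Schur complement takes the value that \<open>\<kappa>\<close> takes after the coefficient at \<open>p\<close>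
  has been changed so as to minimise the form. If \<open>\<kappa> p p = 0\<close>, then division by zero makes the
  Schur complement equal to \<open>\<kappa>\<close>.\<close>

lemma psd_on_schur_complement:
  assumes "psd_on S \<kappa>" "p \<in> S"
  shows "psd_on S (\<lambda>i j. \<kappa> i j - \<kappa> i p * \<kappa> p j / \<kappa> p p)"
proof (cases "\<kappa> p p = 0")
  case True
  then show ?thesis using assms(1) by simp
next
  case nz: False
  show ?thesis
  proof (rule psd_onI)
    fix F and c :: "_ \<Rightarrow> complex" assume F: "finite F" "F \<subseteq> S"
    define G where "G = insert p F"
    define e where "e i = (if i \<in> F then c i else 0)" for i
    have G: "finite G" "G \<subseteq> S" "p \<in> G" using F assms by (auto simp: G_def)
    define A where "A = (\<Sum>j\<in>G. \<kappa> p j * e j)"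
    define t where "t = - A / \<kappa> p p"
    have A': "(\<Sum>i\<in>G. cnj (e i) * \<kappa> i p) = cnj A"
      unfolding A_def cnj_sum using G
      by (intro sum.cong refl) (use psd_on_hermitian[OF assms(1) assms(2)] in auto)
    have to_G: "quad F \<mu> c = quad G \<mu> e" for \<mu>
    proof -
      have "quad F \<mu> c = (\<Sum>i\<in>F. \<Sum>j\<in>F. cnj (e i) * \<mu> i j * e j)" by (simp add: quad_def e_def)
      also have "\<dots> = quad G \<mu> e"
        unfolding quad_def using G
        by (intro sum.mono_neutral_cong_left) (auto simp: G_def e_def intro!: sum.mono_neutral_left)
      finally show ?thesis .
    qed
    define u where "u i = (if i = p then t else 0)" for i
    have u1: "(\<Sum>i\<in>G. cnj (u i) * x i) = cnj t * x p" for x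
      using G by (simp add: u_def if_distrib[of cnj] if_distrib[of "\<lambda>y. y * _"] cong: if_cong)
    have u2: "(\<Sum>i\<in>G. x i * u i) = x p * t" for x
      using G by (simp add: u_def if_distrib[of "\<lambda>y. _ * y"] cong: if_cong)
    have "quad G \<kappa> (\<lambda>i. e i + u i)
        = quad G \<kappa> e + (\<Sum>i\<in>G. cnj (u i) * (\<Sum>j\<in>G. \<kappa> i j * e j))
          + (\<Sum>i\<in>G. \<Sum>j\<in>G. cnj (e i) * \<kappa> i j * u j)
          + (\<Sum>i\<in>G. cnj (u i) * (\<Sum>j\<in>G. \<kappa> i j * u j))"
      by (simp add: quad_def algebra_simps sum.distrib sum_distrib_left)
    also have "\<dots> = quad G \<kappa> e + cnj t * A + cnj A * t + cnj t * (\<kappa> p p * t)"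
      by (simp only: u1 u2 A_def[symmetric] sum_distrib_right[symmetric] A')
    also have "\<dots> = quad G \<kappa> e - cnj A * A / \<kappa> p p"
    proof -
      have "cnj (\<kappa> p p) = \<kappa> p p" using psd_on_hermitian[OF assms assms(2)] by simp
      then show ?thesis using nz by (simp add: t_def field_simps)
    qed
    also have "\<dots> = quad G (\<lambda>i j. \<kappa> i j - \<kappa> i p * \<kappa> p j / \<kappa> p p) e"
    proof -
      have "cnj A * A / \<kappa> p p = quad G (\<lambda>i j. \<kappa> i p * \<kappa> p j / \<kappa> p p) e"
        unfolding A'[symmetric] unfolding A_def quad_def sum_product sum_divide_distrib
        by (simp add: mult_ac)
      then show ?thesis by (simp add: quad_def algebra_simps sum_subtractf)
    qed
    finally show "0 \<le> quad F (\<lambda>i j. \<kappa> i j - \<kappa> i p * \<kappa> p j / \<kappa> p p) c"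
      using psd_onD[OF assms(1) G(1,2), of "\<lambda>i. e i + u i"] by (simp add: to_G)
  qed
qed

text \<open>Induction on the number of points: splitting off the rank-one part of \<open>\<kappa>\<close> at a point \<open>p\<close> leaves the
  Schur complement, which vanishes in the row and the column of \<open>p\<close>, so that the rest of the product
  lives on fewer points; a rank-one factor is a congruence of \<open>\<mu>\<close>.\<close>

lemma psd_on_Schur_product:
  assumes \<kappa>: "psd_on S \<kappa>" and \<mu>: "psd_on S \<mu>"
  shows "psd_on S (\<lambda>i j. \<kappa> i j * \<mu> i j)"
proof (rule psd_onI)
  fix F and c :: "_ \<Rightarrow> complex" assume "finite F" "F \<subseteq> S"
  then show "0 \<le> quad F (\<lambda>i j. \<kappa> i j * \<mu> i j) c"
    using psd_on_subset[OF \<kappa> \<open>F \<subseteq> S\<close>]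
  proof (induction F arbitrary: \<kappa> rule: finite_induct)
    case empty
    then show ?case by (simp add: quad_def)
  next
    case (insert p F)
    let ?G = "insert p F"
    have p: "p \<in> ?G" by simp
    define \<nu> where "\<nu> i j = \<kappa> i j - \<kappa> i p * \<kappa> p j / \<kappa> p p" for i j
    have \<nu>: "psd_on ?G \<nu>" unfolding \<nu>_def by (rule psd_on_schur_complement[OF insert.prems(2) p])
    have van: "\<nu> p i = 0" "\<nu> i p = 0" if "i \<in> ?G" for i
    proof -
      show "\<nu> p i = 0"
        using psd_on_zero_diag[OF insert.prems(2) that p] by (cases "\<kappa> p p = 0") (auto simp: \<nu>_def)
      then show "\<nu> i p = 0" using psd_on_hermitian[OF \<nu> p that] by simp
    qed
    have "quad ?G (\<lambda>i j. \<kappa> i j * \<mu> i j) c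
        = quad ?G (\<lambda>i j. \<nu> i j * \<mu> i j) c + quad ?G (\<lambda>i j. (\<kappa> i p * \<kappa> p j / \<kappa> p p) * \<mu> i j) c"
      by (simp add: quad_add[symmetric] \<nu>_def algebra_simps)
    moreover have "quad ?G (\<lambda>i j. \<nu> i j * \<mu> i j) c = quad F (\<lambda>i j. \<nu> i j * \<mu> i j) c"
      using insert.hyps van by (simp add: quad_def)
    moreover have "0 \<le> quad F (\<lambda>i j. \<nu> i j * \<mu> i j) c"
      by (rule insert.IH) (use insert.prems psd_on_subset[OF \<nu>] in auto)
    moreover have "psd_on ?G (\<lambda>i j. (\<kappa> i p * \<kappa> p j / \<kappa> p p) * \<mu> i j)"
    proof (rule psd_on_cong)
      show "psd_on ?G (\<lambda>i j. (1 / \<kappa> p p) * (\<kappa> i p * \<mu> i j * cnj (\<kappa> j p)))"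
      proof (intro psd_on_scale psd_on_congruence psd_on_subset[OF \<mu>])
        show "0 \<le> 1 / \<kappa> p p" using psd_on_diag[OF insert.prems(2) p]
          by (auto simp: less_eq_complex_def Re_divide Im_divide)
      qed (use insert in auto)
      fix i j assume "i \<in> ?G" "j \<in> ?G"
      then show "\<kappa> i p * \<kappa> p j / \<kappa> p p * \<mu> i j = 1 / \<kappa> p p * (\<kappa> i p * \<mu> i j * cnj (\<kappa> j p))"
        using psd_on_hermitian[OF insert.prems(2) _ p, of j] by simp
    qed
    then have "0 \<le> quad ?G (\<lambda>i j. (\<kappa> i p * \<kappa> p j / \<kappa> p p) * \<mu> i j) c"
      by (rule psd_onD) (use insert in auto)
    ultimately show ?case by simp
  qed
qed

lemma psd_on_power: "psd_on S \<kappa> \<Longrightarrow> psd_on S (\<lambda>i j. \<kappa> i j ^ n)"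
  by (induction n) (auto intro: psd_on_const[of 1, simplified] psd_on_Schur_product simp: less_eq_complex_def)

lemma psd_on_szego:
  assumes "\<And>i. i \<in> S \<Longrightarrow> cmod (x i) < 1"
  shows "psd_on S (\<lambda>i j. 1 / (1 - x i * cnj (x j)))"
proof (rule psd_on_lim)
  show "psd_on S (\<lambda>i j. \<Sum>m<n. (x i * cnj (x j)) ^ m)" for n
    by (intro psd_on_sum psd_on_power psd_on_rank_one)
  fix i j assume "i \<in> S" "j \<in> S"
  then have "cmod (x i * cnj (x j)) < 1 * 1"
    unfolding norm_mult complex_mod_cnj by (intro mult_strict_mono' assms) auto
  then show "(\<lambda>n. \<Sum>m<n. (x i * cnj (x j)) ^ m) \<longlonglongrightarrow> 1 / (1 - x i * cnj (x j))"
    using geometric_sums[of "x i * cnj (x j)"] by (simp add: sums_def)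
qed

section \<open>Kernels and matrices\<close>

lemma psd_iff_psd_on:
  assumes A: "A \<in> carrier_mat m m"
  shows "psd m A \<longleftrightarrow> psd_on {..<m} (\<lambda>i j. A $$ (i, j))"
proof -
  have eq: "(A *\<^sub>v vec m c) \<bullet>c vec m c = quad {..<m} (\<lambda>i j. A $$ (i, j)) c" for c
  proof -
    have "(A *\<^sub>v vec m c) \<bullet>c vec m c = (\<Sum>i = 0..<m. (\<Sum>j = 0..<m. A $$ (i, j) * c j) * cnj (c i))"
      using A by (auto simp: scalar_prod_def conjugate_complex_def intro!: sum.cong)
    then show ?thesis
      by (simp add: quad_def lessThan_atLeast0 sum_distrib_left mult_ac)
  qed
  show ?thesis
  proof
    assume p: "psd m A"
    show "psd_on {..<m} (\<lambda>i j. A $$ (i, j))"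
    proof (rule psd_onI)
      fix F and c :: "_ \<Rightarrow> complex" assume F: "finite F" "F \<subseteq> {..<m}"
      define e where "e i = (if i \<in> F then c i else 0)" for i
      have "quad F (\<lambda>i j. A $$ (i, j)) c = (\<Sum>i\<in>F. \<Sum>j\<in>F. cnj (e i) * A $$ (i, j) * e j)"
        by (simp add: quad_def e_def)
      also have "\<dots> = quad {..<m} (\<lambda>i j. A $$ (i, j)) e"
        unfolding quad_def using F
        by (intro sum.mono_neutral_cong_left) (auto simp: e_def intro!: sum.mono_neutral_left)
      also have "0 \<le> \<dots>" using p unfolding eq[symmetric] psd_def by auto
      finally show "0 \<le> quad F (\<lambda>i j. A $$ (i, j)) c" .
    qed
  next
    assume q: "psd_on {..<m} (\<lambda>i j. A $$ (i, j))"
    show "psd m A"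
      unfolding psd_def
    proof (intro conjI A ballI)
      fix v :: "complex vec" assume "v \<in> carrier_vec m"
      then have v: "v = vec m (\<lambda>i. v $ i)" by auto
      show "0 \<le> (A *\<^sub>v v) \<bullet>c v"
        by (subst (1 2) v, subst eq, rule psd_onD[OF q]) auto
    qed
  qed
qed

lemma kernel_on_iff_psd_on: "kernel_on X k \<longleftrightarrow> X \<noteq> {} \<and> psd_on X k"
proof (intro iffI conjI)
  assume k: "kernel_on X k"
  then show "X \<noteq> {}" by (simp add: kernel_on_def)
  show "psd_on X k"
  proof (rule psd_onI)
    fix F and c :: "_ \<Rightarrow> complex" assume F: "finite F" "F \<subseteq> X"
    obtain xs where xs: "set xs = F" "distinct xs" using finite_distinct_list[OF F(1)] by blast
    define ys where "ys = map (\<lambda>w. (w, c w)) xs"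
    have "0 \<le> kform (kcomb X k ys) ys" using F xs by (intro kernel_pos[OF k]) (auto simp: ys_def)
    also have "kform (kcomb X k ys) ys
        = (\<Sum>i\<in>F. cnj (c i) * (\<Sum>j\<in>F. c j * kernel_fun X k j i))"
      by (simp add: kform_def kcomb_def ys_def o_def sum_list_distinct_conv_sum_set xs)
    also have "\<dots> = quad F k c"
      unfolding quad_def sum_distrib_left using F(2)
      by (intro sum.cong refl) (auto simp: kernel_fun_def)
    finally show "0 \<le> quad F k c" .
  qed
next
  assume k: "X \<noteq> {} \<and> psd_on X k"
  show "kernel_on X k"
    unfolding kernel_on_def
  proof (intro conjI allI impI)
    fix n and z :: "nat \<Rightarrow> 'a" assume z: "\<forall>i<n. z i \<in> X"
    have "psd_on {..<n} (\<lambda>i j. k (z i) (z j))"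
      by (rule psd_on_pullback) (use k z in auto)
    then have "psd_on {..<n} (\<lambda>i j. mat n n (\<lambda>(i, j). k (z i) (z j)) $$ (i, j))"
      by (rule psd_on_cong) auto
    then show "psd n (mat n n (\<lambda>(i, j). k (z i) (z j)))" by (subst psd_iff_psd_on) auto
  qed (use k in simp)
qed

lemma psd_on_block_mat:
  assumes "psd (n * N) (block_mat n N B)"
  shows "psd_on ({..<n} \<times> {..<N}) (\<lambda>(i, a) (j, b). B i j $$ (a, b))"
proof -
  let ?f = "\<lambda>(i, a). i * N + a"
  have f: "?f x < n * N" if x: "x \<in> {..<n} \<times> {..<N}" for x
  proof -
    obtain i a where x: "x = (i, a)" "i < n" "a < N" using x by (cases x) auto
    have "i * N + a < Suc i * N" using x by simp
    also have "\<dots> \<le> n * N" using x by (intro mult_right_mono) auto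
    finally show ?thesis by (simp add: x)
  qed
  have "psd_on {..<n * N} (\<lambda>p q. block_mat n N B $$ (p, q))"
    using assms by (subst psd_iff_psd_on[symmetric]) (auto simp: block_mat_def)
  then have "psd_on ({..<n} \<times> {..<N}) (\<lambda>x y. block_mat n N B $$ (?f x, ?f y))"
    by (rule psd_on_pullback) (use f in auto)
  then show ?thesis
    by (rule psd_on_cong) (use f in \<open>auto simp: block_mat_def\<close>)
qed

lemma index_mult_mat_adjoint:
  assumes "A \<in> carrier_mat N N" "B \<in> carrier_mat N N" "a < N" "b < N"
  shows "(A * mat_adjoint B) $$ (a, b) = (\<Sum>c<N. A $$ (a, c) * cnj (B $$ (b, c)))"
  using assms
  by (auto simp: mat_adjoint_def scalar_prod_def mat_of_rows_def lessThan_atLeast0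
      conjugate_complex_def intro!: sum.cong)

section \<open>Membership in a reproducing kernel Hilbert space\<close>

lemma cmod_sum_mult_le:
  "(cmod (\<Sum>a\<in>A. d a * x a))\<^sup>2 \<le> (\<Sum>a\<in>A. (cmod (d a))\<^sup>2) * (\<Sum>a\<in>A. (cmod (x a))\<^sup>2)"
proof -
  have "cmod (\<Sum>a\<in>A. d a * x a) \<le> (\<Sum>a\<in>A. \<bar>cmod (d a)\<bar> * \<bar>cmod (x a)\<bar>)"
    by (rule order_trans[OF norm_sum]) (simp add: norm_mult)
  also have "\<dots> \<le> L2_set (\<lambda>a. cmod (d a)) A * L2_set (\<lambda>a. cmod (x a)) A"
    by (rule L2_set_mult_ineq)
  finally have "(cmod (\<Sum>a\<in>A. d a * x a))\<^sup>2 \<le> (L2_set (\<lambda>a. cmod (d a)) A * L2_set (\<lambda>a. cmod (x a)) A)\<^sup>2"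
    by (intro power_mono) auto
  then show ?thesis by (simp add: power_mult_distrib L2_set_def sum_nonneg)
qed

lemma kcomb_append: "kcomb X k (xs @ ys) = (\<lambda>z. kcomb X k xs z + kcomb X k ys z)"
  by (simp add: kcomb_def)

lemma kform_append: "kform f (xs @ ys) = kform f xs + kform f ys"
  by (simp add: kform_def)

lemma kcomb_scale: "kcomb X k (map (\<lambda>(w, c). (w, a * c)) xs) = (\<lambda>z. a * kcomb X k xs z)"
  by (induction xs) (auto simp: kcomb_simps algebra_simps)

lemma kform_scale_list: "kform f (map (\<lambda>(w, c). (w, a * c)) xs) = cnj a * kform f xs"
  by (induction xs) (auto simp: kform_simps algebra_simps)

lemma psd_on_kform:
  assumes "psd_on X \<kappa>" "fst ` set xs \<subseteq> X" shows "0 \<le> kform (kcomb X \<kappa> xs) xs"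
proof (cases "X = {}")
  case True
  then show ?thesis using assms by (simp add: kform_simps)
next
  case False
  then show ?thesis using assms by (intro kernel_pos) (simp_all add: kernel_on_iff_psd_on)
qed

context pre_rkhs
begin

lemma kcomb_mem: "fst ` set xs \<subseteq> X \<Longrightarrow> kcomb X k xs \<in> H"
  by (induction xs) (auto simp: kcomb_simps intro!: zero add scale kernel_mem)

lemma ip_kcomb: assumes "f \<in> H" "fst ` set xs \<subseteq> X" shows "ip f (kcomb X k xs) = kform f xs"
  using assms(2)
proof (induction xs)
  case Nil
  then show ?case using ip_scale2[OF zero assms(1), of 0] by (simp add: kcomb_simps kform_simps)
next
  case (Cons p xs)
  obtain w c where p: "p = (w, c)" by force
  have w: "w \<in> X" "fst ` set xs \<subseteq> X" using Cons.prems p by auto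
  show ?case
    unfolding p kcomb_simps kform_simps
    by (simp only: ip_add2[OF scale[OF kernel_mem[OF w(1)]] kcomb_mem[OF w(2)] assms(1)]
        ip_scale2[OF kernel_mem[OF w(1)] assms(1)] reproducing[OF assms(1) w(1)] Cons.IH[OF w(2)])
qed

end

context rkhs
begin

text \<open>A Riesz representation argument. The boundedness says that \<open>u \<mapsto> kform f xs\<close>, for the combination
  \<open>u = kcomb X k xs\<close>, is a bounded antilinear functional on the span of the kernel functions, and the vector representing it must be \<open>f\<close>.
  It is found as the limit of a sequence minimising \<open>\<parallel>u\<parallel>\<^sup>2 - 2 Re (kform f xs)\<close>. Working with the lists \<open>xs\<close>
  instead of the functions \<open>u\<close> avoids showing that the functional is well defined.\<close>

lemma mem_if_bounded:
  assumes supp_f: "\<And>z. z \<notin> X \<Longrightarrow> f z = 0" and C: "C \<ge> 0"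
    and bd: "\<And>xs. fst ` set xs \<subseteq> X \<Longrightarrow> cmod (kform f xs) \<le> C * nrm (kcomb X k xs)"
  shows "f \<in> H" "nrm f \<le> C"
proof -
  let ?U = "kcomb X k"
  define L where "L = {xs :: ('a \<times> complex) list. fst ` set xs \<subseteq> X}"
  define J where "J xs = (nrm (?U xs))\<^sup>2 - 2 * Re (kform f xs)" for xs
  define d where "d = Inf (J ` L)"
  define r :: "nat \<Rightarrow> real" where "r n = 1 / real (Suc n)" for n
  have r: "r n > 0" for n by (simp add: r_def)
  have UL: "?U xs \<in> H" if "xs \<in> L" for xs using that kcomb_mem by (simp add: L_def)
  have J_ge: "- C\<^sup>2 \<le> J xs" if "xs \<in> L" for xs
  proof -
    have "Re (kform f xs) \<le> C * nrm (?U xs)"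
      using bd[of xs] that complex_Re_le_cmod[of "kform f xs"] by (simp add: L_def)
    moreover have "0 \<le> (C - nrm (?U xs))\<^sup>2" by simp
    ultimately show ?thesis by (simp add: J_def power2_diff)
  qed
  have bdd: "bdd_below (J ` L)" by (rule bdd_belowI[of _ "- C\<^sup>2"]) (use J_ge in auto)
  have ne: "J ` L \<noteq> {}" by (auto simp: L_def intro: exI[of _ "[]"])
  have d_le: "d \<le> J xs" if "xs \<in> L" for xs
    unfolding d_def using that by (intro cInf_lower bdd) auto
  have "\<exists>xs \<in> L. J xs < d + r n" for n
    using cInf_lessD[OF ne, of "d + r n"] r[of n] by (auto simp: d_def)
  then obtain xs where xs: "\<And>n. xs n \<in> L" "\<And>n. J (xs n) < d + r n"
    by metis
  have GH: "?U (xs n) \<in> H" for n using xs UL by blast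
  \<comment> \<open>The parallelogram law, applied at the midpoint of two almost minimising combinations.\<close>
  have close: "(nrm (\<lambda>z. ?U (xs m) z - ?U (xs n) z))\<^sup>2 \<le> 2 * r m + 2 * r n" for m n
  proof -
    \<comment> \<open>Averaging the combinations on the level of lists: concatenate and halve the coefficients.\<close>
    define mid where "mid = map (\<lambda>(w, c). (w, (1/2) * c)) (xs m @ xs n)"
    have mid: "mid \<in> L" using xs(1)[of m] xs(1)[of n] by (auto simp: mid_def L_def)
    have Um: "?U mid = (\<lambda>z. (1/2) * (?U (xs m) z + ?U (xs n) z))"
      unfolding mid_def kcomb_scale kcomb_append by simp
    have "kform f mid = (kform f (xs m) + kform f (xs n)) / 2"
      unfolding mid_def kform_scale_list kform_append by simp
    then have km: "2 * Re (kform f mid) = Re (kform f (xs m)) + Re (kform f (xs n))"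
      by (simp only: Re_divide_numeral plus_complex.sel) simp
    have "nrm (\<lambda>z. ?U (xs m) z + ?U (xs n) z) = 2 * nrm (?U mid)"
      unfolding Um by (subst nrm_scale) (auto intro: add GH)
    then have "4 * (nrm (?U mid))\<^sup>2 = (nrm (\<lambda>z. ?U (xs m) z + ?U (xs n) z))\<^sup>2" by simp
    then show ?thesis
      using parallelogram[OF GH[of m] GH[of n]] d_le[OF mid] xs(2)[of m] xs(2)[of n] km
      unfolding J_def by linarith
  qed
  have "cauchy (\<lambda>n. ?U (xs n))"
    unfolding cauchy_def
  proof (intro allI impI)
    fix e :: real assume e: "e > 0"
    then have "0 < e\<^sup>2 / 4" by simp
    then obtain M where M: "r M < e\<^sup>2 / 4"
      using nat_approx_posE[of "e\<^sup>2/4"] by (auto simp: r_def)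
    have "nrm (\<lambda>z. ?U (xs m) z - ?U (xs n) z) < e" if "m \<ge> M" "n \<ge> M" for m n
    proof (rule power2_less_imp_less)
      have "r m \<le> r M" "r n \<le> r M" using that by (auto simp: r_def field_simps)
      then show "(nrm (\<lambda>z. ?U (xs m) z - ?U (xs n) z))\<^sup>2 < e\<^sup>2" using close[of m n] M by simp
    qed (use e in simp)
    then show "\<exists>M. \<forall>m\<ge>M. \<forall>n\<ge>M. nrm (\<lambda>z. ?U (xs m) z - ?U (xs n) z) < e"
      by (intro exI[of _ M] allI impI)
  qed
  then obtain g where g: "g \<in> H" "(\<lambda>n. nrm (\<lambda>z. ?U (xs n) z - g z)) \<longlonglongrightarrow> 0"
    using complete[of "\<lambda>n. ?U (xs n)"] GH by blast
  have "f w - g w = 0" if w: "w \<in> X" for w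
  proof (rule zero_if_quadratic)
    let ?k = "kernel_fun X k w"
    fix c :: complex
    have ineq: "2 * Re (cnj c * (f w - ?U (xs n) w)) - (cmod c)\<^sup>2 * (nrm ?k)\<^sup>2 \<le> r n" for n
    proof -
      have "(w, c) # xs n \<in> L" using xs(1)[of n] w by (auto simp: L_def)
      then have "d \<le> J ((w, c) # xs n)" by (rule d_le)
      also have "\<dots> = (nrm (\<lambda>z. c * ?k z + ?U (xs n) z))\<^sup>2 - 2 * Re (cnj c * f w) - 2 * Re (kform f (xs n))"
        by (simp add: J_def kcomb_simps kform_simps)
      also have "(nrm (\<lambda>z. c * ?k z + ?U (xs n) z))\<^sup>2
          = (cmod c)\<^sup>2 * (nrm ?k)\<^sup>2 + 2 * Re (cnj c * ?U (xs n) w) + (nrm (?U (xs n)))\<^sup>2"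
      proof -
        have "Re (ip (\<lambda>z. c * ?k z) (?U (xs n))) = Re (cnj c * ?U (xs n) w)"
          using w GH by (simp add: ip_scale kernel_mem ip_kernel)
        then show ?thesis
          using w GH by (simp add: nrm_add_sq scale kernel_mem nrm_scale power_mult_distrib)
      qed
      finally show ?thesis using xs(2)[of n] by (simp add: J_def algebra_simps)
    qed
    have "(\<lambda>n. 2 * Re (cnj c * (f w - ?U (xs n) w)) - (cmod c)\<^sup>2 * (nrm ?k)\<^sup>2)
        \<longlonglongrightarrow> 2 * Re (cnj c * (f w - g w)) - (cmod c)\<^sup>2 * (nrm ?k)\<^sup>2"
      by (intro tendsto_intros conv_pointwise GH g)
    moreover have "r \<longlonglongrightarrow> 0"
      using LIMSEQ_inverse_real_of_nat by (simp add: r_def[abs_def] inverse_eq_divide)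
    ultimately have "2 * Re (cnj c * (f w - g w)) - (cmod c)\<^sup>2 * (nrm ?k)\<^sup>2 \<le> 0"
      by (rule LIMSEQ_le) (use ineq in blast)
    then show "2 * Re (cnj c * (f w - g w)) \<le> (cmod c)\<^sup>2 * (nrm ?k)\<^sup>2" by simp
  qed simp
  then have fg: "f = g" using supp supp_f g by (metis eq_iff_diff_eq_0 ext)
  then show "f \<in> H" using g by blast
  have "Re (ip f f) \<le> C * (nrm f + 0)"
  proof (rule LIMSEQ_le)
    show "(\<lambda>n. Re (ip (?U (xs n)) f)) \<longlonglongrightarrow> Re (ip f f)"
      unfolding fg by (intro tendsto_Re conv_ip GH g)
    show "(\<lambda>n. C * (nrm f + nrm (\<lambda>z. ?U (xs n) z - g z))) \<longlonglongrightarrow> C * (nrm f + 0)"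
      by (intro tendsto_intros g)
    have "Re (ip (?U (xs n)) f) \<le> C * (nrm f + nrm (\<lambda>z. ?U (xs n) z - g z))" for n
    proof -
      have xn: "fst ` set (xs n) \<subseteq> X" using xs by (simp add: L_def)
      have "ip (?U (xs n)) f = cnj (kform f (xs n))"
        using ip_kcomb[OF \<open>f \<in> H\<close> xn] ip_cnj[OF \<open>f \<in> H\<close> GH[of n]] by simp
      then have "Re (ip (?U (xs n)) f) \<le> cmod (kform f (xs n))"
        using complex_Re_le_cmod by (metis complex_mod_cnj)
      also have "\<dots> \<le> C * nrm (?U (xs n))" by (rule bd[OF xn])
      also have "\<dots> \<le> C * (nrm f + nrm (\<lambda>z. ?U (xs n) z - g z))"
        using nrm_triangle[OF g(1) diff[OF GH[of n] g(1)]] C fg by (intro mult_left_mono) auto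
      finally show ?thesis .
    qed
    then show "\<exists>N. \<forall>n\<ge>N. Re (ip (?U (xs n)) f) \<le> C * (nrm f + nrm (\<lambda>z. ?U (xs n) z - g z))"
      by blast
  qed
  then have "nrm f * nrm f \<le> C * nrm f"
    using nrm_sq_Re[OF \<open>f \<in> H\<close>] by (simp add: power2_eq_square)
  then show "nrm f \<le> C" using nrm_nonneg[OF \<open>f \<in> H\<close>] C
    by (cases "nrm f = 0") (auto simp: mult_le_cancel_right)
qed

text \<open>At the coefficients \<open>xs\<close>, the quadratic form of \<open>C\<^sup>2 k - f f\<^sup>*\<close> is \<open>C\<^sup>2 \<parallel>kcomb X k xs\<parallel>\<^sup>2 - |kform f xs|\<^sup>2\<close>, so its
  positivity is the boundedness that the Riesz argument needs.\<close>

lemma mem_if_psd: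
  assumes supp_f: "\<And>z. z \<notin> X \<Longrightarrow> f z = 0" and C: "C \<ge> 0"
    and psd: "psd_on X (\<lambda>i j. of_real (C\<^sup>2) * k i j - f i * cnj (f j))"
  shows "f \<in> H" "nrm f \<le> C"
proof -
  have "cmod (kform f xs) \<le> C * nrm (kcomb X k xs)" if xs: "fst ` set xs \<subseteq> X" for xs
  proof -
    let ?\<kappa> = "\<lambda>i j. of_real (C\<^sup>2) * k i j - f i * cnj (f j)"
    have comb: "kcomb X ?\<kappa> xs z = of_real (C\<^sup>2) * kcomb X k xs z + (- cnj (kform f xs)) * f z" for z
      by (induction xs) (auto simp: kcomb_simps kform_simps kernel_fun_def supp_f algebra_simps)
    have "0 \<le> kform (kcomb X ?\<kappa> xs) xs" by (rule psd_on_kform[OF psd xs])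
    also have "kcomb X ?\<kappa> xs = (\<lambda>z. of_real (C\<^sup>2) * kcomb X k xs z + (- cnj (kform f xs)) * f z)"
      using comb by blast
    also have "kform \<dots> xs = of_real (C\<^sup>2) * kform (kcomb X k xs) xs - cnj (kform f xs) * kform f xs"
      by (simp only: kform_add kform_scale) simp
    also have "kform (kcomb X k xs) xs = of_real ((nrm (kcomb X k xs))\<^sup>2)"
      using ip_kcomb[OF kcomb_mem[OF xs] xs] nrm_sq[OF kcomb_mem[OF xs]] by simp
    finally have "0 \<le> C\<^sup>2 * (nrm (kcomb X k xs))\<^sup>2 - (cmod (kform f xs))\<^sup>2"
      unfolding cmod_power2 by (simp add: less_eq_complex_def power2_eq_square)
    then have "(cmod (kform f xs))\<^sup>2 \<le> (C * nrm (kcomb X k xs))\<^sup>2" by (simp add: power_mult_distrib)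
    then show ?thesis by (rule power2_le_imp_le) (use C kcomb_mem[OF xs] in auto)
  qed
  then show "f \<in> H" "nrm f \<le> C" using mem_if_bounded[OF supp_f C] by auto
qed

text \<open>A column \<open>f\<close> with \<open>k \<ge> f f\<^sup>*\<close> is a contraction from \<open>C\<^sup>A\<close> to \<open>H\<close>.\<close>

lemma family_mem_if_psd:
  assumes supp_f: "\<And>a z. a \<in> A \<Longrightarrow> z \<notin> X \<Longrightarrow> f a z = 0"
    and psd: "psd_on X (\<lambda>i j. k i j - (\<Sum>a\<in>A. f a i * cnj (f a j)))"
  shows "(\<lambda>z. \<Sum>a\<in>A. d a * f a z) \<in> H"
    and "(nrm (\<lambda>z. \<Sum>a\<in>A. d a * f a z))\<^sup>2 \<le> (\<Sum>a\<in>A. (cmod (d a))\<^sup>2)"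
proof -
  define D where "D = (\<Sum>a\<in>A. (cmod (d a))\<^sup>2)"
  have D: "0 \<le> D" by (simp add: D_def sum_nonneg)
  let ?g = "\<lambda>z. \<Sum>a\<in>A. d a * f a z"
  have cs: "psd_on X (\<lambda>i j. of_real D * (\<Sum>a\<in>A. f a i * cnj (f a j)) - ?g i * cnj (?g j))"
  proof (rule psd_onI)
    fix F and c :: "_ \<Rightarrow> complex" assume "finite F" "F \<subseteq> X"
    define x where "x a = (\<Sum>i\<in>F. cnj (c i) * f a i)" for a
    have sumg: "(\<Sum>i\<in>F. cnj (c i) * ?g i) = (\<Sum>a\<in>A. d a * x a)"
      unfolding x_def sum_distrib_left by (subst sum.swap) (simp add: mult_ac)
    have "quad F (\<lambda>i j. of_real D * (\<Sum>a\<in>A. f a i * cnj (f a j)) - ?g i * cnj (?g j)) c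
        = of_real D * quad F (\<lambda>i j. \<Sum>a\<in>A. f a i * cnj (f a j)) c - quad F (\<lambda>i j. ?g i * cnj (?g j)) c"
      by (simp add: quad_def right_diff_distrib left_diff_distrib sum_subtractf sum_distrib_left mult_ac)
    also have "quad F (\<lambda>i j. \<Sum>a\<in>A. f a i * cnj (f a j)) c = (\<Sum>a\<in>A. quad F (\<lambda>i j. f a i * cnj (f a j)) c)"
      unfolding quad_def sum_distrib_left sum_distrib_right
      by (subst sum.swap[of _ A F], subst sum.swap[of _ A F]) simp
    also have "\<dots> = (\<Sum>a\<in>A. of_real ((cmod (x a))\<^sup>2))"
      unfolding quad_rank_one x_def[symmetric] complex_norm_square ..
    also have "quad F (\<lambda>i j. ?g i * cnj (?g j)) c = of_real ((cmod (\<Sum>a\<in>A. d a * x a))\<^sup>2)"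
      unfolding quad_rank_one sumg complex_norm_square ..
    finally show "0 \<le> quad F (\<lambda>i j. of_real D * (\<Sum>a\<in>A. f a i * cnj (f a j)) - ?g i * cnj (?g j)) c"
      using cmod_sum_mult_le[of d x A]
      by (simp add: less_eq_complex_def D_def flip: of_real_sum of_real_mult of_real_diff)
  qed
  have "psd_on X (\<lambda>i j. of_real ((sqrt D)\<^sup>2) * k i j - ?g i * cnj (?g j))"
    by (rule psd_on_cong[OF psd_on_add[OF psd_on_scale[OF psd, of "of_real D"] cs]])
      (use D in \<open>auto simp: less_eq_complex_def algebra_simps\<close>)
  then have "?g \<in> H \<and> nrm ?g \<le> sqrt D"
    using mem_if_psd[of ?g "sqrt D"] supp_f D by (simp add: sum.neutral)
  then show g: "?g \<in> H" and "(nrm ?g)\<^sup>2 \<le> (\<Sum>a\<in>A. (cmod (d a))\<^sup>2)"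
    using D power_mono[of "nrm ?g" "sqrt D" 2] nrm_nonneg[of ?g] by (auto simp: D_def[symmetric])
qed

end

context pre_rkhs
begin

lemma sum_mem: "(\<And>i. i \<in> F \<Longrightarrow> v i \<in> H) \<Longrightarrow> (\<lambda>z. \<Sum>i\<in>F. c i * v i z) \<in> H"
proof (induction F rule: infinite_finite_induct)
  case (insert i F)
  then show ?case using add[OF scale[of "v i" "c i"], of "\<lambda>z. \<Sum>i\<in>F. c i * v i z"] by simp
qed (simp_all add: zero)

lemma ip_sum: "(\<And>i. i \<in> F \<Longrightarrow> v i \<in> H) \<Longrightarrow> h \<in> H \<Longrightarrow>
    ip (\<lambda>z. \<Sum>i\<in>F. c i * v i z) h = (\<Sum>i\<in>F. c i * ip (v i) h)"
  by (induction F rule: infinite_finite_induct) (auto simp: ip_zero ip_add scale sum_mem ip_scale)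

lemma ip_sum2: assumes "\<And>i. i \<in> F \<Longrightarrow> v i \<in> H" "h \<in> H"
  shows "ip h (\<lambda>z. \<Sum>i\<in>F. c i * v i z) = (\<Sum>i\<in>F. cnj (c i) * ip h (v i))"
proof -
  have "ip h (\<lambda>z. \<Sum>i\<in>F. c i * v i z) = cnj (\<Sum>i\<in>F. c i * ip (v i) h)"
    using assms by (subst ip_cnj[of _ h]) (auto simp: sum_mem ip_sum)
  also have "\<dots> = (\<Sum>i\<in>F. cnj (c i) * ip h (v i))"
    unfolding cnj_sum using assms by (intro sum.cong refl) (simp add: ip_cnj[of _ h])
  finally show ?thesis .
qed

lemma quad_gram: assumes "\<And>i. i \<in> F \<Longrightarrow> v i \<in> H"
  shows "quad F (\<lambda>i j. ip (v j) (v i)) c = of_real ((nrm (\<lambda>z. \<Sum>i\<in>F. c i * v i z))\<^sup>2)"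
proof -
  have "of_real ((nrm (\<lambda>z. \<Sum>i\<in>F. c i * v i z))\<^sup>2) = ip (\<lambda>z. \<Sum>i\<in>F. c i * v i z) (\<lambda>z. \<Sum>i\<in>F. c i * v i z)"
    by (rule nrm_sq[symmetric]) (rule sum_mem[OF assms])
  also have "\<dots> = (\<Sum>i\<in>F. cnj (c i) * (\<Sum>j\<in>F. c j * ip (v j) (v i)))"
    by (subst ip_sum2[OF assms sum_mem[OF assms]]) (auto simp: ip_sum assms)
  finally show ?thesis by (simp add: quad_def sum_distrib_left mult_ac)
qed

text \<open>The adjoint of a contraction \<open>C\<^sup>B \<rightarrow> H\<close> is a contraction.\<close>

lemma bessel:
  assumes e: "\<And>b. b \<in> B \<Longrightarrow> e b \<in> H"
    and bd: "\<And>d. (nrm (\<lambda>z. \<Sum>b\<in>B. d b * e b z))\<^sup>2 \<le> (\<Sum>b\<in>B. (cmod (d b))\<^sup>2)"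
    and v: "v \<in> H"
  shows "(\<Sum>b\<in>B. (cmod (ip v (e b)))\<^sup>2) \<le> (nrm v)\<^sup>2"
proof -
  define s where "s = (\<Sum>b\<in>B. (cmod (ip v (e b)))\<^sup>2)"
  define w where "w = (\<lambda>z. \<Sum>b\<in>B. ip v (e b) * e b z)"
  have w: "w \<in> H" unfolding w_def by (rule sum_mem[OF e])
  have "ip v w = of_real s"
    unfolding w_def s_def of_real_sum complex_norm_square
    by (subst ip_sum2[OF e v]) (simp_all add: mult.commute)
  then have "s \<le> nrm v * nrm w" using cauchy_schwarz[OF v w] by simp
  moreover have "s \<ge> 0" by (simp add: s_def sum_nonneg)
  ultimately have "s\<^sup>2 \<le> (nrm v * nrm w)\<^sup>2" by (intro power_mono)
  also have "\<dots> \<le> (nrm v)\<^sup>2 * s"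
    using bd[of "\<lambda>b. ip v (e b)"] by (simp add: power_mult_distrib mult_left_mono w_def s_def)
  finally have "s * s \<le> (nrm v)\<^sup>2 * s" by (simp add: power2_eq_square)
  then show ?thesis using \<open>s \<ge> 0\<close> by (cases "s = 0") (auto simp: s_def[symmetric] mult_le_cancel_right)
qed

text \<open>Bessel's inequality for all combinations of the vectors \<open>v i\<close> at once.\<close>

lemma psd_on_gram_minus_projection:
  assumes e: "\<And>b. b \<in> B \<Longrightarrow> e b \<in> H"
    and bd: "\<And>d. (nrm (\<lambda>z. \<Sum>b\<in>B. d b * e b z))\<^sup>2 \<le> (\<Sum>b\<in>B. (cmod (d b))\<^sup>2)"
    and v: "\<And>i. i \<in> I \<Longrightarrow> v i \<in> H"
  shows "psd_on I (\<lambda>i j. ip (v j) (v i) - (\<Sum>b\<in>B. ip (e b) (v i) * cnj (ip (e b) (v j))))"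
proof (rule psd_onI)
  fix F and c :: "_ \<Rightarrow> complex" assume F: "finite F" "F \<subseteq> I"
  let ?v = "\<lambda>z. \<Sum>i\<in>F. c i * v i z"
  have vF: "v i \<in> H" if "i \<in> F" for i using v F that by blast
  have bes: "(\<Sum>b\<in>B. (cmod (ip ?v (e b)))\<^sup>2) \<le> (nrm ?v)\<^sup>2"
    by (rule bessel[OF e bd sum_mem[OF vF]])
  have "quad F (\<lambda>i j. ip (v j) (v i) - (\<Sum>b\<in>B. ip (e b) (v i) * cnj (ip (e b) (v j)))) c
     = quad F (\<lambda>i j. ip (v j) (v i)) c - (\<Sum>b\<in>B. quad F (\<lambda>i j. ip (e b) (v i) * cnj (ip (e b) (v j))) c)"
    unfolding quad_def sum_distrib_left sum_distrib_right left_diff_distrib right_diff_distrib sum_subtractf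
    by (subst sum.swap[of _ B F], subst sum.swap[of _ B F]) simp
  also have "(\<Sum>b\<in>B. quad F (\<lambda>i j. ip (e b) (v i) * cnj (ip (e b) (v j))) c)
      = (\<Sum>b\<in>B. of_real ((cmod (ip ?v (e b)))\<^sup>2))"
  proof (intro sum.cong refl)
    fix b assume b: "b \<in> B"
    have "(\<Sum>i\<in>F. cnj (c i) * ip (e b) (v i)) = ip (e b) ?v" by (rule ip_sum2[symmetric, OF vF e[OF b]])
    also have "\<dots> = cnj (ip ?v (e b))" by (rule ip_cnj[OF sum_mem[OF vF] e[OF b]])
    finally show "quad F (\<lambda>i j. ip (e b) (v i) * cnj (ip (e b) (v j))) c = of_real ((cmod (ip ?v (e b)))\<^sup>2)"
      unfolding quad_rank_one complex_norm_square by simp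
  qed
  finally show "0 \<le> quad F (\<lambda>i j. ip (v j) (v i) - (\<Sum>b\<in>B. ip (e b) (v i) * cnj (ip (e b) (v j)))) c"
    using bes
    by (simp add: quad_gram vF less_eq_complex_def flip: of_real_sum of_real_diff)
qed

end

text \<open>This is the Cauchy--Schwarz inequality for \<open>\<kappa>\<^sub>z - \<kappa>\<^sub>a\<close> and \<open>\<kappa>\<^sub>w\<close>: the increments of all functions \<open>\<kappa>\<^sub>w\<close> are
  controlled by a second difference of \<open>\<kappa>\<close> at the two points \<open>z\<close> and \<open>a\<close>.\<close>

lemma psd_on_diff_bound:
  assumes \<kappa>: "psd_on S \<kappa>" and S: "z \<in> S" "a \<in> S" "w \<in> S"
  shows "(cmod (\<kappa> z w - \<kappa> a w))\<^sup>2 \<le> Re (\<kappa> z z - \<kappa> z a - \<kappa> a z + \<kappa> a a) * Re (\<kappa> w w)"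
proof -
  have "kernel_on S \<kappa>" using \<kappa> S by (auto simp: kernel_on_iff_psd_on)
  then obtain H ip where "rkhs S \<kappa> H ip" using rkhs_exists by blast
  then interpret rkhs S \<kappa> H ip .
  let ?K = "kernel_fun S \<kappa>"
  have K: "?K y \<in> H" if "y \<in> S" for y using kernel_mem that .
  have val: "?K y x = \<kappa> x y" if "x \<in> S" for x y using that by (simp add: kernel_fun_def)
  define d where "d = (\<lambda>x. ?K z x - ?K a x)"
  have d: "d \<in> H" unfolding d_def by (intro diff K S)
  have "ip (?K w) d = \<kappa> z w - \<kappa> a w"
    unfolding d_def by (subst ip_diff2) (simp_all add: K S reproducing val)
  moreover have "ip d d = \<kappa> z z - \<kappa> z a - \<kappa> a z + \<kappa> a a"
    unfolding d_def
    by (subst ip_diff2) (simp_all add: K S diff reproducing val)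
  moreover have "ip (?K w) (?K w) = \<kappa> w w" by (simp add: K S reproducing val)
  ultimately show ?thesis
    using power_mono[OF cauchy_schwarz[OF K[OF S(3)] d], of 2]
    by (simp add: power_mult_distrib nrm_sq_Re K S d mult.commute)
qed

lemma psd_on_cauchy_schwarz:
  assumes \<kappa>: "psd_on S \<kappa>" and S: "z \<in> S" "w \<in> S"
  shows "(cmod (\<kappa> z w))\<^sup>2 \<le> Re (\<kappa> z z) * Re (\<kappa> w w)"
proof -
  have "kernel_on S \<kappa>" using \<kappa> S by (auto simp: kernel_on_iff_psd_on)
  then obtain H ip where "rkhs S \<kappa> H ip" using rkhs_exists by blast
  then interpret rkhs S \<kappa> H ip .
  have "ip (kernel_fun S \<kappa> y) (kernel_fun S \<kappa> x) = \<kappa> x y" if "x \<in> S" "y \<in> S" for x y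
    using that by (simp add: reproducing kernel_mem) (simp add: kernel_fun_def)
  then show ?thesis
    using power_mono[OF cauchy_schwarz[OF kernel_mem[OF S(2)] kernel_mem[OF S(1)]], of 2]
    by (simp add: power_mult_distrib nrm_sq_Re kernel_mem S mult.commute)
qed

section \<open>Contractive multipliers\<close>

lemma kspan_as_sum:
  assumes "u \<in> kspan X k"
  shows "\<exists>E c. finite E \<and> E \<subseteq> X \<and> u = (\<lambda>z. \<Sum>w\<in>E. c w * kernel_fun X k w z)"
  using assms
proof induction
  case kspan_zero
  then show ?case by (intro exI[of _ "{}"]) simp
next
  case (kspan_step g w c)
  then obtain E d where E: "finite E" "E \<subseteq> X" "g = (\<lambda>z. \<Sum>w\<in>E. d w * kernel_fun X k w z)" by blast
  define d' where "d' v = (if v \<in> E then d v else 0) + (if v = w then c else 0)" for v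
  have "g z + c * kernel_fun X k w z = (\<Sum>v\<in>insert w E. d' v * kernel_fun X k v z)" for z
  proof -
    have "(\<Sum>v\<in>insert w E. d' v * kernel_fun X k v z)
        = (\<Sum>v\<in>insert w E. (if v \<in> E then d v * kernel_fun X k v z else 0))
          + (\<Sum>v\<in>insert w E. (if v = w then c * kernel_fun X k v z else 0))"
      unfolding sum.distrib[symmetric] by (intro sum.cong refl) (simp add: d'_def algebra_simps)
    also have "(\<Sum>v\<in>insert w E. (if v \<in> E then d v * kernel_fun X k v z else 0)) = g z"
      unfolding E(3) using E(1) by (intro sum.mono_neutral_cong_right) auto
    finally show ?thesis using E(1) by simp
  qed
  then show ?case using E(1,2) kspan_step.hyps
    by (intro exI[of _ "insert w E"] exI[of _ d']) auto
qed

context pre_rkhs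
begin

lemma ip_kernel_sum: assumes "f \<in> H" "E \<subseteq> X"
  shows "ip f (\<lambda>z. \<Sum>w\<in>E. c w * kernel_fun X k w z) = (\<Sum>w\<in>E. cnj (c w) * f w)"
proof -
  have K: "kernel_fun X k w \<in> H" if "w \<in> E" for w using that assms kernel_mem by blast
  show ?thesis
    by (subst ip_sum2[OF K assms(1)]) (use assms in \<open>auto simp: reproducing subset_eq intro!: sum.cong\<close>)
qed

lemma nrm_kernel_sum: assumes "E \<subseteq> X"
  shows "of_real ((nrm (\<lambda>z. \<Sum>w\<in>E. c w * kernel_fun X k w z))\<^sup>2) = quad E k c"
proof -
  have K: "kernel_fun X k w \<in> H" if "w \<in> E" for w using that assms kernel_mem by blast
  have "quad E k c = quad E (\<lambda>i j. ip (kernel_fun X k j) (kernel_fun X k i)) c"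
  proof (rule quad_cong)
    fix i j assume "i \<in> E" "j \<in> E"
    then have "ip (kernel_fun X k j) (kernel_fun X k i) = kernel_fun X k j i"
      using assms K by (intro reproducing) auto
    then show "k i j = ip (kernel_fun X k j) (kernel_fun X k i)"
      using \<open>i \<in> E\<close> assms by (auto simp: kernel_fun_def)
  qed
  then show ?thesis using quad_gram[of E "kernel_fun X k" c] K by simp
qed

lemma conv_nrm: assumes "\<And>n. F n \<in> H" "f \<in> H" "(\<lambda>n. nrm (\<lambda>z. F n z - f z)) \<longlonglongrightarrow> 0"
  shows "(\<lambda>n. nrm (F n)) \<longlonglongrightarrow> nrm f"
proof -
  have "(\<lambda>n. nrm (F n) - nrm f) \<longlonglongrightarrow> 0"
  proof (rule tendsto_0_le[OF assms(3), where K = 1], intro always_eventually allI)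
    fix n
    have "nrm (F n) \<le> nrm (\<lambda>z. F n z - f z) + nrm f"
      using nrm_triangle[OF diff[OF assms(1,2)] assms(2), of n] by simp
    moreover have "nrm f \<le> nrm (\<lambda>z. f z - F n z) + nrm (F n)"
      using nrm_triangle[OF diff[OF assms(2,1)] assms(1), of n n] by simp
    ultimately show "norm (nrm (F n) - nrm f) \<le> norm (nrm (\<lambda>z. F n z - f z)) * 1"
      using nrm_minus[OF assms(1,2), of n] by simp
  qed
  then show ?thesis by (simp add: LIM_zero_iff)
qed

end

text \<open>Positivity says that the adjoint, which sends the kernel function of \<open>l\<close> at \<open>w\<close> in the direction \<open>b\<close> to
  the kernel function of \<open>k\<close> at \<open>w\<close> in the direction \<open>\<Phi>(w)\<^sup>* b\<close>, is a contraction on finite combinations.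
  Pairing \<open>\<Phi> f\<close> with such combinations therefore costs at most the norm of \<open>f\<close>; by the membership criterion
  the components of \<open>\<Phi> f\<close> lie in \<open>H\<^sub>l\<close>, and by density the norm bound follows.\<close>

lemma contractive_multiplier_if_psd:
  fixes \<Phi> :: "'a \<Rightarrow> complex mat"
  assumes k: "kernel_on X k" and l: "kernel_on X l"
    and \<Phi>: "\<And>z. z \<in> X \<Longrightarrow> \<Phi> z \<in> carrier_mat N N"
    and psd: "psd_on (X \<times> {..<N}) (\<lambda>(z, a) (w, b). (if a = b then l z w else 0)
        - k z w * (\<Sum>c<N. \<Phi> z $$ (a, c) * cnj (\<Phi> w $$ (b, c))))"
  shows "\<Phi> \<in> Mult X k l N" "mult_norm X k l N \<Phi> \<le> 1"
proof -
  interpret A: rkhs X k "rkhs_space X k" "rkhs_ip X k" by (rule rkhs_space_rkhs[OF k])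
  interpret B: rkhs X l "rkhs_space X l" "rkhs_ip X l" by (rule rkhs_space_rkhs[OF l])
  have nA: "rkhs_norm X k = A.nrm" by (simp add: fun_eq_iff rkhs_norm_def A.nrm_def)
  have nB: "rkhs_norm X l = B.nrm" by (simp add: fun_eq_iff rkhs_norm_def B.nrm_def)
  have bounded: "mult_op X N \<Phi> f \<in> vec_rkhs X l N
      \<and> (\<Sum>a<N. (B.nrm (\<lambda>z. mult_op X N \<Phi> f z $ a))\<^sup>2) \<le> (\<Sum>b<N. (A.nrm (\<lambda>z. f z $ b))\<^sup>2)"
    if f: "f \<in> vec_rkhs X k N" for f
  proof -
    define D where "D = (\<Sum>b<N. (A.nrm (\<lambda>z. f z $ b))\<^sup>2)"
    have D: "D \<ge> 0" by (simp add: D_def sum_nonneg)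
    define g where "g b = (\<lambda>z. f z $ b)" for b
    have g: "g b \<in> rkhs_space X k" if "b < N" for b using f that by (simp add: vec_rkhs_def g_def)
    define G where "G a = (\<lambda>z. mult_op X N \<Phi> f z $ a)" for a
    have G_in: "G a z = (\<Sum>b<N. \<Phi> z $$ (a, b) * g b z)" if "z \<in> X" "a < N" for a z
    proof -
      have "dim_vec (f z) = N" using f by (auto simp: vec_rkhs_def dest: spec[of _ z])
      then show ?thesis using \<Phi>[OF that(1)] that
        by (auto simp: G_def g_def mult_op_def scalar_prod_def lessThan_atLeast0 intro!: sum.cong)
    qed
    have G_out: "G a z = 0" if "z \<notin> X" "a < N" for a z
      using that by (simp add: G_def mult_op_def)
    \<comment> \<open>The pairing estimate; \<open>e b\<close> are the coefficients of the image under the adjoint.\<close>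
    have key: "(cmod (\<Sum>a<N. \<Sum>w\<in>E. cnj (c a w) * G a w))\<^sup>2 \<le> D * Re (\<Sum>a<N. quad E l (c a))"
      if E: "finite E" "E \<subseteq> X" for E and c :: "nat \<Rightarrow> 'a \<Rightarrow> complex"
    proof -
      define e where "e b w = (\<Sum>a<N. cnj (\<Phi> w $$ (a, b)) * c a w)" for b w
      define u where "u b = (\<lambda>z. \<Sum>w\<in>E. e b w * kernel_fun X k w z)" for b
      have u: "u b \<in> rkhs_space X k" for b
        unfolding u_def by (rule A.sum_mem) (use E A.kernel_mem in blast)
      have "(\<Sum>a<N. \<Sum>w\<in>E. cnj (c a w) * G a w)
          = (\<Sum>w\<in>E. \<Sum>a<N. \<Sum>b<N. cnj (c a w) * (\<Phi> w $$ (a, b) * g b w))"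
        using E by (subst sum.swap) (auto simp: G_in sum_distrib_left intro!: sum.cong)
      also have "\<dots> = (\<Sum>w\<in>E. \<Sum>b<N. cnj (e b w) * g b w)"
        by (rule sum.cong[OF refl], subst sum.swap)
          (simp add: e_def sum_distrib_left sum_distrib_right mult_ac)
      also have "\<dots> = (\<Sum>b<N. rkhs_ip X k (g b) (u b))"
        unfolding u_def using E g by (subst sum.swap) (simp add: A.ip_kernel_sum)
      finally have "cmod (\<Sum>a<N. \<Sum>w\<in>E. cnj (c a w) * G a w)
          \<le> (\<Sum>b<N. \<bar>A.nrm (g b)\<bar> * \<bar>A.nrm (u b)\<bar>)"
        using A.cauchy_schwarz[OF g u]
        by (auto intro!: order_trans[OF norm_sum] sum_mono simp: g u)
      also have "\<dots> \<le> L2_set (\<lambda>b. A.nrm (g b)) {..<N} * L2_set (\<lambda>b. A.nrm (u b)) {..<N}"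
        by (rule L2_set_mult_ineq)
      finally have "(cmod (\<Sum>a<N. \<Sum>w\<in>E. cnj (c a w) * G a w))\<^sup>2
          \<le> (L2_set (\<lambda>b. A.nrm (g b)) {..<N} * L2_set (\<lambda>b. A.nrm (u b)) {..<N})\<^sup>2"
        by (intro power_mono) auto
      also have "\<dots> = D * (\<Sum>b<N. (A.nrm (u b))\<^sup>2)"
        by (simp add: power_mult_distrib L2_set_def sum_nonneg D_def g_def)
      also have "\<dots> \<le> D * Re (\<Sum>a<N. quad E l (c a))"
      proof (intro mult_left_mono D)
        let ?\<kappa> = "\<lambda>(z, a) (w, b). (if a = b then l z w else 0)
          - k z w * (\<Sum>m<N. \<Phi> z $$ (a, m) * cnj (\<Phi> w $$ (b, m)))"
        have "quad (E \<times> {..<N}) ?\<kappa> (\<lambda>(w, a). c a w)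
            = (\<Sum>z\<in>E. \<Sum>a<N. \<Sum>w\<in>E. \<Sum>b<N. cnj (c a z) * ?\<kappa> (z, a) (w, b) * c b w)"
          by (simp add: quad_def sum.cartesian_product')
        also have "\<dots> = (\<Sum>z\<in>E. \<Sum>a<N. \<Sum>w\<in>E. cnj (c a z) * l z w * c a w)
            - (\<Sum>z\<in>E. \<Sum>a<N. \<Sum>w\<in>E. \<Sum>b<N. cnj (c a z) * c b w * k z w
                * (\<Sum>m<N. \<Phi> z $$ (a, m) * cnj (\<Phi> w $$ (b, m))))"
          unfolding sum_subtractf[symmetric]
          by (intro sum.cong refl) (simp add: algebra_simps sum_subtractf if_distrib[of "\<lambda>y. _ * y"] cong: if_cong)
        also have "(\<Sum>z\<in>E. \<Sum>a<N. \<Sum>w\<in>E. cnj (c a z) * l z w * c a w) = (\<Sum>a<N. quad E l (c a))"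
          unfolding quad_def by (subst sum.swap) simp
        also have "(\<Sum>z\<in>E. \<Sum>a<N. \<Sum>w\<in>E. \<Sum>b<N. cnj (c a z) * c b w * k z w
                * (\<Sum>m<N. \<Phi> z $$ (a, m) * cnj (\<Phi> w $$ (b, m))))
            = (\<Sum>m<N. quad E k (e m))"
        proof -
          have "(\<Sum>m<N. quad E k (e m)) = (\<Sum>z\<in>E. \<Sum>w\<in>E. \<Sum>m<N. cnj (e m z) * k z w * e m w)"
            unfolding quad_def by (subst sum.swap, subst sum.swap[of _ "{..<N}" E]) simp
          also have "\<dots> = (\<Sum>z\<in>E. \<Sum>w\<in>E. \<Sum>a<N. \<Sum>b<N. cnj (c a z) * c b w * k z w
                * (\<Sum>m<N. \<Phi> z $$ (a, m) * cnj (\<Phi> w $$ (b, m))))"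
          proof (rule sum.cong[OF refl], rule sum.cong[OF refl])
            fix z w
            have "(\<Sum>m<N. cnj (e m z) * k z w * e m w)
                = (\<Sum>m<N. \<Sum>a<N. \<Sum>b<N. cnj (c a z) * c b w * k z w * (\<Phi> z $$ (a, m) * cnj (\<Phi> w $$ (b, m))))"
              unfolding e_def cnj_sum sum_distrib_left sum_distrib_right
              by (rule sum.cong[OF refl], subst sum.swap) (simp add: mult_ac)
            also have "\<dots> = (\<Sum>a<N. \<Sum>b<N. \<Sum>m<N. cnj (c a z) * c b w * k z w * (\<Phi> z $$ (a, m) * cnj (\<Phi> w $$ (b, m))))"
              by (subst sum.swap, rule sum.cong[OF refl], rule sum.swap)
            finally show "(\<Sum>m<N. cnj (e m z) * k z w * e m w)
                = (\<Sum>a<N. \<Sum>b<N. cnj (c a z) * c b w * k z w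
                * (\<Sum>m<N. \<Phi> z $$ (a, m) * cnj (\<Phi> w $$ (b, m))))"
              by (simp add: sum_distrib_left)
          qed
          also have "\<dots> = (\<Sum>z\<in>E. \<Sum>a<N. \<Sum>w\<in>E. \<Sum>b<N. cnj (c a z) * c b w * k z w
                * (\<Sum>m<N. \<Phi> z $$ (a, m) * cnj (\<Phi> w $$ (b, m))))"
            by (rule sum.cong[OF refl], rule sum.swap)
          finally show ?thesis ..
        qed
        also have "(\<Sum>m<N. quad E k (e m)) = of_real (\<Sum>b<N. (A.nrm (u b))\<^sup>2)"
          unfolding of_real_sum u_def A.nrm_kernel_sum[OF E(2)] ..
        finally have "0 \<le> (\<Sum>a<N. quad E l (c a)) - of_real (\<Sum>b<N. (A.nrm (u b))\<^sup>2)"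
          using psd_onD[OF psd, of "E \<times> {..<N}" "\<lambda>(w, a). c a w"] E by (simp add: Sigma_mono)
        then show "(\<Sum>b<N. (A.nrm (u b))\<^sup>2) \<le> Re (\<Sum>a<N. quad E l (c a))"
          by (simp add: less_eq_complex_def)
      qed
      finally show ?thesis .
    qed
    have G_mem: "G a \<in> rkhs_space X l" if a: "a < N" for a
    proof (rule B.mem_if_psd(1))
      show "psd_on X (\<lambda>i j. of_real ((sqrt D)\<^sup>2) * l i j - G a i * cnj (G a j))"
      proof (rule psd_onI)
        fix E and c :: "'a \<Rightarrow> complex" assume E: "finite E" "E \<subseteq> X"
        define c' :: "nat \<Rightarrow> 'a \<Rightarrow> complex" where "c' a' w = (if a' = a then c w else 0)" for a' w
        have "(\<Sum>a<N. \<Sum>w\<in>E. cnj (c' a w) * G a w) = (\<Sum>w\<in>E. cnj (c w) * G a w)"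
        proof -
          have "(\<Sum>w\<in>E. cnj (c' a' w) * G a' w) = (if a' = a then (\<Sum>w\<in>E. cnj (c w) * G a w) else 0)" for a'
            by (simp add: c'_def)
          then show ?thesis using a by simp
        qed
        moreover have "(\<Sum>a<N. quad E l (c' a)) = quad E l c"
        proof -
          have "quad E l (c' a') = (if a' = a then quad E l c else 0)" for a'
            by (simp add: c'_def quad_def)
          then show ?thesis using a by simp
        qed
        ultimately have le: "(cmod (\<Sum>w\<in>E. cnj (c w) * G a w))\<^sup>2 \<le> D * Re (quad E l c)"
          using key[OF E, of c'] by simp
        have im: "Im (quad E l c) = 0"
          using psd_onD[OF _ E, of l c] l by (simp add: kernel_on_iff_psd_on less_eq_complex_def)
        have "quad E (\<lambda>i j. of_real ((sqrt D)\<^sup>2) * l i j - G a i * cnj (G a j)) c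
            = of_real D * quad E l c - quad E (\<lambda>i j. G a i * cnj (G a j)) c"
          using D by (simp add: quad_def right_diff_distrib left_diff_distrib sum_subtractf sum_distrib_left mult_ac)
        also have "\<dots> = of_real D * quad E l c - of_real ((cmod (\<Sum>w\<in>E. cnj (c w) * G a w))\<^sup>2)"
          unfolding quad_rank_one complex_norm_square ..
        finally show "0 \<le> quad E (\<lambda>i j. of_real ((sqrt D)\<^sup>2) * l i j - G a i * cnj (G a j)) c"
          using le im by (simp add: less_eq_complex_def)
      qed
    qed (use G_out a D in auto)
    have "\<exists>u. (\<forall>n. u n \<in> kspan X l) \<and> (\<lambda>n. B.nrm (\<lambda>z. u n z - G a z)) \<longlonglongrightarrow> 0" if "a < N" for a
      using B.kspan_dense[OF G_mem[OF that]] .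
    then obtain u where u: "\<And>a n. a < N \<Longrightarrow> u a n \<in> kspan X l"
        "\<And>a. a < N \<Longrightarrow> (\<lambda>n. B.nrm (\<lambda>z. u a n z - G a z)) \<longlonglongrightarrow> 0"
      by metis
    have uH: "u a n \<in> rkhs_space X l" if "a < N" for a n using u(1)[OF that] B.kspan_subset by blast
    define T where "T = (\<Sum>a<N. (B.nrm (G a))\<^sup>2)"
    have T: "T \<ge> 0" by (simp add: T_def sum_nonneg)
    have step: "(cmod (\<Sum>a<N. rkhs_ip X l (G a) (u a n)))\<^sup>2 \<le> D * (\<Sum>a<N. (B.nrm (u a n))\<^sup>2)" for n
    proof -
      have "\<exists>E c. finite E \<and> E \<subseteq> X \<and> u a n = (\<lambda>z. \<Sum>w\<in>E. c w * kernel_fun X l w z)" if "a < N" for a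
        using kspan_as_sum[OF u(1)[OF that]] .
      then obtain Ea ca where Ea: "\<And>a. a < N \<Longrightarrow> finite (Ea a)" "\<And>a. a < N \<Longrightarrow> Ea a \<subseteq> X"
          "\<And>a. a < N \<Longrightarrow> u a n = (\<lambda>z. \<Sum>w\<in>Ea a. ca a w * kernel_fun X l w z)"
        by metis
      define E where "E = (\<Union>a<N. Ea a)"
      define c where "c a w = (if w \<in> Ea a then ca a w else 0)" for a w
      have E: "finite E" "E \<subseteq> X" using Ea by (auto simp: E_def)
      have ua: "u a n = (\<lambda>z. \<Sum>w\<in>E. c a w * kernel_fun X l w z)" if "a < N" for a
        unfolding Ea(3)[OF that] using that E
        by (intro ext sum.mono_neutral_cong_left) (auto simp: c_def E_def)
      have "(\<Sum>a<N. rkhs_ip X l (G a) (u a n)) = (\<Sum>a<N. \<Sum>w\<in>E. cnj (c a w) * G a w)"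
        by (intro sum.cong refl) (simp add: ua B.ip_kernel_sum E G_mem)
      moreover have "of_real (\<Sum>a<N. (B.nrm (u a n))\<^sup>2) = (\<Sum>a<N. quad E l (c a))"
        unfolding of_real_sum using B.nrm_kernel_sum[OF E(2)]
        by (intro sum.cong refl) (simp add: ua)
      then have "(\<Sum>a<N. (B.nrm (u a n))\<^sup>2) = Re (\<Sum>a<N. quad E l (c a))"
        by (metis Re_complex_of_real)
      ultimately show ?thesis using key[OF E, of c] by simp
    qed
    have "(cmod (of_real T))\<^sup>2 \<le> D * T"
    proof (rule LIMSEQ_le)
      have "(\<lambda>n. rkhs_ip X l (G a) (u a n)) \<longlonglongrightarrow> of_real ((B.nrm (G a))\<^sup>2)" if a: "a < N" for a
      proof -
        have "(\<lambda>n. cnj (rkhs_ip X l (u a n) (G a))) \<longlonglongrightarrow> cnj (rkhs_ip X l (G a) (G a))"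
          by (intro tendsto_intros B.conv_ip uH u G_mem a)
        then show ?thesis
          using B.ip_cnj[OF uH[OF a] G_mem[OF a]] by (simp add: B.nrm_sq[OF G_mem[OF a]])
      qed
      then show "(\<lambda>n. (cmod (\<Sum>a<N. rkhs_ip X l (G a) (u a n)))\<^sup>2) \<longlonglongrightarrow> (cmod (of_real T))\<^sup>2"
        unfolding T_def of_real_sum by (intro tendsto_intros) auto
      show "(\<lambda>n. D * (\<Sum>a<N. (B.nrm (u a n))\<^sup>2)) \<longlonglongrightarrow> D * T"
        unfolding T_def by (intro tendsto_intros B.conv_nrm uH u G_mem) auto
    qed (use step in blast)
    then have "T * T \<le> D * T" using T by (simp add: power2_eq_square)
    then have "T \<le> D" using T D by (cases "T = 0") (auto simp: mult_le_cancel_right)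
    moreover have "mult_op X N \<Phi> f \<in> vec_rkhs X l N"
      using G_mem f \<Phi> by (auto simp: vec_rkhs_def G_def mult_op_def intro!: mult_mat_vec_carrier)
    ultimately show ?thesis by (simp add: T_def D_def G_def)
  qed
  show "\<Phi> \<in> Mult X k l N" using bounded \<Phi> by (auto simp: Mult_def)
  show "mult_norm X k l N \<Phi> \<le> 1"
    unfolding mult_norm_def
  proof (rule SUP_least)
    fix f assume f: "f \<in> {f \<in> vec_rkhs X k N. vec_rkhs_norm X k N f \<le> 1}"
    then have "vec_rkhs_norm X l N (mult_op X N \<Phi> f) \<le> vec_rkhs_norm X k N f"
      using bounded[of f] by (simp add: vec_rkhs_norm_def nA nB)
    then show "ennreal (vec_rkhs_norm X l N (mult_op X N \<Phi> f)) \<le> 1"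
      using f by (simp add: ennreal_le_1)
  qed
qed

text \<open>The scalar converse: for a combination \<open>u\<close> of kernel functions of \<open>l\<close> and its image \<open>v\<close> under the adjoint,
  \<open>\<parallel>v\<parallel>\<^sup>2\<close> equals the inner product of \<open>\<phi> v\<close> and \<open>u\<close>, hence is at most \<open>\<parallel>v\<parallel> \<parallel>u\<parallel>\<close>.\<close>

lemma psd_if_contractive_multiplier:
  fixes \<Phi> :: "'a \<Rightarrow> complex mat"
  assumes k: "kernel_on X k" and l: "kernel_on X l"
    and \<Phi>: "\<Phi> \<in> Mult X k l 1" "mult_norm X k l 1 \<Phi> \<le> 1"
  shows "psd_on X (\<lambda>z w. l z w - k z w * (\<Phi> z $$ (0, 0) * cnj (\<Phi> w $$ (0, 0))))"
proof (rule psd_onI)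
  fix E and c :: "'a \<Rightarrow> complex" assume E: "finite E" "E \<subseteq> X"
  interpret A: rkhs X k "rkhs_space X k" "rkhs_ip X k" by (rule rkhs_space_rkhs[OF k])
  interpret B: rkhs X l "rkhs_space X l" "rkhs_ip X l" by (rule rkhs_space_rkhs[OF l])
  define \<phi> where "\<phi> z = \<Phi> z $$ (0, 0)" for z
  define u where "u = (\<lambda>z. \<Sum>w\<in>E. c w * kernel_fun X l w z)"
  define v where "v = (\<lambda>z. \<Sum>w\<in>E. (cnj (\<phi> w) * c w) * kernel_fun X k w z)"
  have u: "u \<in> rkhs_space X l" unfolding u_def by (rule B.sum_mem) (use E B.kernel_mem in blast)
  have v: "v \<in> rkhs_space X k" unfolding v_def by (rule A.sum_mem) (use E A.kernel_mem in blast)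
  define g where "g = (\<lambda>z. if z \<in> X then \<phi> z * v z else 0)"
  have bound: "g \<in> rkhs_space X l \<and> B.nrm g \<le> A.nrm v"
  proof -
    have scaled: "(\<lambda>z. t * g z) \<in> rkhs_space X l \<and> (A.nrm (\<lambda>z. t * v z) \<le> 1 \<longrightarrow> B.nrm (\<lambda>z. t * g z) \<le> 1)"
      for t :: complex
    proof -
      define f where "f = (\<lambda>z. vec 1 (\<lambda>_. t * v z))"
      have f0: "(\<lambda>z. f z $ 0) = (\<lambda>z. t * v z)" by (simp add: f_def)
      have f: "f \<in> vec_rkhs X k 1"
        using A.scale[OF v, of t] by (auto simp: vec_rkhs_def f_def)
      have op: "(\<lambda>z. mult_op X 1 \<Phi> f z $ 0) = (\<lambda>z. t * g z)"
      proof
        fix z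
        have "\<Phi> z \<in> carrier_mat 1 1" if "z \<in> X" using \<Phi>(1) that by (simp add: Mult_def)
        then show "mult_op X 1 \<Phi> f z $ 0 = t * g z"
          by (auto simp: mult_op_def g_def f_def \<phi>_def scalar_prod_def)
      qed
      have mem: "mult_op X 1 \<Phi> f \<in> vec_rkhs X l 1" using \<Phi>(1) f by (simp add: Mult_def)
      then have "(\<lambda>z. mult_op X 1 \<Phi> f z $ 0) \<in> rkhs_space X l" by (auto simp: vec_rkhs_def)
      then have tg: "(\<lambda>z. t * g z) \<in> rkhs_space X l" by (simp only: op)
      have nf: "vec_rkhs_norm X k 1 f = A.nrm (\<lambda>z. t * v z)"
        using A.scale[OF v, of t] by (simp add: vec_rkhs_norm_def rkhs_norm_def f0 A.nrm_def[symmetric])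
      have ng: "vec_rkhs_norm X l 1 (mult_op X 1 \<Phi> f) = B.nrm (\<lambda>z. t * g z)"
        using tg by (simp add: vec_rkhs_norm_def rkhs_norm_def op[simplified] B.nrm_def[symmetric])
      have "B.nrm (\<lambda>z. t * g z) \<le> 1" if "A.nrm (\<lambda>z. t * v z) \<le> 1"
      proof -
        have "ennreal (vec_rkhs_norm X l 1 (mult_op X 1 \<Phi> f)) \<le> mult_norm X k l 1 \<Phi>"
          unfolding mult_norm_def by (rule SUP_upper) (use f nf that in simp)
        also have "\<dots> \<le> 1" by (rule \<Phi>(2))
        finally show ?thesis unfolding ng by (simp add: ennreal_le_1)
      qed
      then show ?thesis using tg by blast
    qed
    have g: "g \<in> rkhs_space X l" using scaled[of 1] by simp
    show ?thesis
    proof (cases "A.nrm v = 0")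
      case True
      then have "v = (\<lambda>_. 0)" using A.ip_definite[OF v] A.nrm_sq[OF v] by simp
      then have "g = (\<lambda>_. 0)" by (simp add: g_def fun_eq_iff)
      then show ?thesis using True g by simp
    next
      case False
      then have pos: "A.nrm v > 0" using A.nrm_nonneg[OF v] by linarith
      define t :: complex where "t = of_real (1 / A.nrm v)"
      have t: "cmod t = 1 / A.nrm v" using pos by (simp add: t_def norm_divide)
      have "B.nrm (\<lambda>z. t * g z) \<le> 1" using scaled[of t] A.nrm_scale[OF v, of t] t pos by simp
      then show ?thesis using B.nrm_scale[OF g, of t] t pos g by (simp add: field_simps)
    qed
  qed
  have "rkhs_ip X l g u = (\<Sum>w\<in>E. cnj (c w) * g w)"
    unfolding u_def using bound E by (simp add: B.ip_kernel_sum)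
  also have "\<dots> = (\<Sum>w\<in>E. cnj (cnj (\<phi> w) * c w) * v w)"
    using E by (intro sum.cong refl) (auto simp: g_def)
  also have "\<dots> = rkhs_ip X k v v"
    by (subst (2) v_def) (simp add: A.ip_kernel_sum v E)
  finally have "of_real ((A.nrm v)\<^sup>2) = rkhs_ip X l g u" by (simp add: A.nrm_sq[OF v])
  then have "(A.nrm v)\<^sup>2 \<le> B.nrm g * B.nrm u"
    using B.cauchy_schwarz[of g u] bound u by (metis norm_of_real abs_of_nonneg zero_le_power2)
  also have "\<dots> \<le> A.nrm v * B.nrm u" using bound u by (intro mult_right_mono) auto
  finally have "A.nrm v \<le> B.nrm u"
    using A.nrm_nonneg[OF v] B.nrm_nonneg[OF u]
    by (cases "A.nrm v = 0") (auto simp: power2_eq_square mult_le_cancel_left)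
  then have le: "(A.nrm v)\<^sup>2 \<le> (B.nrm u)\<^sup>2" using v by (intro power_mono) auto
  have "quad E (\<lambda>z w. l z w - k z w * (\<phi> z * cnj (\<phi> w))) c
      = quad E l c - quad E k (\<lambda>w. cnj (\<phi> w) * c w)"
    by (simp add: quad_def algebra_simps sum_subtractf)
  also have "\<dots> = of_real ((B.nrm u)\<^sup>2 - (A.nrm v)\<^sup>2)"
    using A.nrm_kernel_sum[OF E(2), of "\<lambda>w. cnj (\<phi> w) * c w"] B.nrm_kernel_sum[OF E(2), of c]
    by (simp add: u_def v_def)
  finally show "0 \<le> quad E (\<lambda>z w. l z w - k z w * (\<Phi> z $$ (0, 0) * cnj (\<Phi> w $$ (0, 0)))) c"
    using le by (simp add: \<phi>_def less_eq_complex_def)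
qed

section \<open>Extending a solution by one point\<close>

lemma psd_on_delta: "psd_on S (\<lambda>i j. if i = j then 1 else 0)"
proof (rule psd_onI)
  fix F and c :: "_ \<Rightarrow> complex" assume "finite F" "F \<subseteq> S"
  then have "quad F (\<lambda>i j. if i = j then 1 else 0) c = (\<Sum>i\<in>F. c i * cnj (c i))"
    by (simp add: quad_def if_distrib[of "\<lambda>y. y * _"] if_distrib[of "\<lambda>y. _ * y"] mult_ac cong: if_cong)
  also have "0 \<le> \<dots>" by (intro sum_nonneg mult_cnj_nonneg)
  finally show "0 \<le> quad F (\<lambda>i j. if i = j then 1 else 0) c" .
qed

lemma psd_on_extend_zero:
  assumes "psd_on T \<kappa>" shows "psd_on S (\<lambda>i j. if i \<in> T \<and> j \<in> T then \<kappa> i j else 0)"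
proof (rule psd_onI)
  fix F and c :: "_ \<Rightarrow> complex" assume F: "finite F" "F \<subseteq> S"
  have "quad F (\<lambda>i j. if i \<in> T \<and> j \<in> T then \<kappa> i j else 0) c = quad (F \<inter> T) \<kappa> c"
  proof -
    have inner: "(\<Sum>j\<in>F. cnj (c i) * (if i \<in> T \<and> j \<in> T then \<kappa> i j else 0) * c j)
        = (if i \<in> T then \<Sum>j\<in>F \<inter> T. cnj (c i) * \<kappa> i j * c j else 0)" for i
      using F(1) by (auto simp: sum.inter_restrict intro!: sum.cong)
    show ?thesis unfolding quad_def inner by (rule sum.inter_restrict[OF F(1), symmetric])
  qed
  then show "0 \<le> quad F (\<lambda>i j. if i \<in> T \<and> j \<in> T then \<kappa> i j else 0) c"
    using psd_onD[OF assms, of "F \<inter> T"] F by simp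
qed

lemma (in rkhs) family_member_if_psd:
  assumes "finite A" "a \<in> A" "\<And>a z. a \<in> A \<Longrightarrow> z \<notin> X \<Longrightarrow> f a z = 0"
    and "psd_on X (\<lambda>i j. k i j - (\<Sum>a\<in>A. f a i * cnj (f a j)))"
  shows "f a \<in> H"
proof -
  have "(\<lambda>z. \<Sum>a'\<in>A. (if a' = a then 1 else 0) * f a' z) \<in> H"
    by (rule family_mem_if_psd(1)) (use assms in auto)
  moreover have "(\<lambda>z. \<Sum>a'\<in>A. (if a' = a then 1 else 0) * f a' z) = f a"
    using assms(1,2) by (simp add: fun_eq_iff if_distrib[of "\<lambda>y. y * _"] cong: if_cong)
  ultimately show ?thesis by simp
qed

text \<open>A block matrix with index sets \<open>S\<close>, \<open>A\<close>, \<open>B\<close> is given except for the block \<open>x\<close> between \<open>A\<close> and \<open>B\<close>, with the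
  identity on \<open>A\<close> and on \<open>B\<close>; its two known
  principal parts \<open>S \<union> A\<close> and \<open>S \<union> B\<close> are positive, which is what the assumptions say after taking
  Schur complements. The columns \<open>F\<close> and \<open>E\<close> are then vectors in the Hilbert space with kernel \<open>Q\<close>, and their
  inner products are a possible choice for \<open>x\<close>. The conclusion is the Schur complement
  of the completed matrix with respect to \<open>B\<close>.\<close>

lemma psd_completion:
  fixes Q :: "'i \<Rightarrow> 'i \<Rightarrow> complex" and A :: "'a set" and B :: "'b set"
  assumes S: "S \<noteq> {}" and fin: "finite A" "finite B"
    and psdF: "psd_on S (\<lambda>i j. Q i j - (\<Sum>a\<in>A. F a i * cnj (F a j)))"
    and psdE: "psd_on S (\<lambda>i j. Q i j - (\<Sum>b\<in>B. E b i * cnj (E b j)))"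
  shows "\<exists>x. psd_on (Inl ` S \<union> Inr ` A) (\<lambda>p q. case p of
      Inl i \<Rightarrow> (case q of Inl j \<Rightarrow> Q i j - (\<Sum>b\<in>B. E b i * cnj (E b j))
                | Inr a \<Rightarrow> F a i - (\<Sum>b\<in>B. E b i * cnj (x a b)))
    | Inr a \<Rightarrow> (case q of Inl j \<Rightarrow> cnj (F a j) - (\<Sum>b\<in>B. x a b * cnj (E b j))
                | Inr a' \<Rightarrow> (if a = a' then 1 else 0) - (\<Sum>b\<in>B. x a b * cnj (x a' b))))"
proof -
  define f where "f a i = (if i \<in> S then F a i else 0)" for a i
  define e where "e b i = (if i \<in> S then E b i else 0)" for b i
  have psdf: "psd_on S (\<lambda>i j. Q i j - (\<Sum>a\<in>A. f a i * cnj (f a j)))"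
    by (rule psd_on_cong[OF psdF]) (simp add: f_def)
  have psde: "psd_on S (\<lambda>i j. Q i j - (\<Sum>b\<in>B. e b i * cnj (e b j)))"
    by (rule psd_on_cong[OF psdE]) (simp add: e_def)
  have "psd_on S (\<lambda>i j. (Q i j - (\<Sum>b\<in>B. e b i * cnj (e b j))) + (\<Sum>b\<in>B. e b i * cnj (e b j)))"
    by (intro psd_on_add psde psd_on_sum psd_on_rank_one)
  then have "kernel_on S Q" using S by (simp add: kernel_on_iff_psd_on)
  then obtain H ip where "rkhs S Q H ip" using rkhs_exists by blast
  then interpret rkhs S Q H ip .
  have f: "f a \<in> H" if "a \<in> A" for a
    by (rule family_member_if_psd[OF fin(1) that _ psdf]) (simp add: f_def)
  have e: "e b \<in> H" if "b \<in> B" for b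
    by (rule family_member_if_psd[OF fin(2) that _ psde]) (simp add: e_def)
  have f_bound: "(nrm (\<lambda>z. \<Sum>a\<in>A. d a * f a z))\<^sup>2 \<le> (\<Sum>a\<in>A. (cmod (d a))\<^sup>2)" for d
    by (rule family_mem_if_psd(2)[OF _ psdf]) (simp add: f_def)
  have e_bound: "(nrm (\<lambda>z. \<Sum>b\<in>B. d b * e b z))\<^sup>2 \<le> (\<Sum>b\<in>B. (cmod (d b))\<^sup>2)" for d
    by (rule family_mem_if_psd(2)[OF _ psde]) (simp add: e_def)
  define x where "x a b = ip (e b) (f a)" for a b
  define v where "v p = (case p of Inl i \<Rightarrow> kernel_fun S Q i | Inr a \<Rightarrow> f a)" for p
  let ?I = "Inl ` S \<union> Inr ` A"
  have v: "v p \<in> H" if "p \<in> ?I" for p using that kernel_mem f by (auto simp: v_def)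
  have proj: "psd_on ?I (\<lambda>p q. ip (v q) (v p) - (\<Sum>b\<in>B. ip (e b) (v p) * cnj (ip (e b) (v q))))"
    by (rule psd_on_gram_minus_projection[OF e e_bound v])
  \<comment> \<open>The vectors \<open>f a\<close> realise the rows of \<open>A\<close> only up to the defect \<open>I - Gram f\<close>, which is positive.\<close>
  have gramA: "psd_on A (\<lambda>a a'. (if a = a' then 1 else 0) - ip (f a') (f a))"
  proof (rule psd_onI)
    fix G and c :: "_ \<Rightarrow> complex" assume G: "finite G" "G \<subseteq> A"
    define d where "d a = (if a \<in> G then c a else 0)" for a
    have fG: "f a \<in> H" if "a \<in> G" for a using f G that by blast
    have "(\<lambda>z. \<Sum>a\<in>A. d a * f a z) = (\<lambda>z. \<Sum>a\<in>G. c a * f a z)"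
      using G fin by (intro ext sum.mono_neutral_cong_right) (auto simp: d_def)
    moreover have "(\<Sum>a\<in>A. (cmod (d a))\<^sup>2) = (\<Sum>a\<in>G. (cmod (c a))\<^sup>2)"
      using G fin by (intro sum.mono_neutral_cong_right) (auto simp: d_def)
    ultimately have le: "(nrm (\<lambda>z. \<Sum>a\<in>G. c a * f a z))\<^sup>2 \<le> (\<Sum>a\<in>G. (cmod (c a))\<^sup>2)"
      using f_bound[of d] by simp
    have "quad G (\<lambda>a a'. (if a = a' then 1 else 0) - ip (f a') (f a)) c
        = (\<Sum>a\<in>G. c a * cnj (c a)) - quad G (\<lambda>a a'. ip (f a') (f a)) c"
      using G by (simp add: quad_def right_diff_distrib left_diff_distrib sum_subtractf
          if_distrib[of "\<lambda>y. y * _"] if_distrib[of "\<lambda>y. _ * y"] mult_ac cong: if_cong)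
    also have "(\<Sum>a\<in>G. c a * cnj (c a)) = of_real (\<Sum>a\<in>G. (cmod (c a))\<^sup>2)"
      unfolding of_real_sum complex_norm_square ..
    also have "quad G (\<lambda>a a'. ip (f a') (f a)) c = of_real ((nrm (\<lambda>z. \<Sum>a\<in>G. c a * f a z))\<^sup>2)"
      by (rule quad_gram[OF fG])
    finally show "0 \<le> quad G (\<lambda>a a'. (if a = a' then 1 else 0) - ip (f a') (f a)) c"
      using le by (simp add: less_eq_complex_def flip: of_real_diff)
  qed
  have ext: "psd_on ?I (\<lambda>p q. if p \<in> Inr ` A \<and> q \<in> Inr ` A
      then (if projr p = projr q then 1 else 0) - ip (f (projr q)) (f (projr p)) else 0)"
    by (intro psd_on_extend_zero psd_on_pullback[OF gramA]) auto
  have "psd_on ?I (\<lambda>p q. case p of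
      Inl i \<Rightarrow> (case q of Inl j \<Rightarrow> Q i j - (\<Sum>b\<in>B. E b i * cnj (E b j))
                | Inr a \<Rightarrow> F a i - (\<Sum>b\<in>B. E b i * cnj (x a b)))
    | Inr a \<Rightarrow> (case q of Inl j \<Rightarrow> cnj (F a j) - (\<Sum>b\<in>B. x a b * cnj (E b j))
                | Inr a' \<Rightarrow> (if a = a' then 1 else 0) - (\<Sum>b\<in>B. x a b * cnj (x a' b))))"
    using psd_on_add[OF proj ext]
  proof (rule psd_on_cong)
    have LL: "ip (kernel_fun S Q j) (kernel_fun S Q i) = Q i j" if "i \<in> S" "j \<in> S" for i j
      by (subst reproducing) (use that kernel_mem in \<open>auto simp: kernel_fun_def\<close>)
    have eL: "ip (e b) (kernel_fun S Q i) = E b i" if "b \<in> B" "i \<in> S" for b i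
      by (subst reproducing) (use that e in \<open>auto simp: e_def\<close>)
    have fL: "ip (f a) (kernel_fun S Q i) = F a i" if "a \<in> A" "i \<in> S" for a i
      by (subst reproducing) (use that f in \<open>auto simp: f_def\<close>)
    have Lf: "ip (kernel_fun S Q i) (f a) = cnj (F a i)" if "a \<in> A" "i \<in> S" for a i
      by (subst ip_kernel) (use that f in \<open>auto simp: f_def\<close>)
    fix p q :: "'i + 'a" assume "p \<in> ?I" "q \<in> ?I"
    then show "(case p of
      Inl i \<Rightarrow> (case q of Inl j \<Rightarrow> Q i j - (\<Sum>b\<in>B. E b i * cnj (E b j))
                | Inr a \<Rightarrow> F a i - (\<Sum>b\<in>B. E b i * cnj (x a b)))
    | Inr a \<Rightarrow> (case q of Inl j \<Rightarrow> cnj (F a j) - (\<Sum>b\<in>B. x a b * cnj (E b j))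
                | Inr a' \<Rightarrow> (if a = a' then 1 else 0) - (\<Sum>b\<in>B. x a b * cnj (x a' b))))
      = ip (v q) (v p) - (\<Sum>b\<in>B. ip (e b) (v p) * cnj (ip (e b) (v q)))
        + (if p \<in> Inr ` A \<and> q \<in> Inr ` A
      then (if projr p = projr q then 1 else 0) - ip (f (projr q)) (f (projr p)) else 0)"
      by (auto simp: v_def x_def LL eL fL Lf intro!: sum.cong)
  qed
  then show ?thesis by blast
qed

section \<open>Complete Pick pairs\<close>

text \<open>The Pick matrix as one function for all data: a node \<open>z\<close> together with its target matrix \<open>M\<close> is an
  index. A set of such pairs is a partial solution of an interpolation problem.\<close>

definition pick_form :: "('a \<Rightarrow> 'a \<Rightarrow> complex) \<Rightarrow> ('a \<Rightarrow> 'a \<Rightarrow> complex) \<Rightarrow> nat \<Rightarrow>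
    ('a \<times> complex mat) \<times> nat \<Rightarrow> ('a \<times> complex mat) \<times> nat \<Rightarrow> complex" where
  "pick_form k l N = (\<lambda>((z, M), a) ((w, M'), b). (if a = b then l z w else 0)
     - k z w * (\<Sum>c<N. M $$ (a, c) * cnj (M' $$ (b, c))))"

text \<open>Between two targets \<open>M\<close>, \<open>M'\<close> of the same node the terms with \<open>l\<close> cancel, and what is left is the negative
  multiple \<open>- k z z (M - M') (M - M')\<^sup>*\<close>.\<close>

lemma pick_form_functional:
  assumes psd: "psd_on (R \<times> {..<N}) (pick_form k l N)"
    and R: "(z, M) \<in> R" "(z, M') \<in> R" and c: "M \<in> carrier_mat N N" "M' \<in> carrier_mat N N"
    and kz: "0 < Re (k z z)" "Im (k z z) = 0"
  shows "M = M'"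
proof (rule eq_matI)
  fix a b assume "a < dim_row M'" "b < dim_col M'"
  then have ab: "a < N" "b < N" using c by auto
  let ?d = "\<lambda>m. M $$ (a, m) - M' $$ (a, m)"
  have "0 \<le> cnj 1 * pick_form k l N ((z, M), a) ((z, M), a) * 1
      + cnj 1 * pick_form k l N ((z, M), a) ((z, M'), a) * (-1)
      + (cnj (-1) * pick_form k l N ((z, M'), a) ((z, M), a) * 1
      + cnj (-1) * pick_form k l N ((z, M'), a) ((z, M'), a) * (-1))"
    by (rule psd_on_two_points[OF psd]) (use R ab in auto)
  also have "\<dots> = - (k z z * (\<Sum>m<N. ?d m * cnj (?d m)))"
    by (simp add: pick_form_def algebra_simps sum.distrib sum_subtractf)
  also have "\<dots> = - (k z z * of_real (\<Sum>m<N. (cmod (?d m))\<^sup>2))"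
    unfolding of_real_sum complex_norm_square ..
  finally have "Re (k z z) * (\<Sum>m<N. (cmod (?d m))\<^sup>2) \<le> 0" by (simp add: less_eq_complex_def)
  then have "(\<Sum>m<N. (cmod (?d m))\<^sup>2) \<le> 0" using kz by (simp add: mult_le_0_iff)
  then have "(\<Sum>m<N. (cmod (?d m))\<^sup>2) = 0" by (meson antisym sum_nonneg zero_le_power2)
  then show "M $$ (a, b) = M' $$ (a, b)" using ab by (simp add: sum_nonneg_eq_0_iff)
qed (use c in auto)

text \<open>The target matrix at the new node \<open>p\<close> is the missing block in a completion problem. Write \<open>k'\<close>, \<open>l'\<close> for the Schur
  complements of \<open>k\<close>, \<open>l\<close> at \<open>p\<close> and \<open>P\<close> for the Pick form. One of the two positivity assumptions of the
  completion is \<open>P \<ge> 0\<close>; the other is \<open>l' I - k' M M\<^sup>* \<ge> 0\<close>, and it holds since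
  \<open>l' I - k' M M\<^sup>* = \<tau> P + (l' - \<tau> l) I + (\<tau> k - k') M M\<^sup>*\<close>.\<close>

lemma pick_form_extend:
  assumes k: "psd_on X k" and l: "psd_on X l" and p: "p \<in> X" "k p p \<noteq> 0" "l p p \<noteq> 0"
    and \<tau>: "psd_on X \<tau>"
    and \<tau>l: "psd_on X (\<lambda>z w. l z w - l z p * l p w / l p p - \<tau> z w * l z w)"
    and \<tau>k: "psd_on X (\<lambda>z w. \<tau> z w * k z w - (k z w - k z p * k p w / k p p))"
    and R: "R \<subseteq> X \<times> carrier_mat N N" "R \<noteq> {}" and N: "N \<ge> 1"
    and psd: "psd_on (R \<times> {..<N}) (pick_form k l N)"
  shows "\<exists>M\<in>carrier_mat N N. psd_on (insert (p, M) R \<times> {..<N}) (pick_form k l N)"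
proof -
  define kr where "kr = complex_of_real (sqrt (Re (k p p)))"
  define lr where "lr = complex_of_real (sqrt (Re (l p p)))"
  have kr: "kr * kr = k p p" "cnj kr = kr" "kr \<noteq> 0"
    using psd_on_diag[OF k p(1)] p(2)
    by (auto simp: kr_def less_eq_complex_def complex_eq_iff simp flip: of_real_mult)
  have lr: "lr * lr = l p p" "cnj lr = lr" "lr \<noteq> 0"
    using psd_on_diag[OF l p(1)] p(3)
    by (auto simp: lr_def less_eq_complex_def complex_eq_iff simp flip: of_real_mult)
  let ?S = "R \<times> {..<N}"
  have S: "?S \<noteq> {}" using R N by (auto simp: lessThan_empty_iff)
  define E where "E b = (\<lambda>((z, M), a). k z p / kr * M $$ (a, b))" for b :: nat
  define F where "F a' = (\<lambda>((z, M :: complex mat), a). if a = a' then l z p / lr else 0)" for a' :: nat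
  define Q where "Q i j = pick_form k l N i j + (\<Sum>b<N. E b i * cnj (E b j))" for i j
  have psdE: "psd_on ?S (\<lambda>i j. Q i j - (\<Sum>b<N. E b i * cnj (E b j)))"
    using psd by (simp add: Q_def)
  have pt: "fst (fst i) \<in> X" if "i \<in> ?S" for i using that R by auto
  define MM where "MM i j = (\<Sum>c<N. snd (fst i) $$ (snd i, c) * cnj (snd (fst j) $$ (snd j, c)))"
    for i j :: "('a \<times> complex mat) \<times> nat"
  have "psd_on ?S (\<lambda>i j. \<tau> (fst (fst i)) (fst (fst j)) * pick_form k l N i j
      + ((l (fst (fst i)) (fst (fst j)) - l (fst (fst i)) p * l p (fst (fst j)) / l p p
            - \<tau> (fst (fst i)) (fst (fst j)) * l (fst (fst i)) (fst (fst j)))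
          * (if snd i = snd j then 1 else 0)
        + (\<tau> (fst (fst i)) (fst (fst j)) * k (fst (fst i)) (fst (fst j))
            - (k (fst (fst i)) (fst (fst j)) - k (fst (fst i)) p * k p (fst (fst j)) / k p p)) * MM i j))"
  proof (intro psd_on_add)
    show "psd_on ?S (\<lambda>i j. \<tau> (fst (fst i)) (fst (fst j)) * pick_form k l N i j)"
      by (rule psd_on_Schur_product[OF psd_on_pullback[OF \<tau> pt] psd])
    show "psd_on ?S (\<lambda>i j. (l (fst (fst i)) (fst (fst j)) - l (fst (fst i)) p * l p (fst (fst j)) / l p p
            - \<tau> (fst (fst i)) (fst (fst j)) * l (fst (fst i)) (fst (fst j)))
          * (if snd i = snd j then 1 else 0))"
      by (rule psd_on_Schur_product[OF psd_on_pullback[OF \<tau>l pt] psd_on_pullback[OF psd_on_delta[of UNIV] UNIV_I]])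
    have mm: "psd_on ?S MM" unfolding MM_def by (rule psd_on_sum[OF psd_on_rank_one])
    show "psd_on ?S (\<lambda>i j. (\<tau> (fst (fst i)) (fst (fst j)) * k (fst (fst i)) (fst (fst j))
            - (k (fst (fst i)) (fst (fst j)) - k (fst (fst i)) p * k p (fst (fst j)) / k p p)) * MM i j)"
      by (rule psd_on_Schur_product[OF psd_on_pullback[OF \<tau>k pt] mm])
  qed
  then have psdF: "psd_on ?S (\<lambda>i j. Q i j - (\<Sum>a<N. F a i * cnj (F a j)))"
  proof (rule psd_on_cong)
    fix i j assume ij: "i \<in> ?S" "j \<in> ?S"
    obtain z M a where i: "i = ((z, M), a)" by (metis surj_pair)
    obtain w M' b where j: "j = ((w, M'), b)" by (metis surj_pair)
    have zw: "z \<in> X" "w \<in> X" "a < N" "b < N" using ij R by (auto simp: i j)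
    have hk: "cnj (k w p) = k p w" and hl: "cnj (l w p) = l p w"
      using psd_on_hermitian[OF k zw(2) p(1)] psd_on_hermitian[OF l zw(2) p(1)] by auto
    have EE: "(\<Sum>b<N. E b i * cnj (E b j)) = k z p * k p w / k p p * MM i j"
      by (simp add: E_def MM_def i j hk kr(2,3) sum_distrib_left mult_ac flip: kr(1))
    have "(\<Sum>a'<N. F a' i * cnj (F a' j))
        = (\<Sum>a'<N. if a' = a then (if a = b then l z p / lr * cnj (l w p / lr) else 0) else 0)"
      by (intro sum.cong refl) (auto simp: F_def i j)
    also have "\<dots> = (if a = b then l z p * l p w / l p p else 0)"
      using zw by (simp add: hl lr(2,3) flip: lr(1))
    finally have FF: "(\<Sum>a<N. F a i * cnj (F a j)) = (if a = b then l z p * l p w / l p p else 0)" .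
    have P: "pick_form k l N i j = (if a = b then l z w else 0) - k z w * MM i j"
      by (simp add: pick_form_def MM_def i j)
    show "Q i j - (\<Sum>a<N. F a i * cnj (F a j)) = \<tau> (fst (fst i)) (fst (fst j)) * pick_form k l N i j
      + ((l (fst (fst i)) (fst (fst j)) - l (fst (fst i)) p * l p (fst (fst j)) / l p p
            - \<tau> (fst (fst i)) (fst (fst j)) * l (fst (fst i)) (fst (fst j)))
          * (if snd i = snd j then 1 else 0)
        + (\<tau> (fst (fst i)) (fst (fst j)) * k (fst (fst i)) (fst (fst j))
            - (k (fst (fst i)) (fst (fst j)) - k (fst (fst i)) p * k p (fst (fst j)) / k p p)) * MM i j)"
      unfolding Q_def FF EE P by (simp add: i j algebra_simps)
  qed
  obtain x where x: "psd_on (Inl ` ?S \<union> Inr ` {..<N}) (\<lambda>p q. case p of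
      Inl i \<Rightarrow> (case q of Inl j \<Rightarrow> Q i j - (\<Sum>b<N. E b i * cnj (E b j))
                | Inr a \<Rightarrow> F a i - (\<Sum>b<N. E b i * cnj (x a b)))
    | Inr a \<Rightarrow> (case q of Inl j \<Rightarrow> cnj (F a j) - (\<Sum>b<N. x a b * cnj (E b j))
                | Inr a' \<Rightarrow> (if a = a' then 1 else 0) - (\<Sum>b<N. x a b * cnj (x a' b))))"
    (is "psd_on _ ?\<kappa>")
    using psd_completion[OF S _ _ psdF psdE] by blast
  \<comment> \<open>The block \<open>x\<close> is \<open>kr M / lr\<close>: the columns \<open>E\<close> carry the factor \<open>kr = k p p / kr\<close> at \<open>p\<close>, and the row of \<open>p\<close> was divided by \<open>lr\<close>.\<close>
  define M where "M = mat N N (\<lambda>(a, b). lr / kr * x a b)"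
  \<comment> \<open>If the pair \<open>(p, M)\<close> already belongs to \<open>R\<close>, it is treated as an old node.\<close>
  define g where "g = (\<lambda>(y, a). if y \<in> R then Inl (y, a) else Inr a :: (('a \<times> complex mat) \<times> nat) + nat)"
  define t where "t = (\<lambda>(y, a :: nat). if y \<in> R then 1 else lr)"
  have "psd_on (insert (p, M) R \<times> {..<N}) (\<lambda>i j. t i * ?\<kappa> (g i) (g j) * cnj (t j))"
    by (intro psd_on_congruence psd_on_pullback[OF x]) (auto simp: g_def)
  then have "psd_on (insert (p, M) R \<times> {..<N}) (pick_form k l N)"
  proof (rule psd_on_cong)
    fix i j assume ij: "i \<in> insert (p, M) R \<times> {..<N}" "j \<in> insert (p, M) R \<times> {..<N}"
    obtain y a where i: "i = (y, a)" "a < N" "y \<in> R \<or> y = (p, M)" using ij by auto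
    obtain y' b where j: "j = (y', b)" "b < N" "y' \<in> R \<or> y' = (p, M)" using ij by auto
    have ll: "l p p / lr = lr" using lr by (simp add: field_simps)
    have kk: "k p p / kr = kr" using kr by (simp add: field_simps)
    consider (RR) "y \<in> R" "y' \<in> R" | (RM) "y \<in> R" "y' \<notin> R" | (MR) "y \<notin> R" "y' \<in> R"
      | (MM) "y \<notin> R" "y' \<notin> R" by blast
    then show "pick_form k l N i j = t i * ?\<kappa> (g i) (g j) * cnj (t j)"
    proof cases
      case RR
      then show ?thesis by (simp add: i j g_def t_def Q_def)
    next
      case RM
      obtain z W where y: "y = (z, W)" by force
      have y': "y' = (p, M)" using j RM by simp
      show ?thesis using RM i(2) j(2) lr kr
        by (simp add: i(1) j(1) g_def t_def y y' pick_form_def E_def F_def M_def sum_distrib_left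
            algebra_simps)
    next
      case MR
      obtain z W where y': "y' = (z, W)" by force
      have z: "z \<in> X" using MR y' R by auto
      have hk: "cnj (k z p) = k p z" and hl: "cnj (l z p) = l p z"
        using psd_on_hermitian[OF k z p(1)] psd_on_hermitian[OF l z p(1)] by auto
      have y: "y = (p, M)" using i MR by simp
      show ?thesis using MR i(2) j(2) lr kr
        by (simp add: i(1) j(1) g_def t_def y y' pick_form_def E_def F_def M_def sum_distrib_left
            hk hl algebra_simps)
    next
      case MM
      have y: "y = (p, M)" "y' = (p, M)" using i j MM by auto
      show ?thesis using MM i(2) j(2) lr(2,3) kr(2,3)
        by (simp add: i(1) j(1) g_def t_def y pick_form_def M_def sum_distrib_left
            algebra_simps flip: lr(1) kr(1))
    qed
  qed
  then show ?thesis by (intro bexI[of _ M]) (simp_all add: M_def)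
qed

text \<open>By Zorn's lemma there is a maximal set of nodes with targets whose Pick form is positive; the one-point
  extension shows that every point of \<open>X\<close> is a node of it. Positivity concerns finitely many nodes at a time, so
  it passes to unions of chains.\<close>

theorem complete_pick_pair_if_dominated:
  fixes k l :: "'a \<Rightarrow> 'a \<Rightarrow> complex"
  assumes k: "kernel_on X k" and l: "kernel_on X l"
    and nz: "\<And>p. p \<in> X \<Longrightarrow> k p p \<noteq> 0" "\<And>p. p \<in> X \<Longrightarrow> l p p \<noteq> 0"
    and dom: "\<And>p. p \<in> X \<Longrightarrow> \<exists>\<tau>. psd_on X \<tau>
      \<and> psd_on X (\<lambda>z w. l z w - l z p * l p w / l p p - \<tau> z w * l z w)
      \<and> psd_on X (\<lambda>z w. \<tau> z w * k z w - (k z w - k z p * k p w / k p p))"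
  shows "complete_pick_pair X k l"
  unfolding complete_pick_pair_def
proof (intro conjI k l allI impI)
  fix n N :: nat and z :: "nat \<Rightarrow> 'a" and W :: "nat \<Rightarrow> complex mat"
  assume n: "1 \<le> n" and N: "1 \<le> N"
    and A: "(\<forall>i<n. z i \<in> X \<and> W i \<in> carrier_mat N N) \<and>
        psd (n * N) (block_mat n N
          (\<lambda>i j. l (z i) (z j) \<cdot>\<^sub>m 1\<^sub>m N - k (z i) (z j) \<cdot>\<^sub>m (W i * mat_adjoint (W j))))"
  then have zW: "\<And>i. i < n \<Longrightarrow> z i \<in> X" "\<And>i. i < n \<Longrightarrow> W i \<in> carrier_mat N N" by auto
  have psdk: "psd_on X k" and psdl: "psd_on X l" using k l by (auto simp: kernel_on_iff_psd_on)
  have kpos: "0 < Re (k p p)" "Im (k p p) = 0" if "p \<in> X" for p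
    using psd_on_diag[OF psdk that] nz(1)[OF that] by (auto simp: less_eq_complex_def complex_eq_iff)
  define R0 where "R0 = (\<lambda>i. (z i, W i)) ` {..<n}"
  have psd0: "psd_on (R0 \<times> {..<N}) (pick_form k l N)"
  proof -
    define \<iota> where "\<iota> = inv_into {..<n} (\<lambda>i. (z i, W i))"
    have \<iota>: "(z (\<iota> y), W (\<iota> y)) = y" if "y \<in> R0" for y
      using f_inv_into_f[of y "\<lambda>i. (z i, W i)" "{..<n}"] that by (simp only: R0_def \<iota>_def)
    have \<iota>_less: "\<iota> y < n" if "y \<in> R0" for y
      using inv_into_into[of y "\<lambda>i. (z i, W i)" "{..<n}"] that by (simp add: R0_def \<iota>_def)
    define B where "B i j = l (z i) (z j) \<cdot>\<^sub>m 1\<^sub>m N - k (z i) (z j) \<cdot>\<^sub>m (W i * mat_adjoint (W j))"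
      for i j
    have B: "B i j $$ (a, b) = (if a = b then l (z i) (z j) else 0)
          - k (z i) (z j) * (\<Sum>c<N. W i $$ (a, c) * cnj (W j $$ (b, c)))"
      if "i < n" "j < n" "a < N" "b < N" for i j a b
    proof -
      have "dim_col (mat_adjoint (W j)) = N" using zW(2)[OF that(2)] by (auto simp: mat_adjoint_def)
      moreover have "dim_row (W i) = N" using zW(2)[OF that(1)] by auto
      ultimately have "B i j $$ (a, b) = (if a = b then l (z i) (z j) else 0)
          - k (z i) (z j) * (W i * mat_adjoint (W j)) $$ (a, b)"
        using that by (simp add: B_def)
      then show ?thesis
        by (simp only: index_mult_mat_adjoint[OF zW(2)[OF that(1)] zW(2)[OF that(2)] that(3,4)])
    qed
    have "psd (n * N) (block_mat n N B)" using A unfolding B_def[abs_def] by blast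
    then have "psd_on ({..<n} \<times> {..<N}) (\<lambda>(i, a) (j, b). B i j $$ (a, b))"
      by (rule psd_on_block_mat)
    then have "psd_on (R0 \<times> {..<N}) (\<lambda>x y. (\<lambda>(i, a) (j, b). B i j $$ (a, b))
        (\<iota> (fst x), snd x) (\<iota> (fst y), snd y))"
      by (rule psd_on_pullback[where f = "\<lambda>x. (\<iota> (fst x), snd x)"]) (use \<iota>_less in auto)
    then show ?thesis
    proof (rule psd_on_cong)
      fix x y assume "x \<in> R0 \<times> {..<N}" "y \<in> R0 \<times> {..<N}"
      then have x: "fst x \<in> R0" "snd x < N" and y: "fst y \<in> R0" "snd y < N" by auto
      have xe: "x = ((z (\<iota> (fst x)), W (\<iota> (fst x))), snd x)"
        and ye: "y = ((z (\<iota> (fst y)), W (\<iota> (fst y))), snd y)"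
        using \<iota>[OF x(1)] \<iota>[OF y(1)] by (metis prod.collapse)+
      show "pick_form k l N x y = (\<lambda>(i, a) (j, b). B i j $$ (a, b))
        (\<iota> (fst x), snd x) (\<iota> (fst y), snd y)"
        by (subst xe, subst ye)
          (simp only: pick_form_def prod.case B[OF \<iota>_less[OF x(1)] \<iota>_less[OF y(1)] x(2) y(2)])
    qed
  qed
  define \<A> where "\<A> = {R. R0 \<subseteq> R \<and> R \<subseteq> X \<times> carrier_mat N N \<and> psd_on (R \<times> {..<N}) (pick_form k l N)}"
  have R0: "R0 \<in> \<A>" using psd0 zW by (auto simp: \<A>_def R0_def)
  have "\<exists>R\<in>\<A>. \<forall>R'\<in>\<A>. R \<subseteq> R' \<longrightarrow> R' = R"
  proof (rule subset_Zorn_nonempty)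
    show "\<A> \<noteq> {}" using R0 by blast
    fix \<C> assume ne: "\<C> \<noteq> {}" and chain: "subset.chain \<A> \<C>"
    have sub: "\<C> \<subseteq> \<A>" using chain by (simp add: subset.chain_def)
    have "psd_on (\<Union>\<C> \<times> {..<N}) (pick_form k l N)"
    proof (rule psd_onI)
      fix F and c :: "_ \<Rightarrow> complex" assume F: "finite F" "F \<subseteq> \<Union>\<C> \<times> {..<N}"
      then have "finite (fst ` F)" "fst ` F \<subseteq> \<Union>\<C>" by auto
      then obtain R where R: "R \<in> \<C>" "fst ` F \<subseteq> R"
        using finite_subset_Union_chain[OF _ _ ne chain] by metis
      then have "F \<subseteq> R \<times> {..<N}" using F by force
      moreover have "psd_on (R \<times> {..<N}) (pick_form k l N)" using R sub by (auto simp: \<A>_def)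
      ultimately show "0 \<le> quad F (pick_form k l N) c" using F psd_onD by blast
    qed
    then show "\<Union>\<C> \<in> \<A>" using ne sub by (auto simp: \<A>_def)
  qed
  then obtain R where R: "R \<in> \<A>" and max: "\<And>R'. R' \<in> \<A> \<Longrightarrow> R \<subseteq> R' \<Longrightarrow> R' = R" by blast
  have RX: "R0 \<subseteq> R" "R \<subseteq> X \<times> carrier_mat N N" and psdR: "psd_on (R \<times> {..<N}) (pick_form k l N)"
    using R by (auto simp: \<A>_def)
  have Rne: "R \<noteq> {}" using RX n by (auto simp: R0_def lessThan_empty_iff)
  have total: "\<exists>M. (p, M) \<in> R" if p: "p \<in> X" for p
  proof -
    obtain \<tau> where "psd_on X \<tau>"
        "psd_on X (\<lambda>z w. l z w - l z p * l p w / l p p - \<tau> z w * l z w)"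
        "psd_on X (\<lambda>z w. \<tau> z w * k z w - (k z w - k z p * k p w / k p p))"
      using dom[OF p] by blast
    then obtain M where M: "M \<in> carrier_mat N N" "psd_on (insert (p, M) R \<times> {..<N}) (pick_form k l N)"
      using pick_form_extend[OF psdk psdl p nz[OF p] _ _ _ RX(2) Rne N psdR] by blast
    then have "insert (p, M) R \<in> \<A>" using RX p by (auto simp: \<A>_def)
    then have "insert (p, M) R = R" by (rule max) blast
    then show ?thesis by blast
  qed
  have functional: "M = M'" if "(p, M) \<in> R" "(p, M') \<in> R" for p M M'
    by (rule pick_form_functional[OF psdR that]) (use that RX kpos in auto)
  define \<Phi> where "\<Phi> p = (THE M. (p, M) \<in> R)" for p
  have \<Phi>_eq: "\<Phi> p = M" if "(p, M) \<in> R" for p M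
    unfolding \<Phi>_def using that functional by (intro the_equality) auto
  have \<Phi>: "(p, \<Phi> p) \<in> R" if "p \<in> X" for p using total[OF that] \<Phi>_eq by auto
  then have \<Phi>c: "\<Phi> p \<in> carrier_mat N N" if "p \<in> X" for p using RX that by auto
  have "psd_on (X \<times> {..<N}) (\<lambda>x y. pick_form k l N ((\<lambda>(p, a). ((p, \<Phi> p), a)) x) ((\<lambda>(p, a). ((p, \<Phi> p), a)) y))"
    by (rule psd_on_pullback[OF psdR]) (use \<Phi> in auto)
  then have "psd_on (X \<times> {..<N}) (\<lambda>(z, a) (w, b). (if a = b then l z w else 0)
        - k z w * (\<Sum>c<N. \<Phi> z $$ (a, c) * cnj (\<Phi> w $$ (b, c))))"
    by (rule psd_on_cong) (auto simp: pick_form_def)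
  then have "\<Phi> \<in> Mult X k l N" "mult_norm X k l N \<Phi> \<le> 1"
    using contractive_multiplier_if_psd[OF k l \<Phi>c] by auto
  moreover have "\<Phi> (z i) = W i" if "i < n" for i
    using RX(1) that by (intro \<Phi>_eq) (auto simp: R0_def)
  ultimately show "\<exists>\<Phi>\<in>Mult X k l N. mult_norm X k l N \<Phi> \<le> 1 \<and> (\<forall>i<n. \<Phi> (z i) = W i)" by blast
qed

section \<open>Kernels of Szego type\<close>

text \<open>For these kernels the Schur complement at \<open>p\<close> is \<open>s\<close> times the rank-one kernel of a disc automorphism moving
  \<open>x p\<close> to zero, and this factor serves as \<open>\<tau>\<close>, with equality in both comparisons.\<close>

lemma complete_pick_kernel_szego:
  assumes X: "X \<noteq> {}" and x: "\<And>z. z \<in> X \<Longrightarrow> cmod (x z) < 1" and \<rho>: "\<And>z. z \<in> X \<Longrightarrow> \<rho> z \<noteq> 0"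
  defines "s \<equiv> \<lambda>z w. \<rho> z * cnj (\<rho> w) / (1 - x z * cnj (x w))"
  shows "complete_pick_kernel X s"
  unfolding complete_pick_kernel_def
proof (rule complete_pick_pair_if_dominated)
  have nz: "1 - x z * cnj (x w) \<noteq> 0" if "z \<in> X" "w \<in> X" for z w
  proof -
    have "cmod (x z * cnj (x w)) < 1 * 1"
      unfolding norm_mult complex_mod_cnj by (intro mult_strict_mono' x that) auto
    then show ?thesis by auto
  qed
  have "psd_on X s"
    using psd_on_congruence[OF psd_on_szego[of X x, OF x], where f = \<rho>] by (simp add: s_def)
  then show s: "kernel_on X s" using X by (simp add: kernel_on_iff_psd_on)
  then show "kernel_on X s" .
  fix p assume p: "p \<in> X"
  show "s p p \<noteq> 0" using \<rho> nz p by (simp add: s_def)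
  then show "s p p \<noteq> 0" .
  define y where "y z = (x z - x p) / (1 - cnj (x p) * x z)" for z
  have id: "s z w - s z p * s p w / s p p = (y z * cnj (y w)) * s z w" if z: "z \<in> X" and w: "w \<in> X" for z w
  proof -
    have n: "1 - x z * cnj (x w) \<noteq> 0" "1 - x z * cnj (x p) \<noteq> 0" "1 - x p * cnj (x w) \<noteq> 0"
      "1 - x p * cnj (x p) \<noteq> 0" "1 - cnj (x p) * x z \<noteq> 0"
      using nz z w p by (auto simp: mult.commute)
    have e: "1 - y z * cnj (y w)
        = (1 - x p * cnj (x p)) * (1 - x z * cnj (x w)) / ((1 - x z * cnj (x p)) * (1 - x p * cnj (x w)))"
    proof -
      let ?D = "(1 - x z * cnj (x p)) * (1 - x p * cnj (x w))"
      have "y z * cnj (y w) = (x z - x p) * cnj (x w - x p) / ?D"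
        unfolding y_def complex_cnj_divide times_divide_times_eq by (simp add: mult.commute)
      moreover have "?D - (x z - x p) * cnj (x w - x p)
          = (1 - x p * cnj (x p)) * (1 - x z * cnj (x w))"
        by (simp add: algebra_simps)
      moreover have "?D / ?D = 1" using n by simp
      ultimately show ?thesis by (metis diff_divide_distrib)
    qed
    have "s z p * s p w / s p p
        = \<rho> z * cnj (\<rho> w) * (1 - x p * cnj (x p)) / ((1 - x z * cnj (x p)) * (1 - x p * cnj (x w)))"
      using n \<rho>[OF p] by (simp add: s_def)
    also have "\<dots> = (1 - y z * cnj (y w)) * s z w"
      unfolding e using n by (simp add: s_def)
    finally show ?thesis by (simp add: algebra_simps)
  qed
  show "\<exists>\<tau>. psd_on X \<tau> \<and> psd_on X (\<lambda>z w. s z w - s z p * s p w / s p p - \<tau> z w * s z w)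
      \<and> psd_on X (\<lambda>z w. \<tau> z w * s z w - (s z w - s z p * s p w / s p p))"
    by (intro exI[of _ "\<lambda>z w. y z * cnj (y w)"] conjI psd_on_rank_one
        psd_on_cong[OF psd_on_zero]) (simp_all add: id)
qed

section \<open>Moebius maps on the disc of radius one third\<close>

definition moebius_denom :: "complex \<Rightarrow> complex \<Rightarrow> complex" where
  "moebius_denom a z = 1 - cnj a * z"

definition moebius :: "complex \<Rightarrow> complex \<Rightarrow> complex" where
  "moebius a z = (z - a) / moebius_denom a z"

definition third_szego :: "complex \<Rightarrow> complex \<Rightarrow> complex" where
  "third_szego z w = 1 / (1 - 9 * z * cnj w)"

lemma third_disc_norm: "z \<in> third_disc \<Longrightarrow> cmod z < 1/3"
  by (simp add: third_disc_def)

lemma third_disc_prod: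
  assumes "z \<in> third_disc" "w \<in> third_disc" shows "cmod (z * cnj w) < 1/9"
proof -
  have "cmod z * cmod w < 1/3 * (1/3)"
    by (intro mult_strict_mono' third_disc_norm assms) auto
  then show ?thesis by (simp add: norm_mult)
qed

lemma moebius_denom_bounds:
  assumes "a \<in> third_disc" "z \<in> third_disc"
  shows "8/9 \<le> cmod (moebius_denom a z)" "cmod (moebius_denom a z) \<le> 10/9" "moebius_denom a z \<noteq> 0"
proof -
  have p: "cmod (cnj a * z) < 1/9" using third_disc_prod[OF assms(2,1)] by (simp add: mult.commute)
  show le: "8/9 \<le> cmod (moebius_denom a z)"
    using norm_triangle_ineq2[of 1 "cnj a * z"] p by (simp add: moebius_denom_def)
  show "cmod (moebius_denom a z) \<le> 10/9"
    using norm_triangle_ineq4[of 1 "cnj a * z"] p by (simp add: moebius_denom_def)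
  show "moebius_denom a z \<noteq> 0" using le by auto
qed

lemma one_minus_ne_zero:
  assumes "z \<in> third_disc" "w \<in> third_disc"
  shows "1 - z * cnj w \<noteq> 0" "1 - 9 * z * cnj w \<noteq> 0"
proof -
  show "1 - z * cnj w \<noteq> 0" using third_disc_prod[OF assms] by auto
  have "cmod (9 * z * cnj w) < 1" using third_disc_prod[OF assms] by (simp add: norm_mult)
  then show "1 - 9 * z * cnj w \<noteq> 0" by auto
qed

lemma one_minus_moebius:
  assumes "a \<in> third_disc" "z \<in> third_disc" "w \<in> third_disc"
  shows "1 - moebius a z * cnj (moebius a w)
    = (1 - a * cnj a) * (1 - z * cnj w) / (moebius_denom a z * cnj (moebius_denom a w))"
proof -
  have n: "moebius_denom a z \<noteq> 0" "cnj (moebius_denom a w) \<noteq> 0" using moebius_denom_bounds assms by auto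
  have "moebius_denom a z * cnj (moebius_denom a w) - (z - a) * cnj (w - a) = (1 - a * cnj a) * (1 - z * cnj w)"
    by (simp add: moebius_denom_def algebra_simps)
  moreover have "1 - moebius a z * cnj (moebius a w)
      = (moebius_denom a z * cnj (moebius_denom a w) - (z - a) * cnj (w - a)) / (moebius_denom a z * cnj (moebius_denom a w))"
  proof -
    have "moebius a z * cnj (moebius a w) = (z - a) * cnj (w - a) / (moebius_denom a z * cnj (moebius_denom a w))"
      by (simp only: moebius_def complex_cnj_divide times_divide_times_eq)
    then show ?thesis using n by (simp only: diff_divide_distrib divide_self_if) simp
  qed
  ultimately show ?thesis by simp
qed

text \<open>The constant in the first bound matters: being below one half, it makes \<open>1 - 2 \<phi> \<phi>\<^sup>*\<close> invertible.\<close>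

lemma moebius_bound:
  assumes "a \<in> third_disc" "z \<in> third_disc"
  shows "(cmod (moebius a z))\<^sup>2 \<le> 3/8" and "cmod (moebius a z) \<le> 9/8 * cmod (z - a)"
proof -
  have d: "8/9 \<le> cmod (moebius_denom a z)" "cmod (moebius_denom a z) \<le> 10/9" using moebius_denom_bounds[OF assms] by auto
  have "cmod (moebius a z) = cmod (z - a) / cmod (moebius_denom a z)" by (simp add: moebius_def norm_divide)
  also have "\<dots> \<le> cmod (z - a) / (8/9)" by (intro divide_left_mono mult_pos_pos) (use d in auto)
  finally show "cmod (moebius a z) \<le> 9/8 * cmod (z - a)" by simp
  have q: "8/9 \<le> 1 - (cmod z)\<^sup>2" if "z \<in> third_disc" for z
    using third_disc_prod[OF that that] by (simp add: norm_mult power2_eq_square)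
  have "of_real (1 - (cmod (moebius a z))\<^sup>2)
      = (of_real ((1 - (cmod a)\<^sup>2) * (1 - (cmod z)\<^sup>2) / (cmod (moebius_denom a z))\<^sup>2) :: complex)"
    using one_minus_moebius[OF assms assms(2)]
    by (simp only: of_real_diff of_real_mult of_real_divide of_real_1 complex_norm_square)
  then have eq: "1 - (cmod (moebius a z))\<^sup>2 = (1 - (cmod a)\<^sup>2) * (1 - (cmod z)\<^sup>2) / (cmod (moebius_denom a z))\<^sup>2"
    by (simp only: of_real_eq_iff)
  have "(8/9) * (8/9) \<le> (1 - (cmod a)\<^sup>2) * (1 - (cmod z)\<^sup>2)"
    using q[OF assms(1)] q[OF assms(2)] by (intro mult_mono) auto
  moreover have "(cmod (moebius_denom a z))\<^sup>2 \<le> (10/9)\<^sup>2" using d by (intro power_mono) auto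
  moreover have "0 < (cmod (moebius_denom a z))\<^sup>2" using moebius_denom_bounds(3)[OF assms] by simp
  ultimately have "((8/9) * (8/9)) / (10/9)\<^sup>2 \<le> 1 - (cmod (moebius a z))\<^sup>2"
    unfolding eq by (intro frac_le) auto
  then show "(cmod (moebius a z))\<^sup>2 \<le> 3/8" by (simp add: power2_eq_square)
qed

lemma moebius_self [simp]: "moebius a a = 0"
  by (simp add: moebius_def)

lemma psd_on_third_szego: "psd_on third_disc third_szego"
proof -
  have "psd_on third_disc (\<lambda>z w. 1 / (1 - (3 * z) * cnj (3 * w)))"
  proof (rule psd_on_szego)
    show "cmod (3 * z) < 1" if "z \<in> third_disc" for z
      using third_disc_norm[OF that] by (simp add: norm_mult)
  qed
  then show ?thesis by (rule psd_on_cong) (simp add: third_szego_def)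
qed

lemma psd_on_bergman: "psd_on third_disc bergman_kernel"
proof -
  have "psd_on third_disc (\<lambda>z w. (1 / (1 - z * cnj w)) ^ 2)"
    by (intro psd_on_power psd_on_szego) (use third_disc_norm in fastforce)
  then show ?thesis by (rule psd_on_cong) (simp add: bergman_kernel_def power_one_over)
qed

lemma third_disc_ne: "third_disc \<noteq> {}"
  by (auto simp: third_disc_def intro!: exI[of _ 0])

text \<open>The Bergman kernel is invariant under disc automorphisms up to a rank-one factor.\<close>

lemma bergman_moebius:
  assumes "a \<in> third_disc" "z \<in> third_disc" "w \<in> third_disc"
  shows "bergman_kernel z w * (1 - moebius a z * cnj (moebius a w))\<^sup>2
    = ((1 - a * cnj a) / (moebius_denom a z)\<^sup>2) * cnj ((1 - a * cnj a) / (moebius_denom a w)\<^sup>2)"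
  unfolding one_minus_moebius[OF assms] using one_minus_ne_zero(1)[OF assms(2,3)]
  by (simp add: bergman_kernel_def power2_eq_square divide_simps)

text \<open>Up to the rank-one factor coming from the denominators, the kernel is \<open>(2 (1 - |a|\<^sup>2) (1 - t) - D) / (1 - 9 t)\<close>
  with \<open>t = z w\<^sup>*\<close> and \<open>D = (1 - a\<^sup>* z) (1 - a\<^sup>* w)\<^sup>*\<close>. Since the node \<open>a\<close> is close to zero, \<open>D\<close> is close to one while
  \<open>2 (1 - |a|\<^sup>2) (1 - t)\<close> is close to \<open>16/9\<close> modulo \<open>1 - 9 t\<close>, which leaves a positive remainder.\<close>

lemma psd_on_third_szego_certificate:
  assumes a: "a \<in> third_disc"
  shows "psd_on third_disc (\<lambda>z w. (1 - 2 * (moebius a z * cnj (moebius a w))) * third_szego z w)"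
proof -
  define r where "r = (cmod a)\<^sup>2"
  have r: "0 \<le> r" "r < 1/9"
    using third_disc_prod[OF a a] by (auto simp: r_def norm_mult power2_eq_square)
  have ra: "a * cnj a = of_real r" by (simp only: r_def complex_norm_square)
  have "psd_on third_disc (\<lambda>z w. of_real (2 * (1 - r) / 9 + 5 * r / 9)
      + (of_real (16 * (1 - r) / 9 - 5/4 - 5 * r / 9) * third_szego z w
         + (1/2 + 2 * (cnj a * z)) * third_szego z w * cnj (1/2 + 2 * (cnj a * w))))" (is "psd_on _ ?inner")
  proof (intro psd_on_add)
    show "psd_on third_disc (\<lambda>z w. of_real (2 * (1 - r) / 9 + 5 * r / 9))"
      by (rule psd_on_const) (use r in \<open>simp add: less_eq_complex_def\<close>)
    have "16 * (1 - r) / 9 - 5/4 - 5 * r / 9 = 19/36 - 7/3 * r" by (simp add: field_simps)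
    then have "0 \<le> 16 * (1 - r) / 9 - 5/4 - 5 * r / 9" using r by linarith
    then have "0 \<le> complex_of_real (16 * (1 - r) / 9 - 5/4 - 5 * r / 9)"
      by (simp only: less_eq_complex_def) simp
    then show "psd_on third_disc (\<lambda>z w. of_real (16 * (1 - r) / 9 - 5/4 - 5 * r / 9) * third_szego z w)"
      by (rule psd_on_scale[OF psd_on_third_szego])
    show "psd_on third_disc (\<lambda>z w. (1/2 + 2 * (cnj a * z)) * third_szego z w * cnj (1/2 + 2 * (cnj a * w)))"
      by (rule psd_on_congruence[OF psd_on_third_szego])
  qed
  then have "psd_on third_disc (\<lambda>z w. (1 / moebius_denom a z) * ?inner z w * cnj (1 / moebius_denom a w))"
    by (rule psd_on_congruence)
  then show ?thesis
  proof (rule psd_on_cong)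
    fix z w assume zw: "z \<in> third_disc" "w \<in> third_disc"
    define t where "t = z * cnj w"
    define D where "D = moebius_denom a z * cnj (moebius_denom a w)"
    define L where "L = third_szego z w"
    have D: "D \<noteq> 0" using moebius_denom_bounds(3)[OF a] zw by (simp add: D_def)
    have "(1 - 9 * t) * L = 1" using one_minus_ne_zero(2)[OF zw] by (simp add: L_def third_szego_def t_def)
    then have tL: "t * L = (L - 1) / 9" by (simp add: algebra_simps)
    \<comment> \<open>The identity \<open>(1 - u) (1 - v)\<^sup>* + (1/2 + 2 u) (1/2 + 2 v)\<^sup>* = 5/4 + 5 u v\<^sup>*\<close> bounds \<open>D\<close> by \<open>5/4 + 5 |a|\<^sup>2 t\<close>, and \<open>5/4 + 5 |a|\<^sup>2 / 9 < 16 (1 - |a|\<^sup>2) / 9\<close>.\<close>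
    have D_eq: "(1/2 + 2 * (cnj a * z)) * cnj (1/2 + 2 * (cnj a * w)) = 5/4 + 5 * of_real r * t - D"
      unfolding ra[symmetric] by (simp add: D_def t_def moebius_denom_def algebra_simps)
    have "?inner z w = of_real (2 * (1 - r) / 9 + 5 * r / 9)
      + (of_real (16 * (1 - r) / 9 - 5/4 - 5 * r / 9) * L
         + ((1/2 + 2 * (cnj a * z)) * cnj (1/2 + 2 * (cnj a * w))) * L)"
      by (simp add: L_def)
    also have "\<dots> = of_real (2 * (1 - r) / 9 + 5 * r / 9)
      + (of_real (16 * (1 - r) / 9 - 5/4 - 5 * r / 9) * L
         + (5/4 * L + 5 * of_real r * (t * L) - D * L))"
      unfolding D_eq by (simp add: algebra_simps)
    also have "\<dots> = 2 * of_real (1 - r) * (L - (L - 1) / 9) - D * L"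
      unfolding tL by (simp add: field_simps)
    also have "\<dots> = 2 * of_real (1 - r) * (L - t * L) - D * L" by (simp only: tL)
    also have "\<dots> = (2 * (of_real (1 - r) * (1 - t)) - D) * L" by (simp add: algebra_simps)
    finally have inner: "?inner z w = (2 * (of_real (1 - r) * (1 - t)) - D) * L" .
    have m: "1 - moebius a z * cnj (moebius a w) = of_real (1 - r) * (1 - t) / D"
      unfolding one_minus_moebius[OF a zw] by (simp add: ra t_def D_def)
    have "1 - 2 * (moebius a z * cnj (moebius a w)) = 2 * (1 - moebius a z * cnj (moebius a w)) - 1"
      by simp
    also have "\<dots> = (2 * (of_real (1 - r) * (1 - t)) - D) / D"
      unfolding m using D by (simp add: field_simps)
    finally show "(1 - 2 * (moebius a z * cnj (moebius a w))) * third_szego z w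
        = (1 / moebius_denom a z) * ?inner z w * cnj (1 / moebius_denom a w)"
      unfolding inner by (simp add: D_def L_def)
  qed
qed

text \<open>With \<open>m\<close> the rank-one kernel of the disc automorphism at \<open>p\<close>, the Schur complement of the Bergman kernel at \<open>p\<close> is \<open>(2 m - m\<^sup>2)\<close>
  times the kernel, which suggests \<open>\<tau> = 2 m\<close>. The other comparison is the Schur complement at \<open>p\<close> of the kernel
  \<open>(1 - 2 m) l\<close>.\<close>

lemma complete_pick_pair_bergman: "complete_pick_pair third_disc bergman_kernel third_szego"
proof (rule complete_pick_pair_if_dominated)
  show "kernel_on third_disc bergman_kernel" "kernel_on third_disc third_szego"
    using psd_on_bergman psd_on_third_szego third_disc_ne by (auto simp: kernel_on_iff_psd_on)
  fix p assume p: "p \<in> third_disc"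
  show "bergman_kernel p p \<noteq> 0" "third_szego p p \<noteq> 0"
    using one_minus_ne_zero[OF p p] by (auto simp: bergman_kernel_def third_szego_def)
  let ?m = "\<lambda>z w. moebius p z * cnj (moebius p w)"
  have m: "psd_on third_disc ?m" by (rule psd_on_rank_one)
  have "psd_on third_disc (\<lambda>z w. 2 * ?m z w)"
    by (rule psd_on_scale[OF m]) (simp add: less_eq_complex_def)
  moreover have "psd_on third_disc (\<lambda>z w. third_szego z w - third_szego z p * third_szego p w / third_szego p p - 2 * ?m z w * third_szego z w)"
    by (rule psd_on_cong[OF psd_on_schur_complement[OF psd_on_third_szego_certificate[OF p] p]])
      (simp add: algebra_simps)
  moreover have "psd_on third_disc (\<lambda>z w. 2 * ?m z w * bergman_kernel z w
      - (bergman_kernel z w - bergman_kernel z p * bergman_kernel p w / bergman_kernel p p))"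
  proof (rule psd_on_cong[OF psd_on_Schur_product[OF psd_on_power[OF m, of 2] psd_on_bergman]])
    fix z w assume zw: "z \<in> third_disc" "w \<in> third_disc"
    have "bergman_kernel z p * bergman_kernel p w / bergman_kernel p p
        = bergman_kernel z w * (1 - ?m z w)\<^sup>2"
      unfolding bergman_moebius[OF p zw]
      by (simp add: bergman_kernel_def moebius_denom_def power2_eq_square mult_ac)
    then show "2 * ?m z w * bergman_kernel z w
      - (bergman_kernel z w - bergman_kernel z p * bergman_kernel p w / bergman_kernel p p)
      = (?m z w)\<^sup>2 * bergman_kernel z w"
      by (simp add: power2_eq_square algebra_simps)
  qed
  ultimately show "\<exists>\<tau>. psd_on third_disc \<tau>
      \<and> psd_on third_disc (\<lambda>z w. third_szego z w - third_szego z p * third_szego p w / third_szego p p - \<tau> z w * third_szego z w)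
      \<and> psd_on third_disc (\<lambda>z w. \<tau> z w * bergman_kernel z w
      - (bergman_kernel z w - bergman_kernel z p * bergman_kernel p w / bergman_kernel p p))"
    by blast
qed

section \<open>A family of certificates\<close>

text \<open>The certificate based at \<open>a\<close> is \<open>1 / (1 - 2 z w\<^sup>*)\<close> for \<open>a = 0\<close>. The others arise from it by a disc automorphism, with the
  rank-one factor by which the automorphism changes the Bergman kernel.\<close>

definition cert :: "complex \<Rightarrow> complex \<Rightarrow> complex \<Rightarrow> complex" where
  "cert a z w = ((1 - a * cnj a) / (moebius_denom a z)\<^sup>2) * cnj ((1 - a * cnj a) / (moebius_denom a w)\<^sup>2)
     / (1 - 2 * (moebius a z * cnj (moebius a w)))"

lemma moebius_prod_bound:
  assumes "a \<in> third_disc" "z \<in> third_disc" "w \<in> third_disc"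
  shows "cmod (moebius a z * cnj (moebius a w)) \<le> 3/8"
proof -
  have "0 \<le> (cmod (moebius a z) - cmod (moebius a w))\<^sup>2" by simp
  then show ?thesis using moebius_bound(1)[OF assms(1,2)] moebius_bound(1)[OF assms(1,3)]
    by (simp add: norm_mult power2_diff)
qed

lemma one_minus_moebius_ne_zero:
  assumes "a \<in> third_disc" "z \<in> third_disc" "w \<in> third_disc"
  shows "1 - moebius a z * cnj (moebius a w) \<noteq> 0" "1 - 2 * (moebius a z * cnj (moebius a w)) \<noteq> 0"
    "1/4 \<le> cmod (1 - 2 * (moebius a z * cnj (moebius a w)))"
proof -
  let ?m = "moebius a z * cnj (moebius a w)"
  have b: "cmod ?m \<le> 3/8" by (rule moebius_prod_bound[OF assms])
  show "1 - ?m \<noteq> 0" using b by auto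
  show le: "1/4 \<le> cmod (1 - 2 * ?m)"
    using b norm_triangle_ineq2[of 1 "2 * ?m"] by (simp only: norm_mult) simp
  show "1 - 2 * ?m \<noteq> 0" using le by auto
qed

lemma psd_on_inverse_moebius:
  assumes a: "a \<in> third_disc"
  shows "psd_on third_disc (\<lambda>z w. 1 / (1 - 2 * (moebius a z * cnj (moebius a w))))"
    and "psd_on third_disc (\<lambda>z w. 1 / (1 - moebius a z * cnj (moebius a w)))"
proof -
  have lt: "cmod (moebius a z) < 1" "cmod (of_real (sqrt 2) * moebius a z) < 1" if "z \<in> third_disc" for z
  proof -
    have b: "(cmod (moebius a z))\<^sup>2 \<le> 3/8" by (rule moebius_bound(1)[OF a that])
    show "cmod (moebius a z) < 1" by (rule power2_less_imp_less) (use b in auto)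
    show "cmod (of_real (sqrt 2) * moebius a z) < 1"
      by (rule power2_less_imp_less) (use b in \<open>auto simp: norm_mult power_mult_distrib\<close>)
  qed
  have "psd_on third_disc (\<lambda>z w. 1 / (1 - (of_real (sqrt 2) * moebius a z) * cnj (of_real (sqrt 2) * moebius a w)))"
    by (rule psd_on_szego) (rule lt)
  then show "psd_on third_disc (\<lambda>z w. 1 / (1 - 2 * (moebius a z * cnj (moebius a w))))"
    by (rule psd_on_cong) (simp add: mult_ac flip: of_real_mult)
  show "psd_on third_disc (\<lambda>z w. 1 / (1 - moebius a z * cnj (moebius a w)))"
    by (rule psd_on_szego) (rule lt)
qed

lemma cert_prefactor_ne_zero:
  assumes "a \<in> third_disc" "z \<in> third_disc" shows "(1 - a * cnj a) / (moebius_denom a z)\<^sup>2 \<noteq> 0"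
  using one_minus_ne_zero(1)[OF assms(1,1)] moebius_denom_bounds(3)[OF assms] by simp

lemma complete_pick_kernel_cert:
  assumes a: "a \<in> third_disc" shows "complete_pick_kernel third_disc (cert a)"
proof -
  have "complete_pick_kernel third_disc (\<lambda>z w. ((1 - a * cnj a) / (moebius_denom a z)\<^sup>2)
      * cnj ((1 - a * cnj a) / (moebius_denom a w)\<^sup>2)
      / (1 - (of_real (sqrt 2) * moebius a z) * cnj (of_real (sqrt 2) * moebius a w)))"
  proof (rule complete_pick_kernel_szego)
    fix z assume z: "z \<in> third_disc"
    show "cmod (of_real (sqrt 2) * moebius a z) < 1"
      by (rule power2_less_imp_less)
        (use moebius_bound(1)[OF a z] in \<open>auto simp: norm_mult power_mult_distrib\<close>)
  qed (use third_disc_ne cert_prefactor_ne_zero[OF a] in auto)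
  moreover have "(of_real (sqrt 2) * x) * cnj (of_real (sqrt 2) * y) = 2 * (x * cnj y)" for x y :: complex
  proof -
    have "(of_real (sqrt 2) * x) * cnj (of_real (sqrt 2) * y) = of_real (sqrt 2 * sqrt 2) * (x * cnj y)"
      by (simp only: of_real_mult complex_cnj_mult complex_cnj_complex_of_real mult_ac)
    then show ?thesis by simp
  qed
  ultimately show ?thesis by (simp only: cert_def[abs_def])
qed

lemma cert_eq_bergman:
  assumes "a \<in> third_disc" "z \<in> third_disc" "w \<in> third_disc"
  defines "m \<equiv> moebius a z * cnj (moebius a w)"
  shows "cert a z w = (1 + m\<^sup>2 * (1 / (1 - 2 * m))) * bergman_kernel z w"
proof -
  have n: "1 - m \<noteq> 0" "1 - 2 * m \<noteq> 0" using one_minus_moebius_ne_zero[OF assms(1-3)] by (auto simp: m_def)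
  have "cert a z w = bergman_kernel z w * (1 - m)\<^sup>2 / (1 - 2 * m)"
    by (simp only: cert_def bergman_moebius[OF assms(1-3), folded m_def, symmetric] m_def)
  also have "(1 - m)\<^sup>2 = (1 - 2 * m) + m\<^sup>2" by (simp add: power2_eq_square algebra_simps)
  finally show ?thesis using n by (simp add: field_simps)
qed

lemma strong_shimorin_certificate_cert:
  assumes a: "a \<in> third_disc"
  shows "strong_shimorin_certificate third_disc bergman_kernel third_szego (cert a)"
proof -
  let ?m = "\<lambda>z w. moebius a z * cnj (moebius a w)"
  let ?\<rho> = "\<lambda>z. (1 - a * cnj a) / (moebius_denom a z)\<^sup>2"
  define h where "h z w = (?m z w)\<^sup>2 * (1 / (1 - ?m z w))\<^sup>2" for z w
  define g where "g z w = 1 / ?\<rho> z * ((1 - 2 * ?m z w) * third_szego z w) * cnj (1 / ?\<rho> w)" for z w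
  have "kernel_on third_disc h"
    unfolding kernel_on_iff_psd_on h_def
    by (intro conjI third_disc_ne psd_on_Schur_product[OF psd_on_power[OF psd_on_rank_one]
          psd_on_power[OF psd_on_inverse_moebius(2)[OF a]]])
  moreover have "kernel_on third_disc g"
    unfolding kernel_on_iff_psd_on g_def
    by (intro conjI third_disc_ne psd_on_congruence[OF psd_on_third_szego_certificate[OF a]])
  moreover have "bergman_kernel z w = (1 - h z w) * cert a z w \<and> third_szego z w = cert a z w * g z w"
    if zw: "z \<in> third_disc" "w \<in> third_disc" for z w
  proof
    define m where "m = ?m z w"
    have n: "1 - m \<noteq> 0" "1 - 2 * m \<noteq> 0" using one_minus_moebius_ne_zero[OF a zw] by (auto simp: m_def)
    have "(1 - h z w) * cert a z w
        = (1 - m\<^sup>2 / (1 - m)\<^sup>2) * (1 + m\<^sup>2 / (1 - 2 * m)) * bergman_kernel z w"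
      unfolding cert_eq_bergman[OF a zw] h_def m_def[symmetric] by (simp add: power_one_over)
    also have "1 - m\<^sup>2 / (1 - m)\<^sup>2 = (1 - 2 * m) / (1 - m)\<^sup>2"
      using n by (simp add: divide_simps) (simp add: power2_eq_square algebra_simps)
    also have "1 + m\<^sup>2 / (1 - 2 * m) = (1 - m)\<^sup>2 / (1 - 2 * m)"
      using n by (simp add: divide_simps) (simp add: power2_eq_square algebra_simps)
    finally show "bergman_kernel z w = (1 - h z w) * cert a z w" using n by simp
    define P R where "P = ?\<rho> z" and "R = cnj (?\<rho> w)"
    have PR: "P \<noteq> 0" "R \<noteq> 0"
      unfolding P_def R_def complex_cnj_zero_iff using cert_prefactor_ne_zero[OF a] zw by blast+
    have "cert a z w = P * R / (1 - 2 * m)" by (simp only: cert_def P_def R_def m_def)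
    moreover have "g z w = (1 / P) * ((1 - 2 * m) * third_szego z w) * (1 / R)"
      by (simp add: g_def P_def R_def m_def)
    ultimately show "third_szego z w = cert a z w * g z w" using n PR by simp
  qed
  ultimately show ?thesis
    unfolding strong_shimorin_certificate_def using complete_pick_kernel_cert[OF a] by blast
qed

section \<open>Multiples of the Bergman kernel are not complete Pick kernels\<close>

text \<open>An extremal two-point problem: at the nodes \<open>0\<close> and \<open>1/4\<close>, take the values \<open>0\<close> and \<open>v\<close> with \<open>v\<^sup>2 = 31/256\<close>, the
  largest for which the Pick matrix is positive. The matrix is then singular, which determines the value of a solution at every
  other point, and the value forced at \<open>-1/4\<close> is too large for the Pick condition at \<open>0\<close> and \<open>-1/4\<close>.\<close>

lemma not_complete_pick_kernel_bergman_multiple: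
  assumes c: "c > 0" and s: "\<And>z w. z \<in> third_disc \<Longrightarrow> w \<in> third_disc \<Longrightarrow> s z w = of_real c * bergman_kernel z w"
  shows "\<not> complete_pick_kernel third_disc s"
proof
  assume "complete_pick_kernel third_disc s"
  then have cp: "complete_pick_pair third_disc s s" by (simp add: complete_pick_kernel_def)
  then have ks: "kernel_on third_disc s" by (simp add: complete_pick_pair_def)
  define v :: real where "v = sqrt 31 / 16"
  have v2: "v * v = 31/256" by (simp add: v_def)
  define z :: "nat \<Rightarrow> complex" where "z i = (if i = 0 then 0 else 1/4)" for i
  define W where "W i = mat 1 1 (\<lambda>_. if i = 0 then 0 else complex_of_real v)" for i :: nat
  let ?B = "\<lambda>i j. s (z i) (z j) \<cdot>\<^sub>m 1\<^sub>m 1 - s (z i) (z j) \<cdot>\<^sub>m (W i * mat_adjoint (W j))"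
  have z: "z i \<in> third_disc" for i by (simp add: z_def third_disc_def)
  have W: "W i \<in> carrier_mat 1 1" for i by (simp add: W_def)
  have entry: "?B i j $$ (0, 0) = of_real c" if "i < 2" "j < 2" for i j :: nat
  proof -
    have m: "(W i * mat_adjoint (W j)) $$ (0, 0) = (if i = 0 \<or> j = 0 then 0 else of_real (v * v))"
      using index_mult_mat_adjoint[OF W W, of 0 0 i j] by (simp add: W_def)
    have "dim_row (W i) = 1" "dim_col (mat_adjoint (W j)) = 1"
      using W[of i] W[of j] by (auto simp: mat_adjoint_def)
    then have "?B i j $$ (0, 0) = s (z i) (z j) - s (z i) (z j) * (W i * mat_adjoint (W j)) $$ (0, 0)"
      by simp
    also have "\<dots> = of_real c"
      unfolding m v2 s[OF z z] using that
      by (auto simp: z_def bergman_kernel_def power2_eq_square)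
    finally show ?thesis .
  qed
  have "psd (2 * 1) (block_mat 2 1 ?B)"
  proof (subst psd_iff_psd_on)
    have "psd_on {..<2 * 1::nat} (\<lambda>i j. of_real c)"
      by (rule psd_on_const) (use c in \<open>simp add: less_eq_complex_def\<close>)
    then show "psd_on {..<2 * 1} (\<lambda>i j. block_mat 2 1 ?B $$ (i, j))"
    proof (rule psd_on_cong)
      fix i j :: nat assume "i \<in> {..<2 * 1}" "j \<in> {..<2 * 1}"
      then have ij: "i < 2" "j < 2" by auto
      then have "block_mat 2 1 ?B $$ (i, j) = ?B i j $$ (0, 0)" by (simp add: block_mat_def)
      then show "block_mat 2 1 ?B $$ (i, j) = of_real c" by (simp only: entry[OF ij])
    qed
  qed (simp add: block_mat_def)
  then have "(\<forall>i<2. z i \<in> third_disc \<and> W i \<in> carrier_mat 1 1) \<and> psd (2 * 1) (block_mat 2 1 ?B)"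
    using z W by blast
  then have "\<exists>\<Phi>\<in>Mult third_disc s s 1. mult_norm third_disc s s 1 \<Phi> \<le> 1 \<and> (\<forall>i<2. \<Phi> (z i) = W i)"
    by (rule cp[unfolded complete_pick_pair_def, THEN conjunct2, THEN conjunct2, THEN spec[of _ 2], THEN mp,
          THEN spec[of _ 1], THEN mp, THEN spec[of _ z], THEN spec[of _ W], THEN mp, rotated 2]) simp_all
  then obtain \<Phi> where \<Phi>: "\<Phi> \<in> Mult third_disc s s 1" "mult_norm third_disc s s 1 \<Phi> \<le> 1"
      "\<forall>i<2. \<Phi> (z i) = W i" by blast
  define \<phi> where "\<phi> z = \<Phi> z $$ (0, 0)" for z
  have \<phi>0: "\<phi> 0 = 0" and \<phi>r: "\<phi> (1/4) = of_real v"
    using \<Phi>(3)[rule_format, of 0] \<Phi>(3)[rule_format, of 1] by (auto simp: \<phi>_def z_def W_def)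
  define P where "P z w = bergman_kernel z w * (1 - \<phi> z * cnj (\<phi> w))" for z w
  have "psd_on third_disc (\<lambda>z w. of_real (1 / c) * (s z w - s z w * (\<phi> z * cnj (\<phi> w))))"
    using psd_if_contractive_multiplier[OF ks ks \<Phi>(1,2)] c
    by (intro psd_on_scale) (auto simp: \<phi>_def less_eq_complex_def)
  then have "psd_on third_disc P"
    by (rule psd_on_cong) (use c in \<open>simp add: P_def s field_simps\<close>)
  then have "psd_on third_disc (\<lambda>z w. P z w - P z 0 * P 0 w / P 0 0)"
    by (rule psd_on_schur_complement) (simp add: third_disc_def)
  then have P': "psd_on third_disc (\<lambda>z w. P z w - 1)"
    by (rule psd_on_cong) (simp add: P_def \<phi>0 bergman_kernel_def)
  have mem: "1/4 \<in> third_disc" "-1/4 \<in> third_disc" by (auto simp: third_disc_def)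
  have "P (1/4) (1/4) = bergman_kernel (1/4) (1/4) * (1 - of_real (v * v))"
    by (simp add: P_def \<phi>r)
  \<comment> \<open>Extremality of \<open>v\<close>: the Schur complement at the node \<open>0\<close> vanishes at \<open>1/4\<close>.\<close>
  then have "P (1/4) (1/4) - 1 = 0" unfolding v2 by (simp add: bergman_kernel_def power2_eq_square)
  from psd_on_zero_diag[OF P' mem(2,1) this]
  have "bergman_kernel (1/4) (-1/4) * (1 - of_real v * cnj (\<phi> (-1/4))) = 1"
    by (simp add: P_def \<phi>r)
  moreover have "bergman_kernel (1/4) (-1/4) = 256/289"
    by (simp add: bergman_kernel_def power2_eq_square)
  ultimately have "256/289 * (1 - of_real v * cnj (\<phi> (-1/4))) = 1" by (simp only:)
  then have "289/256 * (256/289 * (1 - of_real v * cnj (\<phi> (-1/4)))) = 289/256" by (simp only: mult_1_right)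
  then have "1 - of_real v * cnj (\<phi> (-1/4)) = 289/256" by (simp only: mult.assoc[symmetric]) simp
  then have "of_real v * cnj (\<phi> (-1/4)) = 1 - 289/256" by (simp only: diff_eq_eq eq_diff_eq add.commute)
  then have "of_real v * cnj (\<phi> (-1/4)) = - (33/256)" by simp
  then have "cmod (of_real v * cnj (\<phi> (-1/4))) = 33/256" by simp
  then have "(v * cmod (\<phi> (-1/4)))\<^sup>2 = (33/256)\<^sup>2" by (simp add: norm_mult v_def)
  then have sz: "31 / 256 * (cmod (\<phi> (-1/4)))\<^sup>2 = (33/256)\<^sup>2"
    by (simp add: power_mult_distrib power2_eq_square[of v] v2)
  have "0 \<le> P (-1/4) (-1/4) - 1" by (rule psd_on_diag[OF P' mem(2)])
  also have "P (-1/4) (-1/4) = of_real (256/225 * (1 - (cmod (\<phi> (-1/4)))\<^sup>2))"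
    unfolding P_def of_real_mult of_real_diff of_real_1 complex_norm_square
    by (simp add: bergman_kernel_def power2_eq_square)
  finally have "0 \<le> 256/225 * (1 - (cmod (\<phi> (-1/4)))\<^sup>2) - 1"
    by (simp add: less_eq_complex_def)
  with sz show False by (simp add: power2_eq_square)
qed

section \<open>There is no smallest certificate\<close>

text \<open>Subdividing the segment from \<open>0\<close> to \<open>z\<close> into \<open>N\<close> pieces bounds the increment by \<open>C |z|\<^sup>2 / N\<close>.\<close>

lemma constant_if_quadratic_modulus:
  fixes f :: "complex \<Rightarrow> complex"
  assumes f: "\<And>x y. x \<in> third_disc \<Longrightarrow> y \<in> third_disc \<Longrightarrow> cmod (f x - f y) \<le> C * (cmod (x - y))\<^sup>2"
    and z: "z \<in> third_disc"
  shows "f z = f 0"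
proof -
  have le: "cmod (f z - f 0) \<le> C * (cmod z)\<^sup>2 * (1 / real (Suc n))" for n
  proof -
    define N where "N = Suc n"
    define x where "x i = of_real (real i / real N) * z" for i
    have x: "x i \<in> third_disc" if "i \<le> N" for i
    proof -
      have "cmod (x i) \<le> 1 * cmod z"
        unfolding x_def norm_mult norm_of_real by (intro mult_right_mono) (use that in \<open>auto simp: N_def\<close>)
      then show ?thesis using z by (simp add: third_disc_def)
    qed
    have "f z - f 0 = (\<Sum>i<N. f (x (Suc i)) - f (x i))"
      by (subst sum_lessThan_telescope) (simp add: x_def N_def)
    also have "cmod \<dots> \<le> (\<Sum>i<N. C * (cmod z)\<^sup>2 * (1 / (real N)\<^sup>2))"
    proof (rule order_trans[OF norm_sum], rule sum_mono)
      fix i assume i: "i \<in> {..<N}"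
      have "real (Suc i) / real N - real i / real N = 1 / real N"
        by (simp add: diff_divide_distrib[symmetric])
      then have "x (Suc i) - x i = of_real (1 / real N) * z"
        by (simp only: x_def left_diff_distrib[symmetric] of_real_diff[symmetric])
      then have "(cmod (x (Suc i) - x i))\<^sup>2 = (cmod z)\<^sup>2 * (1 / (real N)\<^sup>2)"
        by (simp add: norm_mult norm_divide power_mult_distrib power_divide)
      then show "cmod (f (x (Suc i)) - f (x i)) \<le> C * (cmod z)\<^sup>2 * (1 / (real N)\<^sup>2)"
        using f[OF x x, of "Suc i" i] i by simp
    qed
    also have "\<dots> = C * (cmod z)\<^sup>2 * (1 / real N)"
      by (simp add: N_def power2_eq_square)
    finally show ?thesis by (simp add: N_def)
  qed
  have "(\<lambda>n. C * (cmod z)\<^sup>2 * (1 / real (Suc n))) \<longlonglongrightarrow> C * (cmod z)\<^sup>2 * 0"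
    using LIMSEQ_inverse_real_of_nat by (intro tendsto_intros) (simp add: inverse_eq_divide)
  then have "cmod (f z - f 0) \<le> 0"
    by (intro LIMSEQ_le_const[where X = "\<lambda>n. C * (cmod z)\<^sup>2 * (1 / real (Suc n))"]) (use le in auto)
  then show ?thesis by simp
qed

text \<open>Write \<open>K\<close> for the quotient of the certificate at \<open>a\<close> by the Bergman kernel. Then \<open>g = K (1 - h)\<close>, so \<open>K - g = K h\<close> is
  positive and \<open>g\<close> is dominated by \<open>K\<close>. On the diagonal \<open>K - 1\<close> vanishes to fourth order at \<open>a\<close>, so the second
  difference of \<open>g\<close> at \<open>z\<close>, \<open>a\<close> is of fourth order as well and \<open>g z w - g a w\<close> is of second order; the
  same then holds for \<open>h\<close>.\<close>

lemma quotient_quadratic_modulus: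
  assumes s: "\<And>z w. z \<in> third_disc \<Longrightarrow> w \<in> third_disc \<Longrightarrow> bergman_kernel z w = (1 - h z w) * s z w"
    and h: "psd_on third_disc h" and ss: "\<And>z. z \<in> third_disc \<Longrightarrow> 0 \<le> s z z"
    and g: "psd_on third_disc g"
    and gs: "\<And>z w. z \<in> third_disc \<Longrightarrow> w \<in> third_disc \<Longrightarrow> cert a z w = g z w * s z w"
    and a: "a \<in> third_disc" and z: "z \<in> third_disc" and w: "w \<in> third_disc"
  shows "cmod (h z w - h a w) \<le> 8 * (cmod (z - a))\<^sup>2"
proof -
  let ?m = "\<lambda>z w. moebius a z * cnj (moebius a w)"
  define r where "r = (cmod (moebius a z))\<^sup>2"
  define K where "K z w = 1 + (?m z w)\<^sup>2 * (1 / (1 - 2 * ?m z w))" for z w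
  have K: "psd_on third_disc K"
    unfolding K_def
    by (rule psd_on_add[OF psd_on_const psd_on_Schur_product[OF psd_on_power[OF psd_on_rank_one] psd_on_inverse_moebius(1)[OF a]]])
      (simp add: less_eq_complex_def)
  have Ka: "K a y = 1" "K y a = 1" for y by (simp_all add: K_def)
  have snz: "s x y \<noteq> 0" if "x \<in> third_disc" "y \<in> third_disc" for x y
    using s[OF that] one_minus_ne_zero(1)[OF that] by (auto simp: bergman_kernel_def)
  have gK: "g x y = K x y * (1 - h x y)" if "x \<in> third_disc" "y \<in> third_disc" for x y
  proof -
    have "g x y * s x y = (K x y * (1 - h x y)) * s x y"
      by (simp only: gs[OF that, symmetric] cert_eq_bergman[OF a that] s[OF that] K_def mult.assoc)
    then show ?thesis using snz[OF that] by simp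
  qed
  have Kh: "psd_on third_disc (\<lambda>x y. K x y * h x y)" by (rule psd_on_Schur_product[OF K h])
  have h_diag: "0 \<le> Re (h x x)" "Re (h x x) \<le> 1" "Im (h x x) = 0" if "x \<in> third_disc" for x
  proof -
    show h0: "0 \<le> Re (h x x)" "Im (h x x) = 0" using psd_on_diag[OF h that] by (auto simp: less_eq_complex_def)
    have "0 \<le> Re (bergman_kernel x x)" "bergman_kernel x x \<noteq> 0"
      using psd_on_diag[OF psd_on_bergman that] one_minus_ne_zero(1)[OF that that]
      by (auto simp: less_eq_complex_def bergman_kernel_def)
    moreover have "Im (bergman_kernel x x) = 0" using psd_on_diag[OF psd_on_bergman that] by (simp add: less_eq_complex_def)
    ultimately have "0 < Re (bergman_kernel x x)" by (auto simp: complex_eq_iff)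
    also have "Re (bergman_kernel x x) = (1 - Re (h x x)) * Re (s x x)"
      using s[OF that that] ss[OF that] h0 by (simp add: less_eq_complex_def)
    finally show "Re (h x x) \<le> 1" using ss[OF that]
      by (auto simp: less_eq_complex_def zero_less_mult_iff)
  qed
  have mod_K: "cmod (K x y - 1) \<le> 4 * (cmod (moebius a x) * cmod (moebius a y))\<^sup>2"
    if "x \<in> third_disc" "y \<in> third_disc" for x y
  proof -
    have "cmod (K x y - 1) = (cmod (?m x y))\<^sup>2 / cmod (1 - 2 * ?m x y)"
      by (simp add: K_def norm_mult norm_divide norm_power)
    also have "\<dots> \<le> (cmod (?m x y))\<^sup>2 / (1/4)"
      using one_minus_moebius_ne_zero(3)[OF a that]
      by (intro divide_left_mono mult_pos_pos) auto
    finally show ?thesis by (simp add: norm_mult)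
  qed
  have b: "(cmod (moebius a x))\<^sup>2 \<le> 3/8" if "x \<in> third_disc" for x by (rule moebius_bound(1)[OF a that])
  \<comment> \<open>Both kernels in \<open>b = (1 - h) s\<close> are nonnegative on the diagonal, so \<open>h \<le> 1\<close> there.\<close>
  have u2: "cmod (1 - h z w) \<le> 2"
  proof -
    have "(cmod (h z w - 0))\<^sup>2 \<le> 1"
    proof -
      have "0 \<le> Re (h w w)" "Re (h w w) \<le> 1" "0 \<le> Re (h z z)" "Re (h z z) \<le> 1" using h_diag z w by auto
      then have "Re (h z z) * Re (h w w) \<le> 1 * 1" by (intro mult_mono) auto
      moreover have "(cmod (h z w))\<^sup>2 \<le> Re (h z z) * Re (h w w)"
        using psd_on_cauchy_schwarz[OF h z w] .
      ultimately show ?thesis by simp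
    qed
    then have "cmod (h z w) \<le> 1" by (simp add: power_le_one_iff abs_square_le_1)
    then show ?thesis using norm_triangle_ineq4[of 1 "h z w"] by simp
  qed
  have diff_g: "(cmod (g z w - g a w))\<^sup>2 \<le> (3 * r)\<^sup>2"
  proof -
    have "0 \<le> Re (K z z * h z z - K z a * h z a - K a z * h a z + K a a * h a a)"
      using psd_on_two_points[OF Kh z a, of 1 "-1"] by (simp add: less_eq_complex_def)
    then have "Re (g z z - g z a - g a z + g a a) \<le> Re (K z z - 1)"
      unfolding gK[OF z z] gK[OF z a] gK[OF a z] gK[OF a a] Ka by (simp add: algebra_simps)
    also have "\<dots> \<le> 4 * r\<^sup>2"
      using complex_Re_le_cmod[of "K z z - 1"] mod_K[OF z z] by (simp add: r_def power2_eq_square)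
    finally have 1: "Re (g z z - g z a - g a z + g a a) \<le> 4 * r\<^sup>2" .
    have "0 \<le> Re (K w w * h w w)" using psd_on_diag[OF Kh w] by (simp add: less_eq_complex_def)
    then have "Re (g w w) \<le> Re (K w w)" unfolding gK[OF w w] by (simp add: algebra_simps)
    also have "\<dots> \<le> 1 + 4 * ((cmod (moebius a w))\<^sup>2)\<^sup>2"
      using complex_Re_le_cmod[of "K w w - 1"] mod_K[OF w w] by (simp add: power2_eq_square)
    also have "\<dots> \<le> 1 + 4 * (3/8)\<^sup>2"
      using power_mono[OF b[OF w], of 2] by simp
    finally have 2: "Re (g w w) \<le> 2" by (simp add: power2_eq_square)
    have "0 \<le> Re (g w w)" using psd_on_diag[OF g w] by (simp add: less_eq_complex_def)
    have "(cmod (g z w - g a w))\<^sup>2 \<le> Re (g z z - g z a - g a z + g a a) * Re (g w w)"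
      by (rule psd_on_diff_bound[OF g z a w])
    also have "\<dots> \<le> (4 * r\<^sup>2) * 2"
      using 1 2 \<open>0 \<le> Re (g w w)\<close> by (intro mult_mono) auto
    also have "\<dots> \<le> (3 * r)\<^sup>2" by (simp add: power2_eq_square)
    finally show ?thesis .
  qed
  have r: "0 \<le> r" by (simp add: r_def)
  \<comment> \<open>Uses \<open>K a w = 1\<close>: the increment of \<open>g = K (1 - h)\<close> splits into those of \<open>K\<close> and of \<open>h\<close>.\<close>
  have "h z w - h a w = (1 - h z w) * (K z w - 1) - (g z w - g a w)"
    unfolding gK[OF z w] gK[OF a w] Ka by (simp add: algebra_simps)
  then have "cmod (h z w - h a w) \<le> cmod (1 - h z w) * cmod (K z w - 1) + cmod (g z w - g a w)"
    by (metis norm_mult norm_triangle_ineq4)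
  also have "cmod (g z w - g a w) \<le> 3 * r"
    using diff_g by (rule power2_le_imp_le) (use r in simp)
  also have "cmod (1 - h z w) * cmod (K z w - 1) \<le> 2 * (4 * (r * (3/8)))"
  proof (intro mult_mono u2)
    have "cmod (K z w - 1) \<le> 4 * (r * (cmod (moebius a w))\<^sup>2)"
      using mod_K[OF z w] by (simp add: r_def power_mult_distrib)
    also have "\<dots> \<le> 4 * (r * (3/8))" using mult_left_mono[OF b[OF w] r] by simp
    finally show "cmod (K z w - 1) \<le> 4 * (r * (3/8))" .
  qed auto
  also have "r \<le> (9/8 * cmod (z - a))\<^sup>2"
    unfolding r_def by (intro power_mono moebius_bound(2)[OF a z]) auto
  finally have "cmod (h z w - h a w) \<le> 243/32 * (cmod (z - a))\<^sup>2" by (simp add: power_mult_distrib power2_eq_square)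
  then show ?thesis using zero_le_power2[of "cmod (z - a)"] by linarith
qed

text \<open>If every certificate based at a point \<open>a\<close> had the factor \<open>s\<close>, the quotient of the Bergman kernel by \<open>s\<close> would have
  increments of second order at every \<open>a\<close>, hence would be constant, and \<open>s\<close> would be a multiple of the Bergman kernel.\<close>

theorem no_smallest_certificate:
  assumes s: "strong_shimorin_certificate third_disc bergman_kernel third_szego s"
    and min: "\<And>a. a \<in> third_disc \<Longrightarrow> kernel_factor third_disc s (cert a)"
  shows False
proof -
  obtain h where cp: "complete_pick_kernel third_disc s" and kh: "kernel_on third_disc h"
    and bs: "\<And>z w. z \<in> third_disc \<Longrightarrow> w \<in> third_disc \<Longrightarrow> bergman_kernel z w = (1 - h z w) * s z w"
    using s unfolding strong_shimorin_certificate_def by blast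
  have h: "psd_on third_disc h" using kh by (simp add: kernel_on_iff_psd_on)
  have ps: "psd_on third_disc s"
    using cp by (simp add: complete_pick_kernel_def complete_pick_pair_def kernel_on_iff_psd_on)
  have mod: "cmod (h x w - h y w) \<le> 8 * (cmod (x - y))\<^sup>2"
    if x: "x \<in> third_disc" and y: "y \<in> third_disc" and w: "w \<in> third_disc" for x y w
  proof -
    obtain g where "kernel_on third_disc g"
        "\<And>z w. z \<in> third_disc \<Longrightarrow> w \<in> third_disc \<Longrightarrow> cert y z w = g z w * s z w"
      using min[OF y] unfolding kernel_factor_def by blast
    then show ?thesis
      by (intro quotient_quadratic_modulus[OF bs h psd_on_diag[OF ps] _ _ y x w])
        (auto simp: kernel_on_iff_psd_on)
  qed
  have h_left: "h z w = h 0 w" if "z \<in> third_disc" "w \<in> third_disc" for z w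
    by (rule constant_if_quadratic_modulus[where f = "\<lambda>z. h z w", OF mod that(1)]) (use that in auto)
  have zero: "0 \<in> third_disc" by (simp add: third_disc_def)
  have h_const: "h z w = h 0 0" if "z \<in> third_disc" "w \<in> third_disc" for z w
    using h_left[OF that] h_left[OF that(2) zero] psd_on_hermitian[OF h that(2) zero]
      psd_on_hermitian[OF h zero zero] by simp
  define u where "u = 1 - Re (h 0 0)"
  have h00: "1 - h 0 0 = of_real u"
    using psd_on_diag[OF h zero] by (simp add: u_def complex_eq_iff less_eq_complex_def)
  have one: "of_real u * s 0 0 = 1" using bs[OF zero zero] h00 by (simp add: bergman_kernel_def)
  have "u * Re (s 0 0) = Re (of_real u * s 0 0)" by simp
  then have "u * Re (s 0 0) = 1" by (simp only: one one_complex.sel)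
  moreover have "0 \<le> Re (s 0 0)" using psd_on_diag[OF ps zero] by (simp add: less_eq_complex_def)
  ultimately have "u > 0" using mult_nonpos_nonneg[of u "Re (s 0 0)"] by (cases "u > 0") auto
  moreover have "s z w = of_real (1 / u) * bergman_kernel z w" if "z \<in> third_disc" "w \<in> third_disc" for z w
    using bs[OF that] h_const[OF that] h00 \<open>u > 0\<close> by simp
  ultimately show False using not_complete_pick_kernel_bergman_multiple[of "1 / u" s] cp by simp
qed

theorem corollary8p4:
  fixes l :: "complex \<Rightarrow> complex \<Rightarrow> complex"
  defines "l \<equiv> \<lambda>z w. 1 / (1 - 9 * z * cnj w)"
  shows "complete_pick_pair third_disc bergman_kernel l \<and>
    \<not> (\<exists>s. strong_shimorin_certificate third_disc bergman_kernel l s \<and>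
          (\<forall>t. strong_shimorin_certificate third_disc bergman_kernel l t \<longrightarrow>
                kernel_factor third_disc s t))"
proof -
  have l: "l = third_szego" by (simp add: l_def third_szego_def fun_eq_iff)
  show ?thesis
    unfolding l
    using complete_pick_pair_bergman no_smallest_certificate strong_shimorin_certificate_cert by blast
qed

end
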